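(* Consider the two-level Schrödinger equation in a diabatic representation on $\mathbb{R}^m$, $$ i\varepsilon\partial_t u=-\frac{\varepsilon^2}{2}\Delta_x u+\begin{pmatrix}V_{00}&\delta V_{01}\\ \delta V_{10}&V_{11}\end{pmatrix}u,\qquad u(0,x)=\begin{pmatrix}u_0(0,x)\\0\end{pmatrix}, $$ with Hermitian matrix potential (so $V_{10}=\overline{V_{01}}$), semiclassical parameter $\varepsilon>0$ and coupling parameter $\delta>0$. Let the initial amplitude $A_0(q_0,p_0)$, the trajectory quantities $Q_s,P_s,S_s,A_s,l_s$, the phase $\Theta_t$, the functions $u_{\mathrm F}^{(n)}$, and the stochastic process $(Q_s,P_s,l_s)_{0\le s\le t}$ with random initial data be as defined in the context. Let $n$ be the random number of jumps of $l_s$ on $[0,t]$, let $t_1<\dots<t_n$ be the jump times, and set $t_0=0$. Define the trajectory average $$ \tilde u(t,x)=C_{\mathcal N}\,\mathbb{E}\left[(-i)^n\left(\prod_{j=1}^{n}\frac{V_{l_{t_j}l_{t_{j-1}}}(Q_{t_j})}{|V_{l_{t_j}l_{t_{j-1}}}(Q_{t_j})|}\right)\frac{A_t}{|A_0|}\exp\left(\frac{i}{\varepsilon}\Theta_t\right)\exp\left(\int_0^t\frac{\delta}{\varepsilon}|V_{01}(Q_s)|\,ds\right)\begin{pmatrix}\mathbb{I}_{n\text{ is even}}\\ \mathbb{I}_{n\text{ is odd}}\end{pmatrix}\right], $$ where $$ C_{\mathcal N}=\frac{1}{(2\pi\varepsilon)^{3m/2}}\int_{\mathbb{R}^{2m}}|A_0(q_0,p_0)|\,dq_0\,dp_0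 . $$ Then $\tilde u$ is a stochastic representation of the frozen Gaussian approximation surface hopping ansatz $u_{\mathrm F}$, that is, $$ \tilde u(t,x)=u_{\mathrm F}(t,x):=\begin{pmatrix}u_{\mathrm F}^{(0)}(t,x)+u_{\mathrm F}^{(2)}(t,x)+u_{\mathrm F}^{(4)}(t,x)+\cdots\\[2pt] u_{\mathrm F}^{(1)}(t,x)+u_{\mathrm F}^{(3)}(t,x)+u_{\mathrm F}^{(5)}(t,x)+\cdots\end{pmatrix}. $$
   Context: Initial amplitude: for $(q_0,p_0)\in\mathbb{R}^{2m}$, $$A_0(q_0,p_0)=2^{m/2}\int_{\mathbb{R}^m}u_0(0,y)\exp\left(\frac{i}{\varepsilon}\left(-p_0\cdot(y-q_0)+\frac{i}{2}|y-q_0|^2\right)\right)dy.$$ Trajectories with given hopping times: given $(q_0,p_0)$ and $0<t_1<\dots<t_n<t$ (with $n\ge0$), let $l_s\in\{0,1\}$ be the right-continuous, piecewise constant function on $[0,t]$ with $l_0=0$ that switches value between $0$ and $1$ exactly at the times $t_1,\dots,t_n$. The quantities $Q_s,P_s\in\mathbb{R}^m$, $S_s\in\mathbb{R}$, $A_s\in\mathbb{C}$ are continuous in $s$ (in particular across each $t_j$) and, away from the hopping times, solve $$\frac{d}{ds}Q=P,\qquad \frac{d}{ds}P=-\nabla V_{l_sl_s}(Q),\qquad \frac{d}{ds}S=\frac12|P|^2-V_{l_sl_s}(Q),$$ $$\frac{d}{ds}A=\frac12 A\,\mathrm{tr}\left(Z^{-1}\left(\partial_zP-i\,\partial_zQ\,\nabla^2V_{l_sl_s}(Q)\right)\right),$$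 with initial values $Q_0=q_0$, $P_0=p_0$, $S_0=0$, and $A$ equal to $A_0(q_0,p_0)$ at $s=0$. Here $\partial_z=\partial_{q_0}-i\partial_{p_0}$ denotes differentiation with respect to the initial data (hopping times held fixed), $(\partial_zQ)_{jk}=\partial_{z_j}Q_k$ (similarly for $P$), and $Z=\partial_z(Q+iP)$. Define $$\Theta_t=S_t+P_t\cdot(x-Q_t)+\frac{i}{2}|x-Q_t|^2.$$ Ansatz terms: with $t_0=0$ and $dT_{n:1}=dt_1\cdots dt_n$, $$u_{\mathrm F}^{(n)}(t,x)=\left(\frac{-i\delta}{\varepsilon}\right)^n\frac{1}{(2\pi\varepsilon)^{3m/2}}\int_{\mathbb{R}^{2m}}dq_0\,dp_0\int_{0<t_1<\dots<t_n<t}dT_{n:1}\ \prod_{j=1}^nV_{l_{t_j}l_{t_{j-1}}}(Q_{t_j})\,A_t\exp\left(\frac{i}{\varepsilon}\Theta_t\right),$$ where the integrand is evaluated along the trajectory determined by $(q_0,p_0)$ and $(t_1,\dots,t_n)$; for $n=0$ there is no time integral and the product is $1$. Stochastic process: $(Q_0,P_0)=(q_0,p_0)$ is random with probability density $|A_0(q_0,p_0)|\big/\int_{\mathbb{R}^{2m}}|A_0|$ on $\mathbb{R}^{2m}$, and $l_0=0$. In $(Q_s,P_s,l_s)$, the pair $(Q_s,P_s)$ is continuous and follows $\dot Q=P$, $\dot P=-\nabla V_{l_sl_s}(Q)$, while $l_s$ is a Markov jump process on $\{0,1\}$ with $\mathbb{P}(l_{s+h}=k\mid l_s=j,Q_s=q)=\mathbb{I}_{j=k}+\lambda_{jk}(q)h+o(h)$,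 where $\lambda_{01}=\lambda_{10}=\frac{\delta}{\varepsilon}|V_{01}|$ and $\lambda_{00}=\lambda_{11}=-\frac{\delta}{\varepsilon}|V_{01}|$. The process $l_s$ is piecewise constant with almost surely finitely many jumps. Along each realization, with realized initial data $(q_0,p_0)$ and realized jump times $t_1<\dots<t_n$, the quantities $S_s$, $A_s$, $\Theta_t$ are those of the trajectory determined by $(q_0,p_0)$ and these hopping times. $\mathbb{I}$ denotes an indicator, and $\mathbb{E}$ is the expectation over both the initial data and the jumps. *)

theory Defs
  imports "HOL-Probability.Probability" "HOL-Library.Landau_Symbols"
begin

section \<open>Calculus in coordinates\<close>

definition partial_deriv :: "'m \<Rightarrow> (real^'m::finite \<Rightarrow> real) \<Rightarrow> real^'m \<Rightarrow> real" where
  "partial_deriv j f x = deriv (\<lambda>h. f (x + h *\<^sub>R axis j 1)) 0"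

definition grad :: "(real^'m::finite \<Rightarrow> real) \<Rightarrow> real^'m \<Rightarrow> real^'m" where
  "grad f x = (\<chi> j. partial_deriv j f x)"

definition hess :: "(real^'m::finite \<Rightarrow> real) \<Rightarrow> real^'m \<Rightarrow> real^'m^'m" where
  "hess f x = (\<chi> j k. partial_deriv j (partial_deriv k f) x)"

definition C2 :: "(real^'m::finite \<Rightarrow> real) \<Rightarrow> bool" where
  "C2 f \<longleftrightarrow> f differentiable_on UNIV
      \<and> (\<forall>j. partial_deriv j f differentiable_on UNIV)
      \<and> (\<forall>j k. continuous_on UNIV (partial_deriv j (partial_deriv k f)))"

text \<open>For a map \<open>F\<close> of the initial data \<open>(q, p)\<close>, the matrix with entries
  \<open>(d/dq_j - i d/dp_j) F_k\<close> in row \<open>j\<close> and column \<open>k\<close>.\<close>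

definition dz :: "(real^'m::finite \<Rightarrow> real^'m \<Rightarrow> real^'m) \<Rightarrow> real^'m \<Rightarrow> real^'m \<Rightarrow> complex^'m^'m" where
  "dz F q p = (\<chi> j k. complex_of_real (partial_deriv j (\<lambda>q'. F q' p $ k) q)
                    - \<i> * complex_of_real (partial_deriv j (\<lambda>p'. F q p' $ k) p))"


section \<open>Matrix potential and initial amplitude\<close>

text \<open>The matrix potential is \<open>V j k x\<close> with \<open>j, k < 2\<close>; the coupling parameter
  \<open>\<delta>\<close> multiplying the off-diagonal entries is kept separate.  Other indices are never used.\<close>

type_synonym 'm potential = "nat \<Rightarrow> nat \<Rightarrow> real^'m \<Rightarrow> complex"

definition hermitian_potential :: "'m::finite potential \<Rightarrow> bool" where
  "hermitian_potential V \<longleftrightarrow> (\<forall>j<2. \<forall>k<2. \<forall>x. V k j x = cnj (V j k x))"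

text \<open>The diagonal entries of a Hermitian matrix are real.\<close>

definition surface :: "'m::finite potential \<Rightarrow> nat \<Rightarrow> real^'m \<Rightarrow> real" where
  "surface V l x = Re (V l l x)"

definition init_amp :: "real \<Rightarrow> (real^'m::finite \<Rightarrow> complex) \<Rightarrow> real^'m \<Rightarrow> real^'m \<Rightarrow> complex" where
  "init_amp \<epsilon> u0 q p = complex_of_real (2 powr (real CARD('m) / 2)) *
     (LINT y|lborel. u0 y * exp (\<i> / \<epsilon> * (complex_of_real (- (p \<bullet> (y - q)))
                                          + \<i> / 2 * complex_of_real ((norm (y - q))\<^sup>2))))"


section \<open>Trajectories with given hopping times\<close>

definition hop_times :: "real \<Rightarrow> real list \<Rightarrow> bool" where
  "hop_times t ts \<longleftrightarrow> sorted_wrt (<) ts \<and> set ts \<subseteq> {0<..<t}"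

definition level :: "real list \<Rightarrow> real \<Rightarrow> nat" where
  "level ts s = length (filter (\<lambda>r. r \<le> s) ts) mod 2"

text \<open>\<open>trajectory\<close> fixes the hopping times \<open>ts\<close> and describes the whole family of
  trajectories over all initial data, because the amplitude equation differentiates with respect
  to the initial data.  Differentiability in the initial data and invertibility of \<open>Z\<close> are
  what give \<open>dz\<close> and \<open>matrix_inv\<close> their meaning; for \<open>C2\<close> surfaces
  both follow from the equations for \<open>Q\<close> and \<open>P\<close>.\<close>

definition Z_matrix :: "(real^'m::finite \<Rightarrow> real^'m \<Rightarrow> real^'m) \<Rightarrow> (real^'m \<Rightarrow> real^'m \<Rightarrow> real^'m)
    \<Rightarrow> real^'m \<Rightarrow> real^'m \<Rightarrow> complex^'m^'m" where
  "Z_matrix Q P q p = (\<chi> j k. dz Q q p $ j $ k + \<i> * dz P q p $ j $ k)"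

definition amp_rate :: "(real^'m::finite \<Rightarrow> real) \<Rightarrow> (real^'m \<Rightarrow> real^'m \<Rightarrow> real^'m)
    \<Rightarrow> (real^'m \<Rightarrow> real^'m \<Rightarrow> real^'m) \<Rightarrow> real^'m \<Rightarrow> real^'m \<Rightarrow> complex" where
  "amp_rate W Q P q p =
     1/2 * trace (matrix_inv (Z_matrix Q P q p) **
       (dz P q p - (\<chi> j k. \<i> * (dz Q q p ** (\<chi> a b. complex_of_real (hess W (Q q p) $ a $ b))) $ j $ k)))"

definition trajectory :: "'m::finite potential \<Rightarrow> real \<Rightarrow> (real^'m \<Rightarrow> complex) \<Rightarrow> real \<Rightarrow> real list
    \<Rightarrow> (real^'m \<Rightarrow> real^'m \<Rightarrow> real \<Rightarrow> real^'m) \<Rightarrow> (real^'m \<Rightarrow> real^'m \<Rightarrow> real \<Rightarrow> real^'m)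
    \<Rightarrow> (real^'m \<Rightarrow> real^'m \<Rightarrow> real \<Rightarrow> real) \<Rightarrow> (real^'m \<Rightarrow> real^'m \<Rightarrow> real \<Rightarrow> complex) \<Rightarrow> bool" where
  "trajectory V \<epsilon> u0 t ts Q P S A \<longleftrightarrow> (\<forall>q p.
     Q q p 0 = q \<and> P q p 0 = p \<and> S q p 0 = 0 \<and> A q p 0 = init_amp \<epsilon> u0 q p
   \<and> continuous_on {0..t} (Q q p) \<and> continuous_on {0..t} (P q p)
   \<and> continuous_on {0..t} (S q p) \<and> continuous_on {0..t} (A q p)
   \<and> (\<forall>s\<in>{0..t}.
        (\<lambda>(q', p'). Q q' p' s) differentiable (at (q, p))
      \<and> (\<lambda>(q', p'). P q' p' s) differentiable (at (q, p))
      \<and> invertible (Z_matrix (\<lambda>q' p'. Q q' p' s) (\<lambda>q' p'. P q' p' s) q p))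
   \<and> (\<forall>s\<in>{0..t} - set ts. let W = surface V (level ts s) in
        (Q q p has_vector_derivative P q p s) (at s within {0..t})
      \<and> (P q p has_vector_derivative - grad W (Q q p s)) (at s within {0..t})
      \<and> (S q p has_vector_derivative (norm (P q p s))\<^sup>2 / 2 - W (Q q p s)) (at s within {0..t})
      \<and> (A q p has_vector_derivative
            A q p s * amp_rate W (\<lambda>q' p'. Q q' p' s) (\<lambda>q' p'. P q' p' s) q p) (at s within {0..t})))"

definition phase :: "real \<Rightarrow> real^'m::finite \<Rightarrow> real^'m \<Rightarrow> real^'m \<Rightarrow> complex" where
  "phase S P Q x = complex_of_real (S + P \<bullet> (x - Q)) + \<i> / 2 * complex_of_real ((norm (x - Q))\<^sup>2)"

text \<open>Hopping times are numbered from \<open>1\<close>, with \<open>t_0 = 0\<close>: \<open>(0 # ts) ! j\<close>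
  is \<open>t_j\<close>.  The arguments \<open>L\<close> and \<open>Q\<close> are the level and position paths.\<close>

definition hop_prod :: "(nat \<Rightarrow> nat \<Rightarrow> real^'m::finite \<Rightarrow> complex) \<Rightarrow> real list \<Rightarrow> (real \<Rightarrow> nat)
    \<Rightarrow> (real \<Rightarrow> real^'m) \<Rightarrow> complex" where
  "hop_prod G ts L Q =
     (\<Prod>j=1..length ts. G (L ((0 # ts) ! j)) (L ((0 # ts) ! (j - 1))) (Q ((0 # ts) ! j)))"


section \<open>Surface hopping ansatz\<close>

text \<open>In the following, \<open>Q\<close>, \<open>P\<close>, \<open>S\<close>, \<open>A\<close> take the
  list of hopping times as first argument.\<close>

definition uF_integrand :: "'m::finite potential \<Rightarrow> real \<Rightarrow> real
    \<Rightarrow> (real list \<Rightarrow> real^'m \<Rightarrow> real^'m \<Rightarrow> real \<Rightarrow> real^'m)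
    \<Rightarrow> (real list \<Rightarrow> real^'m \<Rightarrow> real^'m \<Rightarrow> real \<Rightarrow> real^'m)
    \<Rightarrow> (real list \<Rightarrow> real^'m \<Rightarrow> real^'m \<Rightarrow> real \<Rightarrow> real)
    \<Rightarrow> (real list \<Rightarrow> real^'m \<Rightarrow> real^'m \<Rightarrow> real \<Rightarrow> complex)
    \<Rightarrow> real^'m \<Rightarrow> real^'m \<Rightarrow> real^'m \<Rightarrow> real list \<Rightarrow> complex" where
  "uF_integrand V \<epsilon> t Q P S A x q p ts =
     hop_prod V ts (level ts) (Q ts q p) * A ts q p t
     * exp (\<i> / \<epsilon> * phase (S ts q p t) (P ts q p t) (Q ts q p t) x)"

definition time_simplex :: "nat \<Rightarrow> real \<Rightarrow> (nat \<Rightarrow> real) set" where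
  "time_simplex n t = {\<tau>. hop_times t (map \<tau> [1..<Suc n])}"

definition uF_term :: "'m::finite potential \<Rightarrow> real \<Rightarrow> real \<Rightarrow> real
    \<Rightarrow> (real list \<Rightarrow> real^'m \<Rightarrow> real^'m \<Rightarrow> real \<Rightarrow> real^'m)
    \<Rightarrow> (real list \<Rightarrow> real^'m \<Rightarrow> real^'m \<Rightarrow> real \<Rightarrow> real^'m)
    \<Rightarrow> (real list \<Rightarrow> real^'m \<Rightarrow> real^'m \<Rightarrow> real \<Rightarrow> real)
    \<Rightarrow> (real list \<Rightarrow> real^'m \<Rightarrow> real^'m \<Rightarrow> real \<Rightarrow> complex)
    \<Rightarrow> real^'m \<Rightarrow> nat \<Rightarrow> complex" where
  "uF_term V \<epsilon> \<delta> t Q P S A x n =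
     (- \<i> * \<delta> / \<epsilon>) ^ n * complex_of_real (1 / (2 * pi * \<epsilon>) powr (3 * real CARD('m) / 2)) *
     (LINT z|lborel. (LINT \<tau>:time_simplex n t|(Pi\<^sub>M {1..n} (\<lambda>_. lborel)).
        uF_integrand V \<epsilon> t Q P S A x (fst z) (snd z) (map \<tau> [1..<Suc n])))"

definition uF :: "'m::finite potential \<Rightarrow> real \<Rightarrow> real \<Rightarrow> real
    \<Rightarrow> (real list \<Rightarrow> real^'m \<Rightarrow> real^'m \<Rightarrow> real \<Rightarrow> real^'m)
    \<Rightarrow> (real list \<Rightarrow> real^'m \<Rightarrow> real^'m \<Rightarrow> real \<Rightarrow> real^'m)
    \<Rightarrow> (real list \<Rightarrow> real^'m \<Rightarrow> real^'m \<Rightarrow> real \<Rightarrow> real)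
    \<Rightarrow> (real list \<Rightarrow> real^'m \<Rightarrow> real^'m \<Rightarrow> real \<Rightarrow> complex)
    \<Rightarrow> real^'m \<Rightarrow> complex \<times> complex" where
  "uF V \<epsilon> \<delta> t Q P S A x = ((\<Sum>k. uF_term V \<epsilon> \<delta> t Q P S A x (2 * k)),
                         (\<Sum>k. uF_term V \<epsilon> \<delta> t Q P S A x (2 * k + 1)))"


section \<open>Surface hopping process\<close>

definition hop_rate :: "'m::finite potential \<Rightarrow> real \<Rightarrow> real \<Rightarrow> nat \<Rightarrow> nat \<Rightarrow> real^'m \<Rightarrow> real" where
  "hop_rate V \<epsilon> \<delta> j k q = (if j = k then - (\<delta> / \<epsilon> * cmod (V 0 1 q)) else \<delta> / \<epsilon> * cmod (V 0 1 q))"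

definition jump_set :: "real \<Rightarrow> (real \<Rightarrow> nat) \<Rightarrow> real set" where
  "jump_set t L = {s \<in> {0<..t}. \<not> eventually (\<lambda>r. L r = L s) (at_left s)}"

text \<open>Together with finiteness of \<open>jump_set\<close>, right-continuity makes the path piecewise
  constant.\<close>

definition hopping_path :: "'m::finite potential \<Rightarrow> real \<Rightarrow> (real \<Rightarrow> real^'m) \<Rightarrow> (real \<Rightarrow> real^'m)
    \<Rightarrow> (real \<Rightarrow> nat) \<Rightarrow> bool" where
  "hopping_path V t Q P L \<longleftrightarrow>
     (\<forall>s\<in>{0..t}. L s \<in> {0, 1}) \<and> L 0 = 0
   \<and> (\<forall>s\<in>{0..<t}. eventually (\<lambda>r. L r = L s) (at_right s))
   \<and> finite (jump_set t L)
   \<and> continuous_on {0..t} Q \<and> continuous_on {0..t} P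
   \<and> (\<forall>s\<in>{0..t} - jump_set t L.
        (Q has_vector_derivative P s) (at s within {0..t})
      \<and> (P has_vector_derivative - grad (surface V (L s)) (Q s)) (at s within {0..t}))"

definition past :: "'w measure \<Rightarrow> (real \<Rightarrow> 'w \<Rightarrow> 'x::topological_space) \<Rightarrow> real \<Rightarrow> 'w measure" where
  "past M X s = sigma (space M) {X r -` B \<inter> space M |r B. r \<in> {0..s} \<and> B \<in> sets borel}"

definition present :: "'w measure \<Rightarrow> (real \<Rightarrow> 'w \<Rightarrow> 'x::topological_space) \<Rightarrow> real \<Rightarrow> 'w measure" where
  "present M X s = vimage_algebra (space M) (X s) borel"

definition cond_prob_given :: "'w measure \<Rightarrow> 'w measure \<Rightarrow> 'w set \<Rightarrow> 'w \<Rightarrow> real" where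
  "cond_prob_given M F E = real_cond_exp M F (indicator E)"

definition markov :: "'w measure \<Rightarrow> real \<Rightarrow> (real \<Rightarrow> 'w \<Rightarrow> 'x::topological_space) \<Rightarrow> bool" where
  "markov M t X \<longleftrightarrow> (\<forall>s r B. 0 \<le> s \<and> s \<le> r \<and> r \<le> t \<and> B \<in> sets borel \<longrightarrow>
     (AE \<omega> in M. cond_prob_given M (past M X s) (X r -` B \<inter> space M) \<omega>
               = cond_prob_given M (present M X s) (X r -` B \<inter> space M) \<omega>))"

text \<open>The Markov process is \<open>(Q, P, l)\<close>.  The remainder \<open>o(h)\<close> in the transition
  probabilities is uniform for \<open>(Q, P)\<close> in a compact set: without local uniformity, jumps
  forced on a hypersurface of phase space would not be excluded.\<close>

definition hopping_process :: "'w measure \<Rightarrow> 'm::finite potential \<Rightarrow> real \<Rightarrow> real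
    \<Rightarrow> (real^'m \<Rightarrow> complex) \<Rightarrow> real \<Rightarrow> (real \<Rightarrow> 'w \<Rightarrow> real^'m) \<Rightarrow> (real \<Rightarrow> 'w \<Rightarrow> real^'m)
    \<Rightarrow> (real \<Rightarrow> 'w \<Rightarrow> nat) \<Rightarrow> bool" where
  "hopping_process M V \<epsilon> \<delta> u0 t Q P l \<longleftrightarrow>
     prob_space M
   \<and> (\<forall>s\<in>{0..t}. Q s \<in> borel_measurable M \<and> P s \<in> borel_measurable M
                 \<and> l s \<in> measurable M (count_space UNIV))
   \<and> distributed M lborel (\<lambda>\<omega>. (Q 0 \<omega>, P 0 \<omega>))
       (\<lambda>(q, p). ennreal (cmod (init_amp \<epsilon> u0 q p)
                          / (LINT z|lborel. cmod (init_amp \<epsilon> u0 (fst z) (snd z)))))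
   \<and> (AE \<omega> in M. hopping_path V t (\<lambda>s. Q s \<omega>) (\<lambda>s. P s \<omega>) (\<lambda>s. l s \<omega>))
   \<and> markov M t (\<lambda>s \<omega>. (Q s \<omega>, P s \<omega>, l s \<omega>))
   \<and> (\<forall>K. compact K \<longrightarrow> (\<exists>R \<in> o[at_right 0](\<lambda>h. h).
        \<forall>s h. \<forall>j<2. \<forall>k<2. 0 \<le> s \<and> 0 < h \<and> s + h \<le> t \<longrightarrow>
          (AE \<omega> in M. (Q s \<omega>, P s \<omega>) \<in> K \<and> l s \<omega> = j \<longrightarrow>
             \<bar>cond_prob_given M (present M (\<lambda>s \<omega>. (Q s \<omega>, P s \<omega>, l s \<omega>)) s)
                  {\<omega>' \<in> space M. l (s + h) \<omega>' = k} \<omega>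
               - (of_bool (j = k) + hop_rate V \<epsilon> \<delta> j k (Q s \<omega>) * h)\<bar> \<le> R h)))"


section \<open>Trajectory average\<close>

text \<open>\<open>Qp\<close> and \<open>l\<close> are the position and level of the process; \<open>Q\<close>,
  \<open>P\<close>, \<open>S\<close>, \<open>A\<close> are the deterministic trajectories, evaluated at the
  realized initial data and jump times.\<close>

definition avg_integrand :: "'m::finite potential \<Rightarrow> real \<Rightarrow> real \<Rightarrow> (real^'m \<Rightarrow> complex) \<Rightarrow> real
    \<Rightarrow> (real list \<Rightarrow> real^'m \<Rightarrow> real^'m \<Rightarrow> real \<Rightarrow> real^'m)
    \<Rightarrow> (real list \<Rightarrow> real^'m \<Rightarrow> real^'m \<Rightarrow> real \<Rightarrow> real^'m)
    \<Rightarrow> (real list \<Rightarrow> real^'m \<Rightarrow> real^'m \<Rightarrow> real \<Rightarrow> real)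
    \<Rightarrow> (real list \<Rightarrow> real^'m \<Rightarrow> real^'m \<Rightarrow> real \<Rightarrow> complex)
    \<Rightarrow> (real \<Rightarrow> 'w \<Rightarrow> real^'m) \<Rightarrow> (real \<Rightarrow> 'w \<Rightarrow> real^'m) \<Rightarrow> (real \<Rightarrow> 'w \<Rightarrow> nat)
    \<Rightarrow> real^'m \<Rightarrow> 'w \<Rightarrow> complex \<times> complex" where
  "avg_integrand V \<epsilon> \<delta> u0 t Q P S A Qp Pp l x \<omega> =
    (let ts = sorted_list_of_set (jump_set t (\<lambda>s. l s \<omega>));
         n = length ts;
         q = Qp 0 \<omega>;
         p = Pp 0 \<omega>;
         Y = (- \<i>) ^ n
             * hop_prod (\<lambda>j k y. V j k y / complex_of_real (cmod (V j k y))) ts (\<lambda>s. l s \<omega>) (\<lambda>s. Qp s \<omega>)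
             * (A ts q p t / complex_of_real (cmod (init_amp \<epsilon> u0 q p)))
             * exp (\<i> / \<epsilon> * phase (S ts q p t) (P ts q p t) (Q ts q p t) x)
             * complex_of_real (exp (integral {0..t} (\<lambda>s. \<delta> / \<epsilon> * cmod (V 0 1 (Qp s \<omega>)))))
     in (Y * of_bool (even n), Y * of_bool (odd n)))"

definition C_N :: "real \<Rightarrow> (real^'m::finite \<Rightarrow> complex) \<Rightarrow> real" where
  "C_N \<epsilon> u0 = 1 / (2 * pi * \<epsilon>) powr (3 * real CARD('m) / 2)
                * (LINT z|lborel. cmod (init_amp \<epsilon> u0 (fst z) (snd z)))"

definition u_avg :: "'w measure \<Rightarrow> 'm::finite potential \<Rightarrow> real \<Rightarrow> real \<Rightarrow> (real^'m \<Rightarrow> complex) \<Rightarrow> real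
    \<Rightarrow> (real list \<Rightarrow> real^'m \<Rightarrow> real^'m \<Rightarrow> real \<Rightarrow> real^'m)
    \<Rightarrow> (real list \<Rightarrow> real^'m \<Rightarrow> real^'m \<Rightarrow> real \<Rightarrow> real^'m)
    \<Rightarrow> (real list \<Rightarrow> real^'m \<Rightarrow> real^'m \<Rightarrow> real \<Rightarrow> real)
    \<Rightarrow> (real list \<Rightarrow> real^'m \<Rightarrow> real^'m \<Rightarrow> real \<Rightarrow> complex)
    \<Rightarrow> (real \<Rightarrow> 'w \<Rightarrow> real^'m) \<Rightarrow> (real \<Rightarrow> 'w \<Rightarrow> real^'m) \<Rightarrow> (real \<Rightarrow> 'w \<Rightarrow> nat)
    \<Rightarrow> real^'m \<Rightarrow> complex \<times> complex" where
  "u_avg M V \<epsilon> \<delta> u0 t Q P S A Qp Pp l x =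
     C_N \<epsilon> u0 *\<^sub>R (LINT \<omega>|M. avg_integrand V \<epsilon> \<delta> u0 t Q P S A Qp Pp l x \<omega>)"

end

theory Submission
  imports Defs
begin

text \<open>Write \<open>\<lambda> = \<delta> / \<epsilon> |V 0 1|\<close> and let \<open>\<rho>\<close> be the density of the initial data, a multiple of the modulus of the
initial amplitude. On the event that the process jumps exactly \<open>n\<close> times, the initial point and the jump
times together have the density
  \<open>\<rho> (q, p) * \<lambda> (Q t_1) * ... * \<lambda> (Q t_n) * exp (- integral of \<lambda> (Q s) over {0..t})\<close>
with respect to Lebesgue measure on phase space times the ordered simplex of hopping times (\<open>path_law\<close>).
The random variable in the trajectory average carries the inverse of each of these factors: it divides by
the modulus of the initial amplitude and by the moduli of the couplings, and multiplies with the exponential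
of the accumulated intensity. Density times random variable is therefore the integrand of the \<open>n\<close>-th ansatz term,
up to the constants in \<open>C_N\<close> and the powers of \<open>\<delta> / \<epsilon>\<close> (\<open>path_density_times_weight\<close>, \<open>term_expectation\<close>).
Since almost every path has some finite number of jumps, summing over the even and over the odd \<open>n\<close>
gives the two components, and the integrability of the random variable gives convergence of both series
(\<open>parity_sums\<close>).

The density has to be derived from the Markov property and the first-order expansion of the transition
probabilities alone. Weighted by an observable of the past at time \<open>s\<close> that confines the phase-space point to a compact
set, the probability of a level change between \<open>s\<close> and \<open>s + h\<close> is \<open>h\<close> times the expected intensity up to an
error \<open>o(h)\<close> that does not depend on \<open>s\<close> or on the observable (\<open>one_step\<close>). Adding this up over a time grid and refining the grid
shows that the next jump occurs at the stochastic rate \<open>\<lambda> (Q s)\<close>, conditionally on the jumps before it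
(\<open>jump_intensity\<close>). Up to the next jump the path is a function of the initial
point and the earlier jump times, because the equations of motion have unique solutions
(\<open>path_follows_state\<close>, \<open>state_hops\<close>). So the rate is a known function of time once the earlier jumps are known, the
waiting time has the survival function of that hazard rate (\<open>survival_law\<close>), and induction on the number of jumps yields the joint
law (\<open>hop_law\<close>).

Changing between the two integrals presupposes a measurable integrand. The flow is jointly continuous in
time, initial data and hopping times by a Gronwall estimate (\<open>state_continuous_joint\<close>). Its derivative in the initial
data is a pointwise limit of difference quotients and hence measurable, and the amplitude is the initial amplitude
times the exponential of a time integral built from that derivative (\<open>amplitude_formula\<close>).\<close>


section \<open>Stability of differential equations\<close>

lemma gronwall:
  fixes u :: "real \<Rightarrow> real"
  assumes u: "continuous_on {0..b} u" and L: "0 \<le> L"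
    and le: "\<And>s. s \<in> {0..b} \<Longrightarrow> u s \<le> a + L * integral {0..s} u"
    and s: "s \<in> {0..b}"
  shows "u s \<le> a * exp (L * s)"
proof -
  define v where "v = (\<lambda>r. exp (- L * r) * (a + L * integral {0..r} u))"
  have d: "(v has_real_derivative exp (- L * r) * (L * (u r - (a + L * integral {0..r} u)))) (at r)"
    if "0 < r" "r < s" for r
  proof -
    have "((\<lambda>x. integral {0..x} u) has_real_derivative u r) (at r within {0..b})"
      using integral_has_real_derivative[OF u, of r] that s by auto
    then have "((\<lambda>x. integral {0..x} u) has_real_derivative u r) (at r)"
      using that s by (simp add: at_within_Icc_at)
    then show ?thesis
      unfolding v_def by (auto intro!: derivative_eq_intros simp: algebra_simps)
  qed
  have "v s \<le> v 0"
  proof (cases "s = 0")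
    case False
    show ?thesis
    proof (rule DERIV_nonpos_imp_decreasing_open[of 0 s v])
      show "0 \<le> s" using s by simp
      show "\<exists>y. (v has_real_derivative y) (at r) \<and> y \<le> 0" if "0 < r" "r < s" for r
        using d[OF that] le[of r] that s L
        by (intro exI[of _ "exp (- L * r) * (L * (u r - (a + L * integral {0..r} u)))"])
          (auto intro!: mult_nonneg_nonpos)
      have "continuous_on {0..s} (\<lambda>r. integral {0..r} u)"
        using u s by (intro indefinite_integral_continuous_1 integrable_continuous_interval)
          (auto intro: continuous_on_subset)
      then show "continuous_on {0..s} v"
        unfolding v_def by (intro continuous_intros)
    qed
  qed simp
  then have "exp (- L * s) * (a + L * integral {0..s} u) \<le> a"
    by (simp add: v_def)
  then have "exp (L * s) * (exp (- L * s) * (a + L * integral {0..s} u)) \<le> exp (L * s) * a"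
    by (intro mult_left_mono) auto
  then have "a + L * integral {0..s} u \<le> a * exp (L * s)"
    by (simp add: mult.assoc[symmetric] exp_add[symmetric] mult.commute)
  with le[OF s] show ?thesis by linarith
qed

text \<open>The defect \<open>e\<close> enters only through its integral. This is what makes the estimate usable for trajectories
with different hopping times: their vector fields differ by a fixed amount, but only on a short time set.\<close>

lemma perturbation_bound:
  fixes x y :: "real \<Rightarrow> 'a::banach"
  assumes x: "continuous_on {0..b} x" and y: "continuous_on {0..b} y" and S: "finite S"
    and x': "\<And>s. s \<in> {0..b} - S \<Longrightarrow> (x has_vector_derivative f s) (at s within {0..b})"
    and y': "\<And>s. s \<in> {0..b} - S \<Longrightarrow> (y has_vector_derivative g s) (at s within {0..b})"
    and L: "0 \<le> L"
    and le: "\<And>s. s \<in> {0..b} - S \<Longrightarrow> norm (f s - g s) \<le> L * norm (x s - y s) + e s"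
    and e: "e integrable_on {0..b}" "\<And>s. 0 \<le> e s" "integral {0..b} e \<le> \<eta>"
    and s: "s \<in> {0..b}"
  shows "norm (x s - y s) \<le> (norm (x 0 - y 0) + \<eta>) * exp (L * s)"
proof (rule gronwall[OF _ L _ s])
  have cn: "continuous_on {0..b} (\<lambda>s. norm (x s - y s))"
    using x y by (intro continuous_intros)
  then show "continuous_on {0..b} (\<lambda>s. norm (x s - y s))" .
  fix r assume r: "r \<in> {0..b}"
  then have sub: "{0..r} \<subseteq> {0..b}" by auto
  have ftc: "((\<lambda>s. if s \<in> S then 0 else f s - g s) has_integral (x r - y r - (x 0 - y 0))) {0..r}"
  proof (rule fundamental_theorem_of_calculus_interior_strong[OF S])
    show "0 \<le> r" using r by simp
    show "continuous_on {0..r} (\<lambda>s. x s - y s)"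
      using x y sub by (intro continuous_intros) (auto intro: continuous_on_subset)
    fix q assume q: "q \<in> {0<..<r} - S"
    have "((\<lambda>s. x s - y s) has_vector_derivative f q - g q) (at q within {0..b})"
      using q r by (intro has_vector_derivative_diff x' y') auto
    then show "((\<lambda>s. x s - y s) has_vector_derivative (if q \<in> S then 0 else f q - g q)) (at q)"
      using q r by (auto simp: at_within_Icc_at)
  qed
  have er: "e integrable_on {0..r}"
    using e(1) sub by (rule integrable_subinterval_real)
  have nr: "(\<lambda>s. norm (x s - y s)) integrable_on {0..r}"
    using cn sub by (intro integrable_continuous_interval) (rule continuous_on_subset)
  have "norm (x r - y r - (x 0 - y 0)) \<le> integral {0..r} (\<lambda>s. L * norm (x s - y s) + e s)"
    unfolding integral_unique[OF ftc, symmetric]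
  proof (rule integral_norm_bound_integral)
    show "(\<lambda>s. if s \<in> S then 0 else f s - g s) integrable_on {0..r}"
      using ftc by auto
    show "(\<lambda>s. L * norm (x s - y s) + e s) integrable_on {0..r}"
      using er integrable_cmul[OF nr, of L] by (intro integrable_add) auto
    show "norm (if q \<in> S then 0 else f q - g q) \<le> L * norm (x q - y q) + e q" if "q \<in> {0..r}" for q
      using le[of q] that r e(2)[of q] L by auto
  qed
  also have "\<dots> = L * integral {0..r} (\<lambda>s. norm (x s - y s)) + integral {0..r} e"
    using er integrable_cmul[OF nr, of L] by (subst integral_add) auto
  also have "integral {0..r} e \<le> integral {0..b} e"
    using er e sub by (intro integral_subset_le) auto
  finally have "norm (x r - y r - (x 0 - y 0)) \<le> L * integral {0..r} (\<lambda>s. norm (x s - y s)) + \<eta>"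
    using e(3) by simp
  moreover have "norm (x r - y r) \<le> norm (x r - y r - (x 0 - y 0)) + norm (x 0 - y 0)"
    by (metis diff_add_cancel norm_triangle_ineq)
  ultimately show "norm (x r - y r) \<le> norm (x 0 - y 0) + \<eta> + L * integral {0..r} (\<lambda>s. norm (x s - y s))"
    by linarith
qed

text \<open>The Lipschitz estimate is required only while the two curves are within distance one, which is all that a
locally Lipschitz field provides. The smallness assumption keeps the curves inside that tube.\<close>

lemma perturbation_bound_within_unit:
  fixes x y :: "real \<Rightarrow> 'a::banach"
  assumes x: "continuous_on {0..b} x" and y: "continuous_on {0..b} y" and S: "finite S"
    and x': "\<And>s. s \<in> {0..b} - S \<Longrightarrow> (x has_vector_derivative f s) (at s within {0..b})"
    and y': "\<And>s. s \<in> {0..b} - S \<Longrightarrow> (y has_vector_derivative g s) (at s within {0..b})"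
    and L: "0 \<le> L"
    and le: "\<And>s. s \<in> {0..b} - S \<Longrightarrow> norm (x s - y s) \<le> 1 \<Longrightarrow> norm (f s - g s) \<le> L * norm (x s - y s) + e s"
    and e: "e integrable_on {0..b}" "\<And>s. 0 \<le> e s" "integral {0..b} e \<le> \<eta>"
    and small: "(norm (x 0 - y 0) + \<eta>) * exp (L * b) < 1"
    and s: "s \<in> {0..b}"
  shows "norm (x s - y s) \<le> (norm (x 0 - y 0) + \<eta>) * exp (L * b)"
proof -
  have \<eta>0: "0 \<le> \<eta>" using integral_nonneg[OF e(1)] e(2,3) by (metis order_trans)
  have on_prefix: "norm (x r - y r) \<le> (norm (x 0 - y 0) + \<eta>) * exp (L * b)"
    if c: "c \<in> {0..b}" and one: "\<And>q. q \<in> {0..c} \<Longrightarrow> norm (x q - y q) \<le> 1" and r: "r \<in> {0..c}" for c r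
  proof -
    have sub: "{0..c} \<subseteq> {0..b}" using c by auto
    have "norm (x r - y r) \<le> (norm (x 0 - y 0) + \<eta>) * exp (L * r)"
    proof (rule perturbation_bound[OF _ _ S _ _ L _ _ e(2) _ r])
      show "continuous_on {0..c} x" "continuous_on {0..c} y"
        using x y sub continuous_on_subset by blast+
      show "(x has_vector_derivative f q) (at q within {0..c})"
        "(y has_vector_derivative g q) (at q within {0..c})" if "q \<in> {0..c} - S" for q
        using that sub x'[of q] y'[of q] has_vector_derivative_within_subset by blast+
      show "norm (f q - g q) \<le> L * norm (x q - y q) + e q" if "q \<in> {0..c} - S" for q
        using that sub le one by auto
      show ec: "e integrable_on {0..c}" using e(1) sub by (rule integrable_subinterval_real)
      show "integral {0..c} e \<le> \<eta>"
        using integral_subset_le[OF sub ec e(1)] e(2,3) by force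
    qed
    also have "\<dots> \<le> (norm (x 0 - y 0) + \<eta>) * exp (L * b)"
      using \<eta>0 r c L by (intro mult_left_mono) (auto intro!: mult_left_mono)
    finally show ?thesis .
  qed
  \<comment> \<open>Continuity argument: at the first time the curves reach distance one, the bound already says that they are closer.\<close>
  define Z where "Z = {q \<in> {0..b}. 1 \<le> norm (x q - y q)}"
  show ?thesis
  proof (cases "Z = {}")
    case True
    then have "norm (x q - y q) \<le> 1" if "q \<in> {0..b}" for q
      using that by (force simp: Z_def)
    then show ?thesis
      using s by (intro on_prefix[of b s]) auto
  next
    case False
    have "compact Z"
    proof -
      have "closed Z" unfolding Z_def
        by (intro continuous_on_closed_Collect_le continuous_intros x y)
      moreover have "Z \<subseteq> {0..b}" by (auto simp: Z_def)
      ultimately show ?thesis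
        by (metis compact_Icc closed_Int_compact inf.absorb1)
    qed
    then obtain c where c: "c \<in> Z" "\<And>q. q \<in> Z \<Longrightarrow> c \<le> q"
      using compact_attains_inf[OF _ False] by blast
    have lt: "norm (x q - y q) < 1" if "q \<in> {0..<c}" for q
      using c(2)[of q] c(1) that by (auto simp: Z_def not_le[symmetric])
    have cpos: "0 < c"
    proof (rule ccontr)
      assume "\<not> 0 < c"
      then have c0: "c = 0" using c(1) by (auto simp: Z_def)
      then have "1 \<le> norm (x 0 - y 0) * 1" using c(1) by (auto simp: Z_def)
      also have "\<dots> \<le> (norm (x 0 - y 0) + \<eta>) * exp (L * b)"
        using \<eta>0 L s by (intro mult_mono) auto
      finally show False using small by simp
    qed
    have le1: "norm (x c - y c) \<le> 1"
    proof (rule tendsto_upperbound)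
      have "((\<lambda>q. norm (x q - y q)) \<longlongrightarrow> norm (x c - y c)) (at c within {0..b})"
        using c(1) x y by (intro tendsto_intros) (auto simp: Z_def continuous_on)
      then show "((\<lambda>q. norm (x q - y q)) \<longlongrightarrow> norm (x c - y c)) (at c within {0..<c})"
        by (rule tendsto_within_subset) (use c(1) in \<open>auto simp: Z_def\<close>)
      show "\<forall>\<^sub>F q in at c within {0..<c}. norm (x q - y q) \<le> 1"
        by (rule eventually_at_filter[THEN iffD2]) (auto intro!: always_eventually less_imp_le lt)
      show "at c within {0..<c} \<noteq> bot"
        using cpos by (simp add: trivial_limit_within)
    qed
    have "norm (x c - y c) \<le> (norm (x 0 - y 0) + \<eta>) * exp (L * b)"
    proof (rule on_prefix)
      show "c \<in> {0..b}" using c(1) by (simp add: Z_def)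
      show "norm (x q - y q) \<le> 1" if "q \<in> {0..c}" for q
        using that lt[of q] le1 by (cases "q = c") auto
      show "c \<in> {0..c}" using cpos by simp
    qed
    with small c(1) show ?thesis by (auto simp: Z_def)
  qed
qed


section \<open>Twice continuously differentiable surfaces\<close>

lemma partial_deriv_eq:
  assumes "(f has_derivative D) (at x)"
  shows "partial_deriv k f x = D (axis k 1)"
proof -
  have "((\<lambda>h. x + h *\<^sub>R axis k 1) has_derivative (\<lambda>h. h *\<^sub>R axis k 1)) (at 0)"
    by (auto intro!: derivative_eq_intros)
  then have "((\<lambda>h. f (x + h *\<^sub>R axis k 1)) has_derivative (\<lambda>h. D (h *\<^sub>R axis k 1))) (at 0)"
    using has_derivative_compose[of "\<lambda>h. x + h *\<^sub>R axis k 1" _ 0 UNIV f D] assms by simp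
  moreover have "(\<lambda>h. D (h *\<^sub>R axis k 1)) = (\<lambda>h. D (axis k 1) * h)"
    using linear_scale[OF has_derivative_linear[OF assms]] by (auto simp: fun_eq_iff)
  ultimately show ?thesis
    unfolding partial_deriv_def has_field_derivative_def[symmetric]
    by (intro DERIV_imp_deriv) (simp add: has_field_derivative_def)
qed

lemma derivative_bound_by_partials:
  fixes f :: "real^'m::finite \<Rightarrow> real"
  assumes D: "(f has_derivative D) (at x)" and B: "\<And>k. \<bar>partial_deriv k f x\<bar> \<le> B"
  shows "onorm D \<le> real CARD('m) * B"
proof (rule onorm_le)
  fix h
  have lin: "linear D" using D by (rule has_derivative_linear)
  have "D h = D (\<Sum>k\<in>UNIV. (h $ k) *\<^sub>R axis k 1)"
    by (subst basis_expansion[symmetric]) (simp add: scalar_mult_eq_scaleR)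
  also have "\<dots> = (\<Sum>k\<in>UNIV. h $ k * partial_deriv k f x)"
    by (simp add: linear_sum[OF lin] linear_scale[OF lin] partial_deriv_eq[OF D])
  finally have "norm (D h) \<le> (\<Sum>k\<in>UNIV. \<bar>h $ k\<bar> * \<bar>partial_deriv k f x\<bar>)"
    by (auto intro: order_trans[OF sum_abs] simp: abs_mult)
  also have "\<dots> \<le> (\<Sum>k\<in>(UNIV :: 'm set). norm h * B)"
    by (intro sum_mono mult_mono B) (auto simp: component_le_norm_cart)
  finally show "norm (D h) \<le> real CARD('m) * B * norm h" by (simp add: algebra_simps)
qed

lemma C2_continuous:
  assumes "C2 f"
  shows "continuous_on UNIV f" "continuous_on UNIV (grad f)" "continuous_on UNIV (hess f)"
proof -
  show "continuous_on UNIV f"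
    using assms by (auto simp: C2_def intro: differentiable_imp_continuous_on)
  show "continuous_on UNIV (grad f)"
    unfolding grad_def using assms
    by (intro continuous_on_vec_lambda) (auto simp: C2_def intro: differentiable_imp_continuous_on)
  show "continuous_on UNIV (hess f)"
    unfolding hess_def using assms by (intro continuous_on_vec_lambda) (auto simp: C2_def)
qed

text \<open>The second derivatives are bounded on a ball by compactness, and balls are convex.\<close>

lemma C2_grad_lipschitz:
  fixes f :: "real^'m::finite \<Rightarrow> real"
  assumes "C2 f"
  obtains L where "0 \<le> L"
    "\<And>x y. x \<in> cball 0 R \<Longrightarrow> y \<in> cball 0 R \<Longrightarrow> norm (grad f x - grad f y) \<le> L * norm (x - y)"
proof -
  have "compact (hess f ` cball 0 R)"
    by (intro compact_continuous_image continuous_on_subset[OF C2_continuous(3)[OF assms]]) auto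
  then have "bounded (hess f ` cball 0 R)" by (rule compact_imp_bounded)
  then obtain B where "\<forall>y\<in>hess f ` cball 0 R. norm y \<le> B"
    unfolding bounded_iff ..
  then have B: "\<And>x. x \<in> cball 0 R \<Longrightarrow> norm (hess f x) \<le> B" by simp
  have B1: "\<bar>partial_deriv j (partial_deriv k f) x\<bar> \<le> max 0 B" if "x \<in> cball 0 R" for j k x
  proof -
    have "\<bar>hess f x $ j $ k\<bar> \<le> norm (hess f x)"
      by (rule order_trans[OF component_le_norm_cart Finite_Cartesian_Product.norm_nth_le])
    with B[OF that] show ?thesis by (auto simp: hess_def)
  qed
  define L where "L = real CARD('m) * (real CARD('m) * max 0 B)"
  show ?thesis
  proof
    show "0 \<le> L" by (simp add: L_def)
    fix x y :: "real^'m" assume xy: "x \<in> cball 0 R" "y \<in> cball 0 R"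
    have k: "norm (partial_deriv k f x - partial_deriv k f y) \<le> real CARD('m) * max 0 B * norm (x - y)" for k
    proof (rule differentiable_bound[OF convex_cball _ _ xy])
      fix z :: "real^'m" assume z: "z \<in> cball 0 R"
      have "partial_deriv k f differentiable at z"
        using assms by (auto simp: C2_def differentiable_on_def)
      then show *: "(partial_deriv k f has_derivative frechet_derivative (partial_deriv k f) (at z))
          (at z within cball 0 R)"
        using frechet_derivative_works has_derivative_at_withinI by blast
      show "onorm (frechet_derivative (partial_deriv k f) (at z)) \<le> real CARD('m) * max 0 B"
        using \<open>partial_deriv k f differentiable at z\<close> z B1
        by (intro derivative_bound_by_partials) (auto simp: frechet_derivative_works)
    qed
    have "norm (grad f x - grad f y) \<le> (\<Sum>k\<in>UNIV. norm ((grad f x - grad f y) $ k))"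
      using norm_le_l1_cart[of "grad f x - grad f y"] by simp
    also have "\<dots> \<le> (\<Sum>k\<in>(UNIV::'m set). real CARD('m) * max 0 B * norm (x - y))"
      using k by (intro sum_mono) (simp add: grad_def)
    finally show "norm (grad f x - grad f y) \<le> L * norm (x - y)"
      by (simp add: L_def algebra_simps)
  qed
qed


section \<open>Trajectories with prescribed hopping times\<close>

definition field :: "'m::finite potential \<Rightarrow> nat \<Rightarrow> (real^'m) \<times> (real^'m) \<Rightarrow> (real^'m) \<times> (real^'m)" where
  "field V j z = (snd z, - grad (surface V j) (fst z))"

lemma level_less_2: "level ts s < 2"
  by (simp add: level_def)

locale smooth_surfaces =
  fixes V :: "'m::finite potential"
  assumes C2_0: "C2 (surface V 0)" and C2_1: "C2 (surface V 1)"
begin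

lemma C2_surface: "j < 2 \<Longrightarrow> C2 (surface V j)"
  using C2_0 C2_1 by (auto simp: less_2_cases_iff)

lemma field_continuous: "j < 2 \<Longrightarrow> continuous_on A (field V j)"
  unfolding field_def
  by (intro continuous_intros continuous_on_compose2[OF C2_continuous(2)[OF C2_surface]]) auto

lemma field_lipschitz:
  obtains L where "0 \<le> L"
    "\<And>j x y. j < 2 \<Longrightarrow> x \<in> cball 0 R \<Longrightarrow> y \<in> cball 0 R
      \<Longrightarrow> norm (field V j x - field V j y) \<le> L * norm (x - y)"
proof -
  obtain L0 where L0: "0 \<le> L0" "\<And>x y. x \<in> cball 0 R \<Longrightarrow> y \<in> cball 0 R
      \<Longrightarrow> norm (grad (surface V 0) x - grad (surface V 0) y) \<le> L0 * norm (x - y)"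
    using C2_grad_lipschitz[OF C2_0] by blast
  obtain L1 where L1: "0 \<le> L1" "\<And>x y. x \<in> cball 0 R \<Longrightarrow> y \<in> cball 0 R
      \<Longrightarrow> norm (grad (surface V 1) x - grad (surface V 1) y) \<le> L1 * norm (x - y)"
    using C2_grad_lipschitz[OF C2_1] by blast
  show ?thesis
  proof
    show "0 \<le> 1 + L0 + L1" using L0(1) L1(1) by simp
    fix j :: nat and x y :: "(real^'m) \<times> (real^'m)"
    assume j: "j < 2" and x: "x \<in> cball 0 R" and y: "y \<in> cball 0 R"
    have fx: "fst x \<in> cball 0 R" "fst y \<in> cball 0 R"
      using x y norm_fst_le[of "fst x" "snd x"] norm_fst_le[of "fst y" "snd y"] by (auto simp: dist_norm)
    have d: "norm (fst x - fst y) \<le> norm (x - y)" "norm (snd x - snd y) \<le> norm (x - y)"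
      using norm_fst_le[of "fst x - fst y" "snd x - snd y"] norm_snd_le[of "snd x - snd y" "fst x - fst y"]
      by (simp_all add: minus_prod_def)
    have g: "norm (grad (surface V j) (fst x) - grad (surface V j) (fst y)) \<le> (L0 + L1) * norm (x - y)"
    proof -
      have "norm (grad (surface V j) (fst x) - grad (surface V j) (fst y)) \<le> (L0 + L1) * norm (fst x - fst y)"
        using j L0(2)[OF fx] L1(2)[OF fx] L0(1) L1(1)
        by (auto simp: less_2_cases_iff distrib_right intro: add_increasing add_increasing2)
      also have "\<dots> \<le> (L0 + L1) * norm (x - y)"
        using d L0(1) L1(1) by (intro mult_left_mono) auto
      finally show ?thesis .
    qed
    have "norm (field V j x - field V j y)
        \<le> norm (snd x - snd y) + norm (grad (surface V j) (fst x) - grad (surface V j) (fst y))"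
      unfolding field_def diff_Pair
      by (rule order_trans[OF norm_Pair_le]) (simp add: norm_minus_commute)
    also have "\<dots> \<le> (1 + L0 + L1) * norm (x - y)"
      using d g by (simp add: algebra_simps)
    finally show "norm (field V j x - field V j y) \<le> (1 + L0 + L1) * norm (x - y)" .
  qed
qed

lemma bounded_curve:
  fixes x :: "real \<Rightarrow> 'a::real_normed_vector"
  assumes "continuous_on {a..b} x"
  obtains R where "0 < R" "\<And>s. s \<in> {a..b} \<Longrightarrow> norm (x s) \<le> R"
proof -
  have "bounded (x ` {a..b})"
    by (intro compact_imp_bounded compact_continuous_image assms) simp
  then show ?thesis using that unfolding bounded_pos by auto
qed

lemma field_curve_unique:
  assumes x: "continuous_on {0..b} x" and y: "continuous_on {0..b} y" and S: "finite S"
    and x': "\<And>s. s \<in> {0..b} - S \<Longrightarrow> (x has_vector_derivative field V (l s) (x s)) (at s within {0..b})"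
    and y': "\<And>s. s \<in> {0..b} - S \<Longrightarrow> (y has_vector_derivative field V (l' s) (y s)) (at s within {0..b})"
    and l: "\<And>s. s \<in> {0..b} - S \<Longrightarrow> l s = l' s" "\<And>s. s \<in> {0..b} - S \<Longrightarrow> l s < 2"
    and init: "x 0 = y 0" and s: "s \<in> {0..b}"
  shows "x s = y s"
proof -
  obtain R1 where R1: "\<And>s. s \<in> {0..b} \<Longrightarrow> norm (x s) \<le> R1" using bounded_curve[OF x] by blast
  obtain R2 where R2: "\<And>s. s \<in> {0..b} \<Longrightarrow> norm (y s) \<le> R2" using bounded_curve[OF y] by blast
  obtain L where L: "0 \<le> L" "\<And>j x y. j < 2 \<Longrightarrow> x \<in> cball 0 (max R1 R2) \<Longrightarrow> y \<in> cball 0 (max R1 R2)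
      \<Longrightarrow> norm (field V j x - field V j y) \<le> L * norm (x - y)"
    using field_lipschitz by blast
  have "norm (x s - y s) \<le> (norm (x 0 - y 0) + 0) * exp (L * s)"
  proof (rule perturbation_bound[where e = "\<lambda>_. 0", OF x y S x' y' L(1) _ _ _ _ s])
    show "norm (field V (l r) (x r) - field V (l' r) (y r)) \<le> L * norm (x r - y r) + 0"
      if "r \<in> {0..b} - S" for r
      using L(2)[of "l r" "x r" "y r"] l[OF that] R1[of r] R2[of r] that by (auto simp: le_max_iff_disj)
  qed auto
  then show ?thesis using init by simp
qed

end

text \<open>Two trajectories with equally many hops are on different surfaces only between corresponding hopping times.\<close>

lemma level_differs:
  assumes "length ts = length ts'" and "level ts s \<noteq> level ts' s"
  obtains i where "i < length ts'" "min (ts ! i) (ts' ! i) \<le> s" "s \<le> max (ts ! i) (ts' ! i)"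
proof -
  have "\<exists>i<length ts'. (ts ! i \<le> s) \<noteq> (ts' ! i \<le> s)"
  proof (rule ccontr)
    assume "\<not> ?thesis"
    then have "{i. i < length ts \<and> ts ! i \<le> s} = {i. i < length ts' \<and> ts' ! i \<le> s}"
      using assms(1) by auto
    with assms(2) show False by (simp add: level_def length_filter_conv_card)
  qed
  then show ?thesis using that by (force simp: min_def max_def split: if_splits)
qed

locale hopping_flow = smooth_surfaces V for V :: "'m::finite potential" +
  fixes u0 :: "real^'m \<Rightarrow> complex" and \<epsilon> t :: real
    and Q P :: "real list \<Rightarrow> real^'m \<Rightarrow> real^'m \<Rightarrow> real \<Rightarrow> real^'m"
    and S :: "real list \<Rightarrow> real^'m \<Rightarrow> real^'m \<Rightarrow> real \<Rightarrow> real"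
    and A :: "real list \<Rightarrow> real^'m \<Rightarrow> real^'m \<Rightarrow> real \<Rightarrow> complex"
  assumes t_nonneg: "0 \<le> t"
    and trajectory: "\<And>ts. hop_times t ts \<Longrightarrow> trajectory V \<epsilon> u0 t ts (Q ts) (P ts) (S ts) (A ts)"
begin

definition state :: "real list \<Rightarrow> (real^'m) \<times> (real^'m) \<Rightarrow> real \<Rightarrow> (real^'m) \<times> (real^'m)" where
  "state ts z s = (Q ts (fst z) (snd z) s, P ts (fst z) (snd z) s)"

lemma state_0: "hop_times t ts \<Longrightarrow> state ts z 0 = z"
  using trajectory[of ts] by (simp add: trajectory_def state_def)

lemma state_continuous: "hop_times t ts \<Longrightarrow> continuous_on {0..t} (state ts z)"
  using trajectory[of ts] unfolding state_def trajectory_def by (intro continuous_intros) simp_all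

lemma state_derivative:
  assumes "hop_times t ts" "s \<in> {0..t} - set ts"
  shows "(state ts z has_vector_derivative field V (level ts s) (state ts z s)) (at s within {0..t})"
proof -
  have "(Q ts (fst z) (snd z) has_vector_derivative P ts (fst z) (snd z) s) (at s within {0..t})"
    "(P ts (fst z) (snd z) has_vector_derivative - grad (surface V (level ts s)) (Q ts (fst z) (snd z) s))
      (at s within {0..t})"
    using trajectory[OF assms(1)] assms(2) by (auto simp: trajectory_def Let_def)
  from has_vector_derivative_Pair[OF this] show ?thesis
    by (simp add: state_def[abs_def] field_def)
qed

text \<open>The constants depend on the reference trajectory only, so that the bound gives continuity in the initial data and in the
hopping times at the same time.\<close>

lemma state_perturbation:
  assumes ts0: "hop_times t ts0"
  obtains L C where "0 \<le> L" "0 \<le> C"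
    "\<And>ts z s. hop_times t ts \<Longrightarrow> length ts = length ts0 \<Longrightarrow> s \<in> {0..t} \<Longrightarrow>
       (norm (z - z0) + C * (\<Sum>i<length ts0. \<bar>ts ! i - ts0 ! i\<bar>)) * exp (L * t) < 1 \<Longrightarrow>
       norm (state ts z s - state ts0 z0 s)
         \<le> (norm (z - z0) + C * (\<Sum>i<length ts0. \<bar>ts ! i - ts0 ! i\<bar>)) * exp (L * t)"
proof -
  obtain R where R: "\<And>s. s \<in> {0..t} \<Longrightarrow> norm (state ts0 z0 s) \<le> R"
    using bounded_curve[OF state_continuous[OF ts0]] by blast
  obtain L where L: "0 \<le> L" "\<And>j x y. j < 2 \<Longrightarrow> x \<in> cball 0 (R + 1) \<Longrightarrow> y \<in> cball 0 (R + 1)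
      \<Longrightarrow> norm (field V j x - field V j y) \<le> L * norm (x - y)"
    using field_lipschitz by blast
  have "bounded (field V j ` cball 0 R)" if "j < 2" for j
    by (intro compact_imp_bounded compact_continuous_image field_continuous that) simp
  from this[of 0] this[of 1] have "bounded (field V 0 ` cball 0 R \<union> field V 1 ` cball 0 R)" by simp
  then obtain C where C: "0 < C" "\<And>x. x \<in> cball 0 R \<Longrightarrow> norm (field V 0 x) \<le> C"
    "\<And>x. x \<in> cball 0 R \<Longrightarrow> norm (field V 1 x) \<le> C"
    unfolding bounded_pos by auto
  have C': "norm (field V j x - field V k x) \<le> 2 * C" if "j < 2" "k < 2" "x \<in> cball 0 R" for j k x
    using C(1) C(2,3)[OF that(3)] that(1,2) norm_triangle_ineq4[of "field V j x" "field V k x"]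
    by (auto simp: less_2_cases_iff)
  show ?thesis
  proof
    show "0 \<le> L" "0 \<le> 2 * C" using L C(1) by auto
    fix ts z s
    assume ts: "hop_times t ts" and len: "length ts = length ts0" and s: "s \<in> {0..t}"
    \<comment> \<open>The levels can differ only on these intervals, and there the fields differ by at most twice the bound \<open>C\<close>.\<close>
    define I where "I i = {min (ts ! i) (ts0 ! i)..max (ts ! i) (ts0 ! i)}" for i
    define e where "e r = (\<Sum>i<length ts0. 2 * C * (if r \<in> I i then 1 else 0))" for r
    define \<eta> where "\<eta> = 2 * C * (\<Sum>i<length ts0. \<bar>ts ! i - ts0 ! i\<bar>)"
    assume small: "(norm (z - z0) + 2 * C * (\<Sum>i<length ts0. \<bar>ts ! i - ts0 ! i\<bar>)) * exp (L * t) < 1"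
    have e: "(e has_integral \<eta>) {0..t}"
    proof -
      have "((\<lambda>r. if r \<in> I i then 1 else 0) has_integral \<bar>ts ! i - ts0 ! i\<bar>) {0..t}"
        if "i < length ts0" for i
      proof -
        have mem: "ts ! i \<in> {0<..<t}" "ts0 ! i \<in> {0<..<t}"
          using ts ts0 that len by (auto simp: hop_times_def subset_iff)
        then have "I i \<subseteq> {0..t}" by (auto simp: I_def)
        moreover have "measure lborel (I i) = \<bar>ts ! i - ts0 ! i\<bar>"
          by (auto simp: I_def)
        then have "((\<lambda>r. 1) has_integral \<bar>ts ! i - ts0 ! i\<bar>) (I i)"
          using has_integral_const_real[of "1::real" "min (ts ! i) (ts0 ! i)" "max (ts ! i) (ts0 ! i)"]
          by (simp only: I_def real_scaleR_def mult_1_right)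
        ultimately show ?thesis by (simp add: has_integral_restrict)
      qed
      then have "((\<lambda>r. \<Sum>i<length ts0. 2 * C * (if r \<in> I i then 1 else 0))
          has_integral (\<Sum>i<length ts0. 2 * C * \<bar>ts ! i - ts0 ! i\<bar>)) {0..t}"
        by (intro has_integral_sum has_integral_mult_right) auto
      then show ?thesis by (simp add: e_def[abs_def] \<eta>_def sum_distrib_left)
    qed
    have "norm (state ts z s - state ts0 z0 s) \<le> (norm (state ts z 0 - state ts0 z0 0) + \<eta>) * exp (L * t)"
    proof (rule perturbation_bound_within_unit[OF state_continuous[OF ts] state_continuous[OF ts0] _ _ _ L(1) _ _ _ _ _ s])
      show "finite (set ts \<union> set ts0)" by simp
      show "(state ts z has_vector_derivative field V (level ts r) (state ts z r)) (at r within {0..t})"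
        if "r \<in> {0..t} - (set ts \<union> set ts0)" for r using that by (intro state_derivative ts) auto
      show "(state ts0 z0 has_vector_derivative field V (level ts0 r) (state ts0 z0 r)) (at r within {0..t})"
        if "r \<in> {0..t} - (set ts \<union> set ts0)" for r using that by (intro state_derivative ts0) auto
      show "e integrable_on {0..t}" "integral {0..t} e \<le> \<eta>" using e by (auto simp: integral_unique)
      show "0 \<le> e r" for r unfolding e_def using C(1) by (intro sum_nonneg) auto
      show "(norm (state ts z 0 - state ts0 z0 0) + \<eta>) * exp (L * t) < 1"
        using small by (simp add: \<eta>_def state_0[OF ts] state_0[OF ts0])
      fix r assume r: "r \<in> {0..t} - (set ts \<union> set ts0)" and le1: "norm (state ts z r - state ts0 z0 r) \<le> 1"
      have y: "state ts0 z0 r \<in> cball 0 R" using R r by auto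
      have x: "state ts z r \<in> cball 0 (R + 1)"
        using y le1 norm_triangle_ineq[of "state ts z r - state ts0 z0 r" "state ts0 z0 r"] by simp
      have "norm (field V (level ts r) (state ts0 z0 r) - field V (level ts0 r) (state ts0 z0 r)) \<le> e r"
      proof (cases "level ts r = level ts0 r")
        case True
        then show ?thesis using C(1) by (auto simp: e_def intro!: sum_nonneg)
      next
        case False
        then obtain i where i: "i < length ts0" "r \<in> I i"
          using level_differs[OF len False] by (auto simp: I_def)
        have "2 * C = (\<Sum>k\<in>{i}. 2 * C * (if r \<in> I k then 1 else 0))" using i by simp
        also have "\<dots> \<le> e r" unfolding e_def using i C(1) by (intro sum_mono2) auto
        finally show ?thesis using C'[OF level_less_2 level_less_2 y] by (rule order_trans[rotated])
      qed
      moreover have "norm (field V (level ts r) (state ts z r) - field V (level ts r) (state ts0 z0 r))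
          \<le> L * norm (state ts z r - state ts0 z0 r)"
        using x y by (intro L(2) level_less_2) auto
      ultimately show "norm (field V (level ts r) (state ts z r) - field V (level ts0 r) (state ts0 z0 r))
          \<le> L * norm (state ts z r - state ts0 z0 r) + e r"
        by (intro norm_diff_triangle_le)
    qed
    then show "norm (state ts z s - state ts0 z0 s)
         \<le> (norm (z - z0) + 2 * C * (\<Sum>i<length ts0. \<bar>ts ! i - ts0 ! i\<bar>)) * exp (L * t)"
      by (simp add: \<eta>_def state_0[OF ts] state_0[OF ts0])
  qed
qed

lemma state_lipschitz_initial:
  assumes ts: "hop_times t ts"
  obtains K d where "0 \<le> K" "0 < d"
    "\<And>z' s. norm (z' - z) < d \<Longrightarrow> s \<in> {0..t} \<Longrightarrow> norm (state ts z' s - state ts z s) \<le> K * norm (z' - z)"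
proof -
  obtain L C where LC: "0 \<le> L" "0 \<le> C"
    "\<And>ts' z' s. hop_times t ts' \<Longrightarrow> length ts' = length ts \<Longrightarrow> s \<in> {0..t} \<Longrightarrow>
       (norm (z' - z) + C * (\<Sum>i<length ts. \<bar>ts' ! i - ts ! i\<bar>)) * exp (L * t) < 1 \<Longrightarrow>
       norm (state ts' z' s - state ts z s)
         \<le> (norm (z' - z) + C * (\<Sum>i<length ts. \<bar>ts' ! i - ts ! i\<bar>)) * exp (L * t)"
    using state_perturbation[OF ts, of z] by blast
  show ?thesis
  proof
    show "0 \<le> exp (L * t)" "0 < exp (- L * t)" by auto
    fix z' s assume z': "norm (z' - z) < exp (- L * t)" and s: "s \<in> {0..t}"
    have "norm (z' - z) * exp (L * t) < exp (- L * t) * exp (L * t)"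
      using z' by (intro mult_strict_right_mono) auto
    then show "norm (state ts z' s - state ts z s) \<le> exp (L * t) * norm (z' - z)"
      using LC(3)[OF ts refl s, of z'] by (simp add: mult.commute flip: exp_add)
  qed
qed

lemma level_append:
  assumes "s < u" shows "level (ts @ [u]) s = level ts s"
  using assms by (simp add: level_def)

lemma hop_times_append:
  assumes "hop_times t (ts @ [u])" shows "hop_times t ts" "u \<in> {0<..<t}"
  using assms by (auto simp: hop_times_def sorted_wrt_append)

text \<open>A hop at time \<open>u\<close> does not influence the trajectory before \<open>u\<close>; by continuity the state at \<open>u\<close> itself is
unaffected too.\<close>

lemma state_append:
  assumes ts: "hop_times t (ts @ [u])" and s: "s \<in> {0..u}"
  shows "state (ts @ [u]) z s = state ts z s"
proof -
  note ts0 = hop_times_append[OF ts]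
  have sub: "{0..u} \<subseteq> {0..t}" using ts0(2) by auto
  have d: "(state ts' z has_vector_derivative field V (level ts' r) (state ts' z r)) (at r within {0..u})"
    if "hop_times t ts'" "r \<in> {0..u} - set ts'" for ts' r
    using state_derivative[OF that(1), of r z] that(2) sub
    by (auto intro: has_vector_derivative_within_subset)
  show ?thesis
  proof (rule field_curve_unique[OF _ _ _ _ _ _ _ _ s])
    show "continuous_on {0..u} (state (ts @ [u]) z)" "continuous_on {0..u} (state ts z)"
      using state_continuous ts ts0 sub continuous_on_subset by blast+
    show "finite (set (ts @ [u]))" by simp
    show "level (ts @ [u]) r = level ts r" "level (ts @ [u]) r < 2" if "r \<in> {0..u} - set (ts @ [u])" for r
      using that by (auto intro: level_append level_less_2)
  qed (use ts ts0 in \<open>auto intro: d simp: state_0\<close>)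
qed

end


section \<open>Joint continuity and measurability of the flow\<close>

abbreviation times :: "nat \<Rightarrow> (nat \<Rightarrow> real) \<Rightarrow> real list" where
  "times n \<tau> \<equiv> map \<tau> [1..<Suc n]"

lemma nth_times: "i < n \<Longrightarrow> times n \<tau> ! i = \<tau> (Suc i)"
  by (simp del: upt_Suc)

lemma time_simplex_iff:
  "\<tau> \<in> time_simplex n t \<longleftrightarrow>
     (\<forall>i\<in>{1..n}. 0 < \<tau> i \<and> \<tau> i < t) \<and> (\<forall>i\<in>{1..n}. \<forall>j\<in>{1..n}. i < j \<longrightarrow> \<tau> i < \<tau> j)"
proof -
  have "sorted_wrt (<) (times n \<tau>) \<longleftrightarrow> (\<forall>i<n. \<forall>j<n. i < j \<longrightarrow> \<tau> (Suc i) < \<tau> (Suc j))"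
    by (auto simp: sorted_wrt_iff_nth_less nth_times simp del: upt_Suc)
  also have "\<dots> \<longleftrightarrow> (\<forall>i\<in>{1..n}. \<forall>j\<in>{1..n}. i < j \<longrightarrow> \<tau> i < \<tau> j)"
  proof (intro iffI ballI impI allI)
    fix i j assume *: "\<forall>i<n. \<forall>j<n. i < j \<longrightarrow> \<tau> (Suc i) < \<tau> (Suc j)" and "i \<in> {1..n}" "j \<in> {1..n}" "i < j"
    then show "\<tau> i < \<tau> j" using *[rule_format, of "i - 1" "j - 1"] by auto
  qed auto
  finally show ?thesis
    by (auto simp: time_simplex_def hop_times_def subset_iff simp del: upt_Suc)
qed

text \<open>The space on which the ansatz integrates: initial data together with hopping times indexed from \<open>1\<close> to \<open>n\<close>.\<close>

definition path_space :: "nat \<Rightarrow> ('a::euclidean_space \<times> (nat \<Rightarrow> real)) measure" where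
  "path_space n = lborel \<Otimes>\<^sub>M Pi\<^sub>M {1..n} (\<lambda>_. lborel)"

lemma measurable_path_space_fst [measurable]: "fst \<in> borel_measurable (path_space n)"
  unfolding path_space_def by simp

lemma measurable_path_space_time: "i \<in> {1..n} \<Longrightarrow> (\<lambda>x. snd x i) \<in> borel_measurable (path_space n)"
  unfolding path_space_def by measurable

definition hop_region :: "real \<Rightarrow> nat \<Rightarrow> (('a \<times> (nat \<Rightarrow> real)) \<times> real) set" where
  "hop_region t n = {x. snd (fst x) \<in> time_simplex n t \<and> snd x \<in> {0..t}}"

abbreviation region_space :: "real \<Rightarrow> nat \<Rightarrow> (('a::euclidean_space \<times> (nat \<Rightarrow> real)) \<times> real) measure" where
  "region_space t n \<equiv> restrict_space (path_space n \<Otimes>\<^sub>M borel) (hop_region t n)"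

lemma sets_simplex [measurable]: "{x \<in> space (path_space n). snd x \<in> time_simplex n t} \<in> sets (path_space n)"
proof -
  note measurable_path_space_time[measurable]
  show ?thesis unfolding time_simplex_iff by measurable
qed

lemma sets_hop_region [measurable]:
  "{x \<in> space (path_space n \<Otimes>\<^sub>M borel). x \<in> hop_region t n} \<in> sets (path_space n \<Otimes>\<^sub>M borel)"
proof -
  have eq: "{x \<in> space (path_space n \<Otimes>\<^sub>M borel). x \<in> hop_region t n}
      = {x \<in> space (path_space n). snd x \<in> time_simplex n t} \<times> {0..t}"
    by (auto simp: hop_region_def space_pair_measure)
  show ?thesis unfolding eq by (intro pair_measureI sets_simplex) simp
qed

context hopping_flow
begin

lemma state_continuous_joint:
  "continuous_on {(z, \<tau>, s). \<tau> \<in> time_simplex n t \<and> s \<in> {0..t}} (\<lambda>(z, \<tau>, s). state (times n \<tau>) z s)"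
  (is "continuous_on ?\<Omega> ?f")
  unfolding continuous_on_def
proof
  fix p0 assume p0: "p0 \<in> ?\<Omega>"
  obtain z0 \<tau>0 s0 where p0_eq: "p0 = (z0, \<tau>0, s0)" by (cases p0) auto
  have ts0: "hop_times t (times n \<tau>0)" and s0: "s0 \<in> {0..t}" using p0 by (auto simp: p0_eq time_simplex_def)
  obtain L C where LC: "0 \<le> L" "0 \<le> C"
    "\<And>ts z s. hop_times t ts \<Longrightarrow> length ts = length (times n \<tau>0) \<Longrightarrow> s \<in> {0..t} \<Longrightarrow>
       (norm (z - z0) + C * (\<Sum>i<length (times n \<tau>0). \<bar>ts ! i - times n \<tau>0 ! i\<bar>)) * exp (L * t) < 1 \<Longrightarrow>
       norm (state ts z s - state (times n \<tau>0) z0 s)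
         \<le> (norm (z - z0) + C * (\<Sum>i<length (times n \<tau>0). \<bar>ts ! i - times n \<tau>0 ! i\<bar>)) * exp (L * t)"
    using state_perturbation[OF ts0, of z0] by blast
  define \<kappa> where "\<kappa> p = (norm (fst p - z0) + C * (\<Sum>i<n. \<bar>fst (snd p) (Suc i) - \<tau>0 (Suc i)\<bar>)) * exp (L * t)"
    for p :: "((real^'m) \<times> (real^'m)) \<times> (nat \<Rightarrow> real) \<times> real"
  have "continuous_on UNIV (\<lambda>p :: ((real^'m) \<times> (real^'m)) \<times> (nat \<Rightarrow> real) \<times> real. fst (snd p) i)" for i
    by (rule continuous_on_compose2[of UNIV "\<lambda>x. x i" UNIV "\<lambda>p. fst (snd p)", OF continuous_on_product_coordinates])
      (intro continuous_on_fst continuous_on_snd continuous_on_id, simp)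
  then have "continuous_on UNIV \<kappa>"
    unfolding \<kappa>_def by (intro continuous_intros)
  then have "continuous_on ?\<Omega> \<kappa>" by (rule continuous_on_subset) simp
  then have "(\<kappa> \<longlongrightarrow> \<kappa> p0) (at p0 within ?\<Omega>)"
    using p0 unfolding continuous_on_def by (rule bspec)
  then have \<kappa>: "(\<kappa> \<longlongrightarrow> 0) (at p0 within ?\<Omega>)"
    by (simp add: \<kappa>_def p0_eq)
  have time: "((\<lambda>p. norm (state (times n \<tau>0) z0 (snd (snd p)) - state (times n \<tau>0) z0 s0)) \<longlongrightarrow> 0) (at p0 within ?\<Omega>)"
  proof -
    have "continuous_on ?\<Omega> (\<lambda>p. norm (state (times n \<tau>0) z0 (snd (snd p)) - state (times n \<tau>0) z0 s0))"
      by (intro continuous_intros continuous_on_compose2[OF state_continuous[OF ts0]]) auto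
    from this[unfolded continuous_on_def, rule_format, OF p0] show ?thesis by (simp add: p0_eq)
  qed
  have "((\<lambda>p. ?f p - ?f p0) \<longlongrightarrow> 0) (at p0 within ?\<Omega>)"
  proof (rule Lim_null_comparison)
    show "((\<lambda>p. \<kappa> p + norm (state (times n \<tau>0) z0 (snd (snd p)) - state (times n \<tau>0) z0 s0)) \<longlongrightarrow> 0)
        (at p0 within ?\<Omega>)"
      using tendsto_add[OF \<kappa> time] by simp
    have "\<forall>\<^sub>F p in at p0 within ?\<Omega>. p \<in> ?\<Omega>"
      unfolding eventually_at_filter by (rule always_eventually) auto
    moreover have "\<forall>\<^sub>F p in at p0 within ?\<Omega>. \<kappa> p < 1"
      using \<kappa> by (rule order_tendstoD) simp
    ultimately show "\<forall>\<^sub>F p in at p0 within ?\<Omega>.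
        norm (?f p - ?f p0) \<le> \<kappa> p + norm (state (times n \<tau>0) z0 (snd (snd p)) - state (times n \<tau>0) z0 s0)"
    proof eventually_elim
      case (elim p)
      obtain z \<tau> s where p: "p = (z, \<tau>, s)" by (cases p) auto
      have eq: "(norm (z - z0) + C * (\<Sum>i<length (times n \<tau>0). \<bar>times n \<tau> ! i - times n \<tau>0 ! i\<bar>)) * exp (L * t) = \<kappa> p"
        by (simp add: \<kappa>_def p nth_times del: upt_Suc)
      have "norm (state (times n \<tau>) z s - state (times n \<tau>0) z0 s) \<le> \<kappa> p"
        using LC(3)[of "times n \<tau>" s z, unfolded eq] elim by (auto simp: p time_simplex_def simp del: upt_Suc)
      moreover have "?f p - ?f p0 = (state (times n \<tau>) z s - state (times n \<tau>0) z0 s)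
          + (state (times n \<tau>0) z0 s - state (times n \<tau>0) z0 s0)"
        by (simp add: p p0_eq)
      ultimately show ?case
        by (simp only: p snd_conv) (rule order_trans[OF norm_triangle_ineq], simp)
    qed
  qed
  then show "(?f \<longlongrightarrow> ?f p0) (at p0 within ?\<Omega>)"
    by (rule LIM_zero_cancel)
qed

text \<open>Points of a finite product measure are undefined outside the index set. Filling in \<open>0\<close> moves them into the
topological space of all sequences, in which continuity implies Borel measurability.\<close>

lemma measurable_extend_times:
  "(\<lambda>x. (fst (fst x), \<lambda>i. if i \<in> {1..n} then snd (fst x) i else 0, snd x))
    \<in> path_space n \<Otimes>\<^sub>M borel \<rightarrow>\<^sub>M (borel :: ('a::euclidean_space \<times> (nat \<Rightarrow> real) \<times> real) measure)"
proof -
  have "(\<lambda>x. (fst (fst x), \<lambda>i. if i \<in> {1..n} then snd (fst x) i else 0, snd x))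
      \<in> path_space n \<Otimes>\<^sub>M borel \<rightarrow>\<^sub>M ((borel :: 'a measure) \<Otimes>\<^sub>M ((borel :: (nat \<Rightarrow> real) measure) \<Otimes>\<^sub>M (borel :: real measure)))"
  proof (intro measurable_Pair)
    show "(\<lambda>x. \<lambda>i. if i \<in> {1..n} then snd (fst x) i else 0)
        \<in> borel_measurable (path_space n \<Otimes>\<^sub>M borel :: (('a \<times> (nat \<Rightarrow> real)) \<times> real) measure)"
    proof (rule measurable_coordinatewise_then_product)
      fix i
      show "(\<lambda>x. if i \<in> {1..n} then snd (fst x) i else 0)
          \<in> borel_measurable (path_space n \<Otimes>\<^sub>M borel :: (('a \<times> (nat \<Rightarrow> real)) \<times> real) measure)"
      proof (cases "i \<in> {1..n}")
        case True
        show ?thesis unfolding if_P[OF True]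
          by (rule measurable_compose[OF measurable_fst measurable_path_space_time[OF True]])
      next
        case False
        show ?thesis unfolding if_not_P[OF False] by simp
      qed
    qed
  qed measurable
  then show ?thesis by (simp add: borel_prod)
qed

lemma measurable_on_region:
  fixes f :: "((real^'m) \<times> (real^'m)) \<times> (nat \<Rightarrow> real) \<times> real \<Rightarrow> 'b::topological_space"
  assumes f: "continuous_on {(z, \<tau>, s). \<tau> \<in> time_simplex n t \<and> s \<in> {0..t}} f"
    and ext: "\<And>z \<tau> \<tau>' s. (\<And>i. i \<in> {1..n} \<Longrightarrow> \<tau> i = \<tau>' i) \<Longrightarrow> f (z, \<tau>, s) = f (z, \<tau>', s)"
  shows "(\<lambda>x. f (fst (fst x), snd (fst x), snd x)) \<in> borel_measurable (region_space t n)"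
proof -
  let ?\<iota> = "\<lambda>x :: (((real^'m) \<times> (real^'m)) \<times> (nat \<Rightarrow> real)) \<times> real.
      (fst (fst x), \<lambda>i. if i \<in> {1..n} then snd (fst x) i else 0, snd x)"
  have "?\<iota> \<in> region_space t n \<rightarrow>\<^sub>M restrict_space borel {(z, \<tau>, s). \<tau> \<in> time_simplex n t \<and> s \<in> {0..t}}"
    by (rule measurable_restrict_space3[OF measurable_extend_times])
      (auto simp: hop_region_def time_simplex_iff)
  from measurable_compose[OF this borel_measurable_continuous_on_restrict[OF f]]
  have "(\<lambda>x. f (?\<iota> x)) \<in> borel_measurable (region_space t n)" .
  moreover have "f (?\<iota> x) = f (fst (fst x), snd (fst x), snd x)" for x
    by (rule ext) auto
  ultimately show ?thesis by simp
qed

lemma measurable_state: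
  "(\<lambda>x. state (times n (snd (fst x))) (fst (fst x)) (snd x)) \<in> borel_measurable (region_space t n)"
proof -
  have "(\<lambda>x. (\<lambda>(z, \<tau>, s). state (times n \<tau>) z s) (fst (fst x), snd (fst x), snd x))
      \<in> borel_measurable (region_space t n)"
  proof (rule measurable_on_region[OF state_continuous_joint])
    fix z :: "(real^'m) \<times> (real^'m)" and \<tau> \<tau>' :: "nat \<Rightarrow> real" and s :: real
    assume "\<And>i. i \<in> {1..n} \<Longrightarrow> \<tau> i = \<tau>' i"
    then have "times n \<tau> = times n \<tau>'" by (intro map_cong) auto
    then show "(\<lambda>(z, \<tau>, s). state (times n \<tau>) z s) (z, \<tau>, s) = (\<lambda>(z, \<tau>, s). state (times n \<tau>) z s) (z, \<tau>', s)"
      by (simp only: prod.case)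
  qed
  then show ?thesis by (simp only: prod.case)
qed

end


section \<open>Derivative of the flow with respect to the initial data\<close>

lemma bounded_derivative_lipschitz:
  fixes f :: "real \<Rightarrow> 'a::banach"
  assumes f: "continuous_on {0..b} f" and S: "finite S"
    and f': "\<And>s. s \<in> {0..b} - S \<Longrightarrow> (f has_vector_derivative f' s) (at s within {0..b})"
    and B: "\<And>s. s \<in> {0..b} - S \<Longrightarrow> norm (f' s) \<le> B" and B0: "0 \<le> B"
    and s: "s1 \<in> {0..b}" "s2 \<in> {0..b}"
  shows "norm (f s2 - f s1) \<le> B * \<bar>s2 - s1\<bar>"
proof -
  have ordered: "norm (f s2 - f s1) \<le> B * (s2 - s1)"
    if "s1 \<in> {0..b}" "s2 \<in> {0..b}" "s1 \<le> s2" for s1 s2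
  proof -
    have "(f' has_integral (f s2 - f s1)) {s1..s2}"
    proof (rule fundamental_theorem_of_calculus_interior_strong[OF S that(3)])
      show "continuous_on {s1..s2} f" using f that by (auto intro: continuous_on_subset)
      fix r assume "r \<in> {s1<..<s2} - S"
      then have "r \<in> {0<..<b}" "r \<in> {0..b} - S" using that by auto
      then show "(f has_vector_derivative f' r) (at r)" using f'[of r] by (simp add: at_within_Icc_at)
    qed
    from has_integral_bound_real[OF B0 S this] B that show ?thesis by auto
  qed
  show ?thesis
  proof (cases "s1 \<le> s2")
    case True
    then show ?thesis using ordered[OF s] by simp
  next
    case False
    then show ?thesis using ordered[OF s(2,1)] by (simp add: norm_minus_commute)
  qed
qed

lemma difference_quotient_LIMSEQ:
  fixes f :: "'a::real_normed_vector \<Rightarrow> 'b::real_normed_vector"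
  assumes "f differentiable at x"
  shows "(\<lambda>k. real (Suc k) *\<^sub>R (f (x + (1 / real (Suc k)) *\<^sub>R v) - f x)) \<longlonglongrightarrow> frechet_derivative f (at x) v"
proof (cases "v = 0")
  case True
  then show ?thesis
    using linear_0[OF linear_frechet_derivative[OF assms]] by simp
next
  case False
  let ?D = "frechet_derivative f (at x)" and ?h = "\<lambda>k. (1 / real (Suc k)) *\<^sub>R v"
  have D: "(f has_derivative ?D) (at x)" using assms by (simp add: frechet_derivative_works)
  have lin: "linear ?D" by (rule linear_frechet_derivative[OF assms])
  have "(\<lambda>k. (1 / real (Suc k)) *\<^sub>R v) \<longlonglongrightarrow> 0 *\<^sub>R v"
    by (intro tendsto_intros LIMSEQ_Suc[OF lim_1_over_n])
  then have h: "filterlim ?h (at 0) sequentially"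
    using False by (auto simp: filterlim_at)
  have "(\<lambda>h. norm (f (x + h) - f x - ?D h) / norm h) \<midarrow>0\<rightarrow> 0"
    using D by (simp add: has_derivative_at)
  from filterlim_compose[OF this h]
  have lim: "(\<lambda>k. norm (f (x + ?h k) - f x - ?D (?h k)) / norm (?h k)) \<longlonglongrightarrow> 0" .
  have "norm (real (Suc k) *\<^sub>R (f (x + ?h k) - f x) - ?D v)
      = norm v * (norm (f (x + ?h k) - f x - ?D (?h k)) / norm (?h k))" for k
  proof -
    have "real (Suc k) *\<^sub>R (f (x + ?h k) - f x) - ?D v = real (Suc k) *\<^sub>R (f (x + ?h k) - f x - ?D (?h k))"
      by (simp add: linear_scale[OF lin] scaleR_diff_right del: of_nat_Suc)
    then have "norm (real (Suc k) *\<^sub>R (f (x + ?h k) - f x) - ?D v)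
        = real (Suc k) * norm (f (x + ?h k) - f x - ?D (?h k))" by (simp only: norm_scaleR abs_of_nat)
    moreover have "real (Suc k) * N = norm v * (N / norm (?h k))" for N
      using False by (simp del: of_nat_Suc)
    ultimately show ?thesis by (simp only:)
  qed
  then have "(\<lambda>k. norm (real (Suc k) *\<^sub>R (f (x + ?h k) - f x) - ?D v)) \<longlonglongrightarrow> 0"
    using tendsto_mult_right_zero[OF lim, of "norm v"] by simp
  then show ?thesis
    by (rule LIM_zero_cancel[OF tendsto_norm_zero_cancel])
qed

context hopping_flow
begin

lemma state_differentiable:
  assumes "hop_times t ts" "s \<in> {0..t}"
  shows "(\<lambda>z. state ts z s) differentiable (at z)"
proof -
  have "(\<lambda>(q', p'). Q ts q' p' s) differentiable (at (fst z, snd z))"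
    "(\<lambda>(q', p'). P ts q' p' s) differentiable (at (fst z, snd z))"
    using trajectory[OF assms(1)] assms(2) unfolding trajectory_def by blast+
  then obtain D1 D2 where "((\<lambda>z. Q ts (fst z) (snd z) s) has_derivative D1) (at z)"
    "((\<lambda>z. P ts (fst z) (snd z) s) has_derivative D2) (at z)"
    by (auto simp: differentiable_def case_prod_unfold)
  from has_derivative_Pair[OF this] show ?thesis
    unfolding state_def differentiable_def by blast
qed

definition dstate :: "real list \<Rightarrow> (real^'m) \<times> (real^'m) \<Rightarrow> real \<Rightarrow> (real^'m) \<times> (real^'m) \<Rightarrow> (real^'m) \<times> (real^'m)" where
  "dstate ts z s = frechet_derivative (\<lambda>z. state ts z s) (at z)"

lemma dstate_LIMSEQ:
  assumes "hop_times t ts" "s \<in> {0..t}"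
  shows "(\<lambda>k. real (Suc k) *\<^sub>R (state ts (z + (1 / real (Suc k)) *\<^sub>R v) s - state ts z s))
    \<longlonglongrightarrow> dstate ts z s v"
  unfolding dstate_def by (rule difference_quotient_LIMSEQ[OF state_differentiable[OF assms]])

lemma partial_deriv_state:
  assumes "hop_times t ts" "s \<in> {0..t}"
  shows "partial_deriv j (\<lambda>q'. Q ts q' (snd z) s $ k) (fst z) = fst (dstate ts z s (axis j 1, 0)) $ k"
    and "partial_deriv j (\<lambda>p'. Q ts (fst z) p' s $ k) (snd z) = fst (dstate ts z s (0, axis j 1)) $ k"
    and "partial_deriv j (\<lambda>q'. P ts q' (snd z) s $ k) (fst z) = snd (dstate ts z s (axis j 1, 0)) $ k"
    and "partial_deriv j (\<lambda>p'. P ts (fst z) p' s $ k) (snd z) = snd (dstate ts z s (0, axis j 1)) $ k"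
proof -
  have D: "((\<lambda>z. state ts z s) has_derivative dstate ts z s) (at z)"
    unfolding dstate_def using state_differentiable[OF assms] by (simp add: frechet_derivative_works)
  have q: "((\<lambda>q'. (q', snd z)) has_derivative (\<lambda>h. (h, 0))) (at (fst z))"
    by (auto intro!: derivative_eq_intros)
  have p: "((\<lambda>p'. (fst z, p')) has_derivative (\<lambda>h. (0, h))) (at (snd z))"
    by (auto intro!: derivative_eq_intros)
  have Dq: "((\<lambda>q'. state ts (q', snd z) s) has_derivative (\<lambda>h. dstate ts z s (h, 0))) (at (fst z))"
    using has_derivative_compose[OF q, of "\<lambda>z. state ts z s" "dstate ts z s"] D by simp
  have Dp: "((\<lambda>p'. state ts (fst z, p') s) has_derivative (\<lambda>h. dstate ts z s (0, h))) (at (snd z))"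
    using has_derivative_compose[OF p, of "\<lambda>z. state ts z s" "dstate ts z s"] D by simp
  have nth: "((\<lambda>x. f x $ k) has_derivative (\<lambda>h. f' h $ k)) F"
    if "(f has_derivative f') F" for f f' :: "real^'m \<Rightarrow> real^'m" and F
    by (rule bounded_linear.has_derivative[OF bounded_linear_vec_nth that])
  show "partial_deriv j (\<lambda>q'. Q ts q' (snd z) s $ k) (fst z) = fst (dstate ts z s (axis j 1, 0)) $ k"
    using nth[OF has_derivative_fst[OF Dq]] by (intro partial_deriv_eq) (simp add: state_def)
  show "partial_deriv j (\<lambda>p'. Q ts (fst z) p' s $ k) (snd z) = fst (dstate ts z s (0, axis j 1)) $ k"
    using nth[OF has_derivative_fst[OF Dp]] by (intro partial_deriv_eq) (simp add: state_def)
  show "partial_deriv j (\<lambda>q'. P ts q' (snd z) s $ k) (fst z) = snd (dstate ts z s (axis j 1, 0)) $ k"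
    using nth[OF has_derivative_snd[OF Dq]] by (intro partial_deriv_eq) (simp add: state_def)
  show "partial_deriv j (\<lambda>p'. P ts (fst z) p' s $ k) (snd z) = snd (dstate ts z s (0, axis j 1)) $ k"
    using nth[OF has_derivative_snd[OF Dp]] by (intro partial_deriv_eq) (simp add: state_def)
qed

text \<open>The derivative is Lipschitz in time: the difference of two neighbouring trajectories grows at a rate proportional to their
initial distance, and this survives division by that distance and passage to the limit.\<close>

lemma dstate_continuous:
  assumes ts: "hop_times t ts"
  shows "continuous_on {0..t} (\<lambda>s. dstate ts z s v)"
proof -
  obtain K d where K: "0 \<le> K" "0 < d"
    "\<And>z' s. norm (z' - z) < d \<Longrightarrow> s \<in> {0..t} \<Longrightarrow> norm (state ts z' s - state ts z s) \<le> K * norm (z' - z)"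
    using state_lipschitz_initial[OF ts] by blast
  obtain R where R: "\<And>s. s \<in> {0..t} \<Longrightarrow> norm (state ts z s) \<le> R"
    using bounded_curve[OF state_continuous[OF ts]] by blast
  obtain L where L: "0 \<le> L" "\<And>j x y. j < 2 \<Longrightarrow> x \<in> cball 0 (R + K * d) \<Longrightarrow> y \<in> cball 0 (R + K * d)
      \<Longrightarrow> norm (field V j x - field V j y) \<le> L * norm (x - y)"
    using field_lipschitz by blast
  have increment: "norm ((state ts z' s2 - state ts z s2) - (state ts z' s1 - state ts z s1))
      \<le> L * K * norm (z' - z) * \<bar>s2 - s1\<bar>"
    if z': "norm (z' - z) < d" and s: "s1 \<in> {0..t}" "s2 \<in> {0..t}" for z' s1 s2
  proof (rule bounded_derivative_lipschitz[OF _ _ _ _ _ s])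
    show "continuous_on {0..t} (\<lambda>s. state ts z' s - state ts z s)"
      by (intro continuous_intros state_continuous ts)
    show "finite (set ts)" by simp
    show "((\<lambda>s. state ts z' s - state ts z s) has_vector_derivative
        field V (level ts r) (state ts z' r) - field V (level ts r) (state ts z r)) (at r within {0..t})"
      if "r \<in> {0..t} - set ts" for r
      by (intro has_vector_derivative_diff state_derivative ts that)
    show "0 \<le> L * K * norm (z' - z)" using L(1) K(1) by simp
    fix r assume r: "r \<in> {0..t} - set ts"
    then have close: "norm (state ts z' r - state ts z r) \<le> K * norm (z' - z)"
      using K(3)[OF z', of r] by auto
    have "K * norm (z' - z) \<le> K * d" using z' K(1) by (intro mult_left_mono) auto
    then have "norm (state ts z r) \<le> R + K * d" "norm (state ts z' r) \<le> R + K * d"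
      using close R[of r] r K(1,2) norm_triangle_sub[of "state ts z' r" "state ts z r"]
      by (auto intro: add_increasing2)
    then have "norm (field V (level ts r) (state ts z' r) - field V (level ts r) (state ts z r))
        \<le> L * norm (state ts z' r - state ts z r)"
      by (intro L(2) level_less_2) auto
    also have "\<dots> \<le> L * (K * norm (z' - z))" using close L(1) by (intro mult_left_mono)
    finally show "norm (field V (level ts r) (state ts z' r) - field V (level ts r) (state ts z r))
        \<le> L * K * norm (z' - z)" by (simp add: mult.assoc)
  qed
  have lip: "norm (dstate ts z s2 v - dstate ts z s1 v) \<le> (L * K * norm v) * \<bar>s2 - s1\<bar>"
    if s: "s1 \<in> {0..t}" "s2 \<in> {0..t}" for s1 s2
  proof (rule tendsto_upperbound)
    let ?z = "\<lambda>k. z + (1 / real (Suc k)) *\<^sub>R v"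
    show "(\<lambda>k. norm (real (Suc k) *\<^sub>R (state ts (?z k) s2 - state ts z s2)
        - real (Suc k) *\<^sub>R (state ts (?z k) s1 - state ts z s1))) \<longlonglongrightarrow> norm (dstate ts z s2 v - dstate ts z s1 v)"
      by (intro tendsto_intros dstate_LIMSEQ ts s)
    have "(\<lambda>k. norm ((1 / real (Suc k)) *\<^sub>R v)) \<longlonglongrightarrow> norm (0 *\<^sub>R v)"
      by (intro tendsto_intros LIMSEQ_Suc[OF lim_1_over_n])
    then have "(\<lambda>k. norm ((1 / real (Suc k)) *\<^sub>R v)) \<longlonglongrightarrow> 0" by simp
    then have "\<forall>\<^sub>F k in sequentially. norm ((1 / real (Suc k)) *\<^sub>R v) < d"
      using K(2) by (rule order_tendstoD(2))
    then show "\<forall>\<^sub>F k in sequentially. norm (real (Suc k) *\<^sub>R (state ts (?z k) s2 - state ts z s2)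
        - real (Suc k) *\<^sub>R (state ts (?z k) s1 - state ts z s1)) \<le> (L * K * norm v) * \<bar>s2 - s1\<bar>"
    proof eventually_elim
      case (elim k)
      have "norm (?z k - z) < d" using elim by simp
      then have "real (Suc k) * norm ((state ts (?z k) s2 - state ts z s2) - (state ts (?z k) s1 - state ts z s1))
          \<le> real (Suc k) * (L * K * norm (?z k - z) * \<bar>s2 - s1\<bar>)"
        by (intro mult_left_mono increment s) auto
      then have "norm (real (Suc k) *\<^sub>R ((state ts (?z k) s2 - state ts z s2) - (state ts (?z k) s1 - state ts z s1)))
          \<le> real (Suc k) * (L * K * norm (?z k - z) * \<bar>s2 - s1\<bar>)"
        by (simp only: norm_scaleR abs_of_nat)
      also have "\<dots> = (L * K * norm v) * \<bar>s2 - s1\<bar>" by (simp del: of_nat_Suc)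
      finally show ?case by (simp only: scaleR_diff_right)
    qed
  qed simp
  have "(L * K * norm v)-lipschitz_on {0..t} (\<lambda>s. dstate ts z s v)"
    using lip L(1) K(1) by (intro lipschitz_onI) (auto simp: dist_norm norm_minus_commute abs_minus_commute)
  then show ?thesis by (rule lipschitz_on_continuous_on)
qed

lemma measurable_shift_region:
  fixes v :: "'b::euclidean_space"
  shows "(\<lambda>x. ((fst (fst x) + v, snd (fst x)), snd x)) \<in> region_space t n \<rightarrow>\<^sub>M region_space t n"
proof (rule measurable_restrict_space3)
  show "(\<lambda>x. ((fst (fst x) + v, snd (fst x)), snd x))
      \<in> path_space n \<Otimes>\<^sub>M borel \<rightarrow>\<^sub>M (path_space n \<Otimes>\<^sub>M borel :: (('b \<times> (nat \<Rightarrow> real)) \<times> real) measure)"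
    unfolding path_space_def by measurable
qed (auto simp: hop_region_def)

lemma measurable_dstate:
  "(\<lambda>x. dstate (times n (snd (fst x))) (fst (fst x)) (snd x) v) \<in> borel_measurable (region_space t n)"
proof (rule borel_measurable_LIMSEQ_metric)
  let ?f = "\<lambda>k x. real (Suc k) *\<^sub>R
      (state (times n (snd (fst x))) (fst (fst x) + (1 / real (Suc k)) *\<^sub>R v) (snd x)
        - state (times n (snd (fst x))) (fst (fst x)) (snd x))"
  fix k
  show "?f k \<in> borel_measurable (region_space t n)"
    using measurable_compose[OF measurable_shift_region measurable_state, of "(1 / real (Suc k)) *\<^sub>R v" n]
    by (intro borel_measurable_scaleR borel_measurable_diff measurable_state) (simp_all del: upt_Suc of_nat_Suc)
next
  fix x assume "x \<in> space (region_space t n :: ((((real^'m) \<times> (real^'m)) \<times> (nat \<Rightarrow> real)) \<times> real) measure)"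
  then have "hop_times t (times n (snd (fst x)))" "snd x \<in> {0..t}"
    by (auto simp: space_restrict_space hop_region_def time_simplex_def)
  then show "(\<lambda>k. real (Suc k) *\<^sub>R
      (state (times n (snd (fst x))) (fst (fst x) + (1 / real (Suc k)) *\<^sub>R v) (snd x)
        - state (times n (snd (fst x))) (fst (fst x)) (snd x))) \<longlonglongrightarrow> dstate (times n (snd (fst x))) (fst (fst x)) (snd x) v"
    by (rule dstate_LIMSEQ)
qed

end


section \<open>Amplitude and action as time integrals\<close>

lemma continuous_on_det:
  fixes M :: "'a::topological_space \<Rightarrow> complex^'n::finite^'n"
  assumes "\<And>a b. continuous_on S (\<lambda>x. M x $ a $ b)"
  shows "continuous_on S (\<lambda>x. det (M x))"
  unfolding det_def by (intro continuous_intros assms)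

lemma borel_measurable_det:
  fixes M :: "'a \<Rightarrow> complex^'n::finite^'n"
  assumes "\<And>a b. (\<lambda>x. M x $ a $ b) \<in> borel_measurable N"
  shows "(\<lambda>x. det (M x)) \<in> borel_measurable N"
  unfolding det_def by (intro borel_measurable_sum borel_measurable_times borel_measurable_prod assms borel_measurable_const)

text \<open>Cramer's rule exhibits the trace as a rational function of the matrix entries, from which continuity
and measurability follow.\<close>

lemma trace_matrix_inv_mult:
  fixes Z B :: "complex^'n::finite^'n"
  assumes "invertible Z"
  shows "trace (matrix_inv Z ** B)
    = (\<Sum>i\<in>UNIV. \<Sum>k\<in>UNIV. det (\<chi> a b. if b = i then axis k 1 $ a else Z $ a $ b) / det Z * B $ k $ i)"
proof -
  have inv: "Z ** matrix_inv Z = mat 1"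
    using someI_ex[of "\<lambda>A'. Z ** A' = mat 1 \<and> A' ** Z = mat 1"] assms
    by (simp add: invertible_def matrix_inv_def)
  have nz: "det Z \<noteq> 0" using assms by (simp add: invertible_det_nz)
  have "matrix_inv Z $ i $ k = det (\<chi> a b. if b = i then axis k 1 $ a else Z $ a $ b) / det Z" for i k
  proof -
    have "Z *v (matrix_inv Z *v axis k 1) = axis k 1"
      by (simp add: matrix_vector_mul_assoc inv)
    then have "matrix_inv Z *v axis k 1 = (\<chi> i. det (\<chi> a b. if b = i then axis k 1 $ a else Z $ a $ b) / det Z)"
      using cramer[OF nz] by blast
    then have "(matrix_inv Z *v axis k 1) $ i = det (\<chi> a b. if b = i then axis k 1 $ a else Z $ a $ b) / det Z"
      by simp
    moreover have "(matrix_inv Z *v axis k 1) $ i = matrix_inv Z $ i $ k"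
      by (simp add: matrix_vector_mult_def axis_def if_distrib cong: if_cong)
    ultimately show ?thesis by simp
  qed
  then show ?thesis by (simp add: trace_def matrix_matrix_mult_def)
qed

lemma continuous_on_trace_matrix_inv_mult:
  fixes Z B :: "'a::topological_space \<Rightarrow> complex^'n::finite^'n"
  assumes inv: "\<And>x. x \<in> S \<Longrightarrow> invertible (Z x)"
    and Z: "\<And>a b. continuous_on S (\<lambda>x. Z x $ a $ b)" and B: "\<And>a b. continuous_on S (\<lambda>x. B x $ a $ b)"
  shows "continuous_on S (\<lambda>x. trace (matrix_inv (Z x) ** B x))"
proof -
  have e: "continuous_on S (\<lambda>x. (\<chi> a b. if b = i then axis k 1 $ a else Z x $ a $ b) $ a $ b)" for i k a b
    using Z by (cases "b = i") simp_all
  have "continuous_on S (\<lambda>x. \<Sum>i\<in>UNIV. \<Sum>k\<in>UNIV.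
      det (\<chi> a b. if b = i then axis k 1 $ a else Z x $ a $ b) / det (Z x) * B x $ k $ i)"
    using inv by (intro continuous_on_sum continuous_on_mult continuous_on_divide continuous_on_det e Z B)
      (auto simp: invertible_det_nz)
  then show ?thesis
    using inv by (subst continuous_on_cong[OF refl trace_matrix_inv_mult]) auto
qed

lemma measurable_trace_matrix_inv_mult:
  fixes Z B :: "'a \<Rightarrow> complex^'n::finite^'n"
  assumes inv: "\<And>x. x \<in> space N \<Longrightarrow> invertible (Z x)"
    and Z: "\<And>a b. (\<lambda>x. Z x $ a $ b) \<in> borel_measurable N" and B: "\<And>a b. (\<lambda>x. B x $ a $ b) \<in> borel_measurable N"
  shows "(\<lambda>x. trace (matrix_inv (Z x) ** B x)) \<in> borel_measurable N"
proof -
  have e: "(\<lambda>x. (\<chi> a b. if b = i then axis k 1 $ a else Z x $ a $ b) $ a $ b) \<in> borel_measurable N" for i k a b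
    using Z by (cases "b = i") simp_all
  have "(\<lambda>x. \<Sum>i\<in>UNIV. \<Sum>k\<in>UNIV.
      det (\<chi> a b. if b = i then axis k 1 $ a else Z x $ a $ b) / det (Z x) * B x $ k $ i) \<in> borel_measurable N"
    by (intro borel_measurable_sum borel_measurable_times borel_measurable_divide borel_measurable_det e Z B)
  then show ?thesis
    using inv by (subst measurable_cong[OF trace_matrix_inv_mult]) auto
qed

lemma measurable_level_time: "level ts \<in> borel \<rightarrow>\<^sub>M count_space UNIV"
proof -
  have "(\<lambda>s. length (filter (\<lambda>r. r \<le> s) ts)) \<in> borel \<rightarrow>\<^sub>M count_space UNIV"
  proof (induction ts)
    case (Cons a ts)
    note Cons[measurable]
    have "(\<lambda>s. if a \<le> s then Suc (length (filter (\<lambda>r. r \<le> s) ts)) else length (filter (\<lambda>r. r \<le> s) ts))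
        \<in> borel \<rightarrow>\<^sub>M count_space UNIV"
      by measurable
    moreover have "(\<lambda>s. if a \<le> s then Suc (length (filter (\<lambda>r. r \<le> s) ts)) else length (filter (\<lambda>r. r \<le> s) ts))
        = (\<lambda>s. length (filter (\<lambda>r. r \<le> s) (a # ts)))"
      by auto
    ultimately show ?case by (simp only:)
  qed simp
  from measurable_compose[OF this, of "\<lambda>k. k mod 2" "count_space UNIV"]
  show ?thesis by (simp add: level_def[abs_def])
qed

lemma measurable_level:
  "(\<lambda>x. level (times n (snd (fst x))) (snd x)) \<in> path_space n \<Otimes>\<^sub>M borel \<rightarrow>\<^sub>M count_space UNIV"
proof -
  let ?M = "path_space n \<Otimes>\<^sub>M borel :: (('a \<times> (nat \<Rightarrow> real)) \<times> real) measure"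
  have "m \<le> n \<Longrightarrow> (\<lambda>x. length (filter (\<lambda>r. r \<le> snd x) (times m (snd (fst x))))) \<in> ?M \<rightarrow>\<^sub>M count_space UNIV" for m
  proof (induction m)
    case (Suc m)
    have [measurable]: "(\<lambda>x. length (filter (\<lambda>r. r \<le> snd x) (times m (snd (fst x))))) \<in> ?M \<rightarrow>\<^sub>M count_space UNIV"
      using Suc by simp
    have [measurable]: "(\<lambda>x. snd (fst x) (Suc m)) \<in> borel_measurable ?M"
      using Suc(2) by (intro measurable_compose[OF measurable_fst measurable_path_space_time]) auto
    have "(\<lambda>x. if snd (fst x) (Suc m) \<le> snd x then Suc (length (filter (\<lambda>r. r \<le> snd x) (times m (snd (fst x)))))
        else length (filter (\<lambda>r. r \<le> snd x) (times m (snd (fst x))))) \<in> ?M \<rightarrow>\<^sub>M count_space UNIV"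
      by measurable
    moreover have "(if snd (fst x) (Suc m) \<le> snd x then Suc (length (filter (\<lambda>r. r \<le> snd x) (times m (snd (fst x)))))
        else length (filter (\<lambda>r. r \<le> snd x) (times m (snd (fst x)))))
        = length (filter (\<lambda>r. r \<le> snd x) (times (Suc m) (snd (fst x))))" for x :: "('a \<times> (nat \<Rightarrow> real)) \<times> real"
      by (subst upt_Suc_append) auto
    ultimately show ?case by (simp only:)
  qed simp
  from measurable_compose[OF this[OF order_refl], of "\<lambda>k. k mod 2" "count_space UNIV"]
  show ?thesis by (simp add: level_def del: upt_Suc)
qed

lemma level_eventually_const:
  assumes "s \<notin> set ts"
  shows "\<forall>\<^sub>F r in at s. level ts r = level ts s"
proof -
  have "\<forall>u\<in>set ts. \<forall>\<^sub>F r in at s. (u \<le> r) = (u \<le> s)"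
  proof
    fix u assume "u \<in> set ts"
    with assms consider "u < s" | "s < u" by force
    then show "\<forall>\<^sub>F r in at s. (u \<le> r) = (u \<le> s)"
    proof cases
      case 1
      have "\<forall>\<^sub>F r in at s. u < r" using 1 by (intro order_tendstoD(1)[OF tendsto_ident_at])
      then show ?thesis by eventually_elim (use 1 in auto)
    next
      case 2
      have "\<forall>\<^sub>F r in at s. r < u" using 2 by (intro order_tendstoD(2)[OF tendsto_ident_at])
      then show ?thesis by eventually_elim (use 2 in auto)
    qed
  qed
  then have "\<forall>\<^sub>F r in at s. \<forall>u\<in>set ts. (u \<le> r) = (u \<le> s)"
    by (intro eventually_ball_finite) auto
  then show ?thesis
    by eventually_elim (auto simp: level_def cong: filter_cong)
qed

text \<open>The level path jumps, so that the integrand is not continuous; it is pieced together from one continuous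
function for each level.\<close>

lemma set_integrable_by_level:
  fixes f :: "nat \<Rightarrow> real \<Rightarrow> 'b::euclidean_space"
  assumes "\<And>j. j < 2 \<Longrightarrow> continuous_on {0..b} (f j)"
  shows "set_integrable lborel {0..b} (\<lambda>s. f (level ts s) s)"
proof -
  have f: "integrable lborel (\<lambda>s. indicator {0..b} s *\<^sub>R f j s)" if "j < 2" for j
    using borel_integrable_atLeastAtMost'[OF assms[OF that]] by (simp add: set_integrable_def)
  have sets: "{s. level ts s = j} \<in> sets lborel" for j
    using measurable_sets[OF measurable_level_time, of "{j}" ts] by (simp add: vimage_def)
  have "integrable lborel (\<lambda>s. indicator {s. level ts s = 0} s *\<^sub>R (indicator {0..b} s *\<^sub>R f 0 s)
      + indicator {s. level ts s = 1} s *\<^sub>R (indicator {0..b} s *\<^sub>R f 1 s))"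
    by (intro Bochner_Integration.integrable_add integrable_mult_indicator sets f) auto
  also have "(\<lambda>s. indicator {s. level ts s = 0} s *\<^sub>R (indicator {0..b} s *\<^sub>R f 0 s)
      + indicator {s. level ts s = 1} s *\<^sub>R (indicator {0..b} s *\<^sub>R f 1 s))
      = (\<lambda>s. indicator {0..b} s *\<^sub>R f (level ts s) s)"
  proof
    fix s
    show "indicator {s. level ts s = 0} s *\<^sub>R (indicator {0..b} s *\<^sub>R f 0 s)
      + indicator {s. level ts s = 1} s *\<^sub>R (indicator {0..b} s *\<^sub>R f 1 s)
      = indicator {0..b} s *\<^sub>R f (level ts s) s"
      using level_less_2[of ts s] by (auto simp: less_2_cases_iff indicator_def)
  qed
  finally show ?thesis by (simp add: set_integrable_def)
qed

abbreviation simplex_space :: "real \<Rightarrow> nat \<Rightarrow> ('a::euclidean_space \<times> (nat \<Rightarrow> real)) measure" where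
  "simplex_space t n \<equiv> restrict_space (path_space n) {x. snd x \<in> time_simplex n t}"

lemma measurable_time_integral:
  fixes g :: "('a::euclidean_space \<times> (nat \<Rightarrow> real)) \<times> real \<Rightarrow> 'b::euclidean_space"
  assumes g: "g \<in> borel_measurable (region_space t n)"
    and int: "\<And>x. x \<in> space (simplex_space t n) \<Longrightarrow> set_integrable lborel {0..t} (\<lambda>s. g (x, s))"
  shows "(\<lambda>x. integral {0..t} (\<lambda>s. g (x, s))) \<in> borel_measurable (simplex_space t n)"
proof -
  have "(\<lambda>x. if x \<in> hop_region t n then g x else 0) \<in> borel_measurable (path_space n \<Otimes>\<^sub>M borel)"
    using g sets_hop_region[of n t] by (subst measurable_If_restrict_space_iff) auto
  moreover have "(\<lambda>(x, s). if (x, s) \<in> hop_region t n then g (x, s) else 0)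
      = (\<lambda>x. if x \<in> hop_region t n then g x else 0)"
    by (auto simp: fun_eq_iff)
  ultimately have "(\<lambda>(x, s). if (x, s) \<in> hop_region t n then g (x, s) else 0) \<in> borel_measurable (path_space n \<Otimes>\<^sub>M lborel)"
    by (subst measurable_cong_sets[OF sets_pair_measure_cong[OF refl sets_lborel] refl]) (simp only:)
  then have "(\<lambda>x. LINT s|lborel. (if (x, s) \<in> hop_region t n then g (x, s) else 0)) \<in> borel_measurable (path_space n)"
    by (rule lborel.borel_measurable_lebesgue_integral)
  then have "(\<lambda>x. LINT s|lborel. (if (x, s) \<in> hop_region t n then g (x, s) else 0)) \<in> borel_measurable (simplex_space t n)"
    by (rule measurable_restrict_space1)
  moreover have "(LINT s|lborel. (if (x, s) \<in> hop_region t n then g (x, s) else 0)) = integral {0..t} (\<lambda>s. g (x, s))"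
    if x: "x \<in> space (simplex_space t n)" for x
  proof -
    have "(LINT s|lborel. (if (x, s) \<in> hop_region t n then g (x, s) else 0)) = (LINT s:{0..t}|lborel. g (x, s))"
      using x unfolding set_lebesgue_integral_def
      by (intro Bochner_Integration.integral_cong) (auto simp: hop_region_def space_restrict_space)
    with set_borel_integral_eq_integral(2)[OF int[OF x]] show ?thesis by simp
  qed
  ultimately show ?thesis by (simp cong: measurable_cong)
qed

context hopping_flow
begin

definition rate :: "nat \<Rightarrow> real list \<Rightarrow> (real^'m) \<times> (real^'m) \<Rightarrow> real \<Rightarrow> complex" where
  "rate j ts z s = amp_rate (surface V j) (\<lambda>q p. Q ts q p s) (\<lambda>q p. P ts q p s) (fst z) (snd z)"

lemma dz_state:
  assumes "hop_times t ts" "s \<in> {0..t}"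
  shows "dz (\<lambda>q p. Q ts q p s) (fst z) (snd z) $ j $ k
      = complex_of_real (fst (dstate ts z s (axis j 1, 0)) $ k) - \<i> * complex_of_real (fst (dstate ts z s (0, axis j 1)) $ k)"
    and "dz (\<lambda>q p. P ts q p s) (fst z) (snd z) $ j $ k
      = complex_of_real (snd (dstate ts z s (axis j 1, 0)) $ k) - \<i> * complex_of_real (snd (dstate ts z s (0, axis j 1)) $ k)"
  by (simp_all add: dz_def partial_deriv_state[OF assms])

lemma Z_invertible:
  assumes "hop_times t ts" "s \<in> {0..t}"
  shows "invertible (Z_matrix (\<lambda>q p. Q ts q p s) (\<lambda>q p. P ts q p s) (fst z) (snd z))"
  using trajectory[OF assms(1)] assms(2) by (simp add: trajectory_def)

lemma dz_continuous:
  assumes "hop_times t ts"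
  shows "continuous_on {0..t} (\<lambda>s. dz (\<lambda>q p. Q ts q p s) (fst z) (snd z) $ j $ k)"
    and "continuous_on {0..t} (\<lambda>s. dz (\<lambda>q p. P ts q p s) (fst z) (snd z) $ j $ k)"
  by (subst continuous_on_cong[OF refl dz_state(1)[OF assms]], assumption,
      intro continuous_intros dstate_continuous assms)
    (subst continuous_on_cong[OF refl dz_state(2)[OF assms]], assumption,
      intro continuous_intros dstate_continuous assms)

lemma region_space_hop_times:
  assumes "x \<in> space (region_space t n :: (('a::euclidean_space \<times> (nat \<Rightarrow> real)) \<times> real) measure)"
  shows "hop_times t (times n (snd (fst x)))" "snd x \<in> {0..t}"
  using assms by (auto simp: space_restrict_space hop_region_def time_simplex_def)

lemma dz_measurable:
  shows "(\<lambda>x. dz (\<lambda>q p. Q (times n (snd (fst x))) q p (snd x)) (fst (fst (fst x))) (snd (fst (fst x))) $ j $ k)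
      \<in> borel_measurable (region_space t n)"
    and "(\<lambda>x. dz (\<lambda>q p. P (times n (snd (fst x))) q p (snd x)) (fst (fst (fst x))) (snd (fst (fst x))) $ j $ k)
      \<in> borel_measurable (region_space t n)"
proof -
  have q: "(\<lambda>x. complex_of_real (fst (dstate (times n (snd (fst x))) (fst (fst x)) (snd x) v) $ k)) \<in> borel_measurable (region_space t n)" for v
    by (rule measurable_compose[OF measurable_dstate]) (intro borel_measurable_continuous_onI continuous_intros)
  have p: "(\<lambda>x. complex_of_real (snd (dstate (times n (snd (fst x))) (fst (fst x)) (snd x) v) $ k)) \<in> borel_measurable (region_space t n)" for v
    by (rule measurable_compose[OF measurable_dstate]) (intro borel_measurable_continuous_onI continuous_intros)
  show "(\<lambda>x. dz (\<lambda>q p. Q (times n (snd (fst x))) q p (snd x)) (fst (fst (fst x))) (snd (fst (fst x))) $ j $ k)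
      \<in> borel_measurable (region_space t n)"
    by (subst measurable_cong[OF dz_state(1)[OF region_space_hop_times]]; assumption?)
      (intro borel_measurable_diff borel_measurable_times borel_measurable_const q)
  show "(\<lambda>x. dz (\<lambda>q p. P (times n (snd (fst x))) q p (snd x)) (fst (fst (fst x))) (snd (fst (fst x))) $ j $ k)
      \<in> borel_measurable (region_space t n)"
    by (subst measurable_cong[OF dz_state(2)[OF region_space_hop_times]]; assumption?)
      (intro borel_measurable_diff borel_measurable_times borel_measurable_const p)
qed

lemma rate_continuous:
  assumes ts: "hop_times t ts" and j: "j < 2"
  shows "continuous_on {0..t} (rate j ts z)"
proof -
  have "continuous_on {0..t} (\<lambda>s. fst (state ts z s))"
    by (intro continuous_intros state_continuous ts)
  then have q: "continuous_on {0..t} (\<lambda>s. Q ts (fst z) (snd z) s)" by (simp add: state_def)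
  have h: "continuous_on {0..t} (\<lambda>s. hess (surface V j) (Q ts (fst z) (snd z) s) $ a $ b)" for a b
    by (intro continuous_intros continuous_on_compose2[OF C2_continuous(3)[OF C2_surface[OF j]] q]) auto
  show ?thesis
    unfolding rate_def[abs_def] amp_rate_def
    by (intro continuous_on_mult continuous_on_const continuous_on_trace_matrix_inv_mult Z_invertible ts)
      (auto simp: Z_matrix_def matrix_matrix_mult_def
        intro!: continuous_on_add continuous_on_diff continuous_on_mult continuous_on_const dz_continuous ts
          continuous_on_sum continuous_on_of_real h)
qed

lemma rate_measurable:
  assumes j: "j < 2"
  shows "(\<lambda>x. rate j (times n (snd (fst x))) (fst (fst x)) (snd x)) \<in> borel_measurable (region_space t n)"
proof -
  have h: "(\<lambda>x. complex_of_real
      (hess (surface V j) (Q (times n (snd (fst x))) (fst (fst (fst x))) (snd (fst (fst x))) (snd x)) $ a $ b))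
      \<in> borel_measurable (region_space t n)" for a b
  proof -
    have "continuous_on UNIV (\<lambda>x. complex_of_real (hess (surface V j) (fst x) $ a $ b))"
      by (intro continuous_intros continuous_on_compose2[OF C2_continuous(3)[OF C2_surface[OF j]]]) auto
    from measurable_compose[OF measurable_state borel_measurable_continuous_onI[OF this], of n]
    show ?thesis by (simp only: state_def fst_conv)
  qed
  let ?Q = "\<lambda>x q p. Q (times n (snd (fst x))) q p (snd x)" and ?P = "\<lambda>x q p. P (times n (snd (fst x))) q p (snd x)"
  define Zf where "Zf x = Z_matrix (?Q x) (?P x) (fst (fst (fst x))) (snd (fst (fst x)))"
    for x :: "(((real^'m) \<times> (real^'m)) \<times> (nat \<Rightarrow> real)) \<times> real"
  define Bf where "Bf x = dz (?P x) (fst (fst (fst x))) (snd (fst (fst x))) - (\<chi> a k. \<i> *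
      (dz (?Q x) (fst (fst (fst x))) (snd (fst (fst x))) **
        (\<chi> a b. complex_of_real (hess (surface V j) (?Q x (fst (fst (fst x))) (snd (fst (fst x)))) $ a $ b))) $ a $ k)"
    for x :: "(((real^'m) \<times> (real^'m)) \<times> (nat \<Rightarrow> real)) \<times> real"
  have "invertible (Zf x)" if "x \<in> space (region_space t n)" for x
    unfolding Zf_def by (rule Z_invertible[OF region_space_hop_times[OF that]])
  moreover have "(\<lambda>x. Zf x $ a $ b) \<in> borel_measurable (region_space t n)" for a b
    unfolding Zf_def Z_matrix_def vec_lambda_beta
    by (intro borel_measurable_add borel_measurable_times borel_measurable_const dz_measurable)
  moreover have "(\<lambda>x. Bf x $ a $ b) \<in> borel_measurable (region_space t n)" for a b
    unfolding Bf_def matrix_matrix_mult_def vec_lambda_beta vector_minus_component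
    by (intro borel_measurable_diff borel_measurable_times borel_measurable_const dz_measurable borel_measurable_sum h)
  ultimately have "(\<lambda>x. 1 / 2 * trace (matrix_inv (Zf x) ** Bf x)) \<in> borel_measurable (region_space t n)"
    by (intro borel_measurable_times borel_measurable_const measurable_trace_matrix_inv_mult)
  then show ?thesis
    unfolding rate_def amp_rate_def Zf_def Bf_def .
qed

text \<open>The amplitude satisfies a linear equation. Solving it expresses \<open>A\<close> by quantities whose measurability in the initial
data and the hopping times is known.\<close>

lemma amplitude_formula:
  assumes ts: "hop_times t ts"
  shows "A ts (fst z) (snd z) t
    = init_amp \<epsilon> u0 (fst z) (snd z) * exp (integral {0..t} (\<lambda>s. rate (level ts s) ts z s))"
proof -
  define f where "f s = rate (level ts s) ts z s" for s
  define E where "E s = integral {0..s} f" for s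
  \<comment> \<open>Constant in time, by the product rule off the hopping times.\<close>
  define B where "B s = A ts (fst z) (snd z) s * exp (- E s)" for s
  have f_int: "f integrable_on {0..t}"
    unfolding f_def using rate_continuous[OF ts]
    by (intro set_borel_integral_eq_integral(1) set_integrable_by_level) auto
  have tr: "A ts (fst z) (snd z) 0 = init_amp \<epsilon> u0 (fst z) (snd z)" "continuous_on {0..t} (A ts (fst z) (snd z))"
    "\<And>s. s \<in> {0..t} - set ts \<Longrightarrow>
      (A ts (fst z) (snd z) has_vector_derivative A ts (fst z) (snd z) s * f s) (at s within {0..t})"
    using trajectory[OF ts] by (simp_all add: trajectory_def Let_def f_def rate_def)
  have "((\<lambda>s. 0) has_integral (B t - B 0)) {0..t}"
  proof (rule fundamental_theorem_of_calculus_interior_strong[of "set ts"])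
    show "continuous_on {0..t} B"
      unfolding B_def E_def by (intro continuous_intros tr indefinite_integral_continuous_1 f_int)
    fix s assume s: "s \<in> {0<..<t} - set ts"
    have sub: "{0<..<t} - set ts \<subseteq> {0..t} - set ts" "open ({0<..<t} - set ts)"
      by (auto intro: open_Diff finite_imp_closed)
    have at: "at s within ({0..t} - set ts) = at s" "at s within {0..t} = at s"
      using at_within_open_subset[OF s sub(2,1)] at_within_Icc_at[of 0 s t] s by auto
    have "continuous (at s within ({0..t} - set ts)) f"
    proof -
      have "continuous_on {0..t} (rate (level ts s) ts z)" by (rule rate_continuous[OF ts level_less_2])
      then have "(rate (level ts s) ts z \<longlongrightarrow> f s) (at s)"
        using s at(2) by (auto simp: continuous_on f_def dest!: bspec[where x = s])
      moreover have "\<forall>\<^sub>F r in at s. rate (level ts s) ts z r = f r"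
        using level_eventually_const[of s ts] s by (auto simp: f_def elim!: eventually_mono)
      ultimately have "(f \<longlongrightarrow> f s) (at s)" by (rule Lim_transform_eventually)
      then show ?thesis by (simp add: at continuous_within)
    qed
    then have E': "(E has_vector_derivative f s) (at s)"
      using integral_has_vector_derivative_continuous_at[OF f_int, of s "set ts"] s
      by (simp add: at E_def[abs_def])
    have "((\<lambda>s. exp (- E s)) has_vector_derivative - f s * exp (- E s)) (at s)"
      using field_vector_diff_chain_at[OF has_vector_derivative_minus[OF E'], of exp "exp (- E s)"]
      by (simp add: o_def)
    moreover have "(A ts (fst z) (snd z) has_vector_derivative A ts (fst z) (snd z) s * f s) (at s)"
      using tr(3)[of s] s at by auto
    ultimately have "(B has_vector_derivative
        A ts (fst z) (snd z) s * (- f s * exp (- E s)) + A ts (fst z) (snd z) s * f s * exp (- E s)) (at s)"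
      unfolding B_def[abs_def] by (intro has_vector_derivative_mult)
    then show "(B has_vector_derivative 0) (at s)" by (simp add: algebra_simps)
  qed (use t_nonneg in auto)
  then have "B t = B 0" by (metis eq_iff_diff_eq_0 has_integral_0_eq)
  then have "A ts (fst z) (snd z) t * exp (- E t) * exp (E t) = A ts (fst z) (snd z) 0 * exp (E t)"
    by (simp add: B_def E_def)
  then show ?thesis
    by (simp add: mult.assoc tr(1) E_def f_def[abs_def] flip: exp_add)
qed

lemma action_formula:
  assumes ts: "hop_times t ts"
  shows "S ts (fst z) (snd z) t
    = integral {0..t} (\<lambda>s. (norm (snd (state ts z s)))\<^sup>2 / 2 - surface V (level ts s) (fst (state ts z s)))"
proof -
  have tr: "S ts (fst z) (snd z) 0 = 0" "continuous_on {0..t} (S ts (fst z) (snd z))"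
    "\<And>s. s \<in> {0..t} - set ts \<Longrightarrow>
      (S ts (fst z) (snd z) has_vector_derivative
        (norm (snd (state ts z s)))\<^sup>2 / 2 - surface V (level ts s) (fst (state ts z s))) (at s within {0..t})"
    using trajectory[OF ts] by (simp_all add: trajectory_def Let_def state_def)
  have "((\<lambda>s. (norm (snd (state ts z s)))\<^sup>2 / 2 - surface V (level ts s) (fst (state ts z s))) has_integral
      (S ts (fst z) (snd z) t - S ts (fst z) (snd z) 0)) {0..t}"
  proof (rule fundamental_theorem_of_calculus_interior_strong[of "set ts"])
    fix s assume "s \<in> {0<..<t} - set ts"
    then show "(S ts (fst z) (snd z) has_vector_derivative
        (norm (snd (state ts z s)))\<^sup>2 / 2 - surface V (level ts s) (fst (state ts z s))) (at s)"
      using tr(3)[of s] by (auto simp: at_within_Icc_at)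
  qed (use t_nonneg tr in auto)
  then show ?thesis by (simp add: integral_unique tr(1))
qed

end


section \<open>Measurability of the ansatz integrand\<close>

lemma time_simplexD:
  assumes "\<tau> \<in> time_simplex n t" "j \<in> {1..n}"
  shows "0 < \<tau> j" "\<tau> j < t"
  using assms by (simp_all add: time_simplex_iff)

lemma length_filter_times: "length (filter p (times n \<tau>)) = card {i\<in>{1..n}. p (\<tau> i)}"
proof -
  have "length (filter p (times n \<tau>)) = length (filter (p \<circ> \<tau>) [1..<Suc n])"
    by (simp add: filter_map del: upt_Suc)
  also have "\<dots> = card (set (filter (p \<circ> \<tau>) [1..<Suc n]))"
    by (intro distinct_card[symmetric] distinct_filter) simp
  also have "set (filter (p \<circ> \<tau>) [1..<Suc n]) = {i\<in>{1..n}. p (\<tau> i)}" by auto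
  finally show ?thesis .
qed

lemma level_at_hop:
  assumes \<tau>: "\<tau> \<in> time_simplex n t" and j: "j \<in> {1..n}"
  shows "level (times n \<tau>) (\<tau> j) = j mod 2"
proof -
  have "{i\<in>{1..n}. \<tau> i \<le> \<tau> j} = {1..j}"
  proof (intro set_eqI iffI)
    fix i assume i: "i \<in> {i\<in>{1..n}. \<tau> i \<le> \<tau> j}"
    then have "\<not> j < i" using \<tau> j by (force simp: time_simplex_iff)
    with i show "i \<in> {1..j}" by auto
  next
    fix i assume "i \<in> {1..j}"
    then show "i \<in> {i\<in>{1..n}. \<tau> i \<le> \<tau> j}"
      using \<tau> j by (cases "i = j") (auto simp: time_simplex_iff intro!: less_imp_le)
  qed
  then show ?thesis unfolding level_def length_filter_times by simp
qed

lemma level_start: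
  assumes "hop_times t ts" shows "level ts 0 = 0"
proof -
  have "filter (\<lambda>r. r \<le> 0) ts = []" using assms by (auto simp: hop_times_def filter_empty_conv subset_iff)
  then show ?thesis by (simp add: level_def)
qed

lemma hop_prod_times:
  assumes L: "L 0 = 0" "\<And>j. j \<in> {1..n} \<Longrightarrow> L (\<tau> j) = j mod 2"
  shows "hop_prod G (times n \<tau>) L X = (\<Prod>j=1..n. G (j mod 2) ((j - 1) mod 2) (X (\<tau> j)))"
proof -
  have nth: "(0 # times n \<tau>) ! j = (if j = 0 then 0 else \<tau> j)" if "j \<le> n" for j
    using that by (cases j) (auto simp: nth_times simp del: upt_Suc)
  have lev: "L ((0 # times n \<tau>) ! j) = j mod 2" if "j \<le> n" for j
    unfolding nth[OF that] using that L by (cases "j = 0") auto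
  have len: "length (times n \<tau>) = n" by simp
  show ?thesis
    unfolding hop_prod_def len
  proof (rule prod.cong)
    fix j assume j: "j \<in> {1..n}"
    then have "j \<le> n" "j - 1 \<le> n" "j \<noteq> 0" by auto
    then show "G (L ((0 # times n \<tau>) ! j)) (L ((0 # times n \<tau>) ! (j - 1))) (X ((0 # times n \<tau>) ! j))
        = G (j mod 2) ((j - 1) mod 2) (X (\<tau> j))"
      by (simp only: lev) (simp add: nth del: upt_Suc)
  qed simp
qed

definition last_time :: "nat \<Rightarrow> (nat \<Rightarrow> real) \<Rightarrow> real" where
  "last_time n \<tau> = (if n = 0 then 0 else \<tau> n)"

lemma time_simplex_Suc:
  assumes "0 \<le> t"
  shows "\<tau> \<in> time_simplex (Suc n) t \<longleftrightarrow> \<tau> \<in> time_simplex n t \<and> last_time n \<tau> < \<tau> (Suc n) \<and> \<tau> (Suc n) < t"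
    (is "?l \<longleftrightarrow> ?r")
proof
  assume ?l then show ?r by (auto simp: time_simplex_iff last_time_def)
next
  assume r: ?r
  have le: "\<tau> i < \<tau> (Suc n)" if "i \<in> {1..n}" for i
  proof (cases "i = n")
    case True
    then show ?thesis using r that by (auto simp: last_time_def)
  next
    case False
    then have "\<tau> i < \<tau> n" using r that by (auto simp: time_simplex_iff)
    then show ?thesis using r that by (auto simp: last_time_def)
  qed
  have "0 \<le> last_time n \<tau>" using r by (auto simp: last_time_def time_simplex_iff less_imp_le)
  then have "0 < \<tau> (Suc n)" using r by linarith
  with r le show ?l by (auto simp: time_simplex_iff le_Suc_eq)
qed

lemma time_simplex_cong:
  assumes "\<And>i. i \<in> {1..n} \<Longrightarrow> \<tau> i = \<tau>' i"
  shows "\<tau> \<in> time_simplex n t \<longleftrightarrow> \<tau>' \<in> time_simplex n t"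
  using assms by (simp add: time_simplex_iff)

lemma measurable_init_amp:
  assumes [measurable]: "u0 \<in> borel_measurable borel"
  shows "(\<lambda>z. init_amp \<epsilon> u0 (fst z) (snd z)) \<in> borel_measurable borel"
proof -
  have "(\<lambda>(z, y). u0 y * exp (\<i> / \<epsilon> * (complex_of_real (- (snd z \<bullet> (y - fst z)))
      + \<i> / 2 * complex_of_real ((norm (y - fst z))\<^sup>2)))) \<in> borel_measurable (borel \<Otimes>\<^sub>M lborel)"
    unfolding borel_prod[symmetric] by measurable
  then show ?thesis
    unfolding init_amp_def
    by (intro borel_measurable_times borel_measurable_const lborel.borel_measurable_lebesgue_integral)
qed

locale hopping_model = hopping_flow V u0 \<epsilon> t Q P S A
  for V :: "'m::finite potential" and u0 :: "real^'m \<Rightarrow> complex" and \<epsilon> t :: real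
    and Q P :: "real list \<Rightarrow> real^'m \<Rightarrow> real^'m \<Rightarrow> real \<Rightarrow> real^'m"
    and S :: "real list \<Rightarrow> real^'m \<Rightarrow> real^'m \<Rightarrow> real \<Rightarrow> real"
    and A :: "real list \<Rightarrow> real^'m \<Rightarrow> real^'m \<Rightarrow> real \<Rightarrow> complex" +
  fixes \<delta> :: real
  assumes eps_pos: "0 < \<epsilon>" and delta_pos: "0 < \<delta>" and herm: "hermitian_potential V"
    and V01: "continuous_on UNIV (V 0 1)" and u0_measurable: "u0 \<in> borel_measurable borel"
begin

lemma V_10: "V 1 0 q = cnj (V 0 1 q)"
  by (rule herm[unfolded hermitian_potential_def, rule_format]) auto

lemma V_offdiag_continuous: "j < 2 \<Longrightarrow> k < 2 \<Longrightarrow> j \<noteq> k \<Longrightarrow> continuous_on UNIV (V j k)"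
proof -
  have "continuous_on UNIV (V 1 0)"
    unfolding V_10[abs_def] by (intro continuous_intros V01)
  then show "j < 2 \<Longrightarrow> k < 2 \<Longrightarrow> j \<noteq> k \<Longrightarrow> continuous_on UNIV (V j k)"
    using V01 by (auto simp: less_2_cases_iff)
qed

lemma V_offdiag_norm: "j < 2 \<Longrightarrow> k < 2 \<Longrightarrow> j \<noteq> k \<Longrightarrow> cmod (V j k q) = cmod (V 0 1 q)"
  by (auto simp: less_2_cases_iff V_10[simplified])

lemma measurable_eval_region:
  assumes h: "h \<in> borel_measurable (path_space n)"
    and range: "\<And>x. x \<in> space (simplex_space t n :: (((real^'m) \<times> (real^'m)) \<times> (nat \<Rightarrow> real)) measure) \<Longrightarrow> h x \<in> {0..t}"
  shows "(\<lambda>x. (x, h x)) \<in> simplex_space t n \<rightarrow>\<^sub>M (region_space t n :: ((((real^'m) \<times> (real^'m)) \<times> (nat \<Rightarrow> real)) \<times> real) measure)"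
proof (rule measurable_restrict_space2)
  show "(\<lambda>x. (x, h x)) \<in> simplex_space t n \<rightarrow>\<^sub>M path_space n \<Otimes>\<^sub>M borel"
    using h by (intro measurable_restrict_space1) measurable
  show "(\<lambda>x. (x, h x)) \<in> space (simplex_space t n) \<rightarrow> hop_region t n"
    using range by (auto simp: hop_region_def space_restrict_space)
qed

lemma state_at_measurable:
  assumes "h \<in> borel_measurable (path_space n)"
    and "\<And>x. x \<in> space (simplex_space t n :: (((real^'m) \<times> (real^'m)) \<times> (nat \<Rightarrow> real)) measure) \<Longrightarrow> h x \<in> {0..t}"
  shows "(\<lambda>x. state (times n (snd x)) (fst x) (h x)) \<in> borel_measurable (simplex_space t n)"
  using measurable_compose[OF measurable_eval_region[OF assms] measurable_state] by (simp only: fst_conv snd_conv)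

lemma amplitude_measurable:
  "(\<lambda>x. A (times n (snd x)) (fst (fst x)) (snd (fst x)) t) \<in> borel_measurable (simplex_space t n)"
proof -
  have lev: "(\<lambda>x. level (times n (snd (fst x))) (snd x)) \<in> region_space t n \<rightarrow>\<^sub>M count_space UNIV"
    by (rule measurable_restrict_space1[OF measurable_level])
  have "(\<lambda>x. if level (times n (snd (fst x))) (snd x) = 0 then rate 0 (times n (snd (fst x))) (fst (fst x)) (snd x)
      else rate 1 (times n (snd (fst x))) (fst (fst x)) (snd x)) \<in> borel_measurable (region_space t n)"
    by (intro measurable_If rate_measurable) (use lev in measurable)
  moreover have "(if level ts s = 0 then rate 0 ts z s else rate 1 ts z s) = rate (level ts s) ts z s" for ts z s
    using level_less_2[of ts s] by (auto simp: less_2_cases_iff)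
  ultimately have m: "(\<lambda>x. rate (level (times n (snd (fst x))) (snd x)) (times n (snd (fst x))) (fst (fst x)) (snd x))
      \<in> borel_measurable (region_space t n)"
    by (simp only:)
  have hop: "hop_times t (times n (snd x))"
    if "x \<in> space (simplex_space t n :: (((real^'m) \<times> (real^'m)) \<times> (nat \<Rightarrow> real)) measure)" for x
    using that by (simp add: space_restrict_space time_simplex_def)
  have "(\<lambda>x. integral {0..t} (\<lambda>s. rate (level (times n (snd x)) s) (times n (snd x)) (fst x) s))
      \<in> borel_measurable (simplex_space t n)"
    by (rule measurable_time_integral[OF m, unfolded fst_conv snd_conv],
        rule set_integrable_by_level[OF rate_continuous[OF hop]])
  moreover have "(\<lambda>x. init_amp \<epsilon> u0 (fst (fst x)) (snd (fst x))) \<in> borel_measurable (simplex_space t n)"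
    by (rule measurable_restrict_space1[OF measurable_compose[OF measurable_path_space_fst measurable_init_amp[OF u0_measurable]]])
  ultimately have "(\<lambda>x. init_amp \<epsilon> u0 (fst (fst x)) (snd (fst x)) *
      exp (integral {0..t} (\<lambda>s. rate (level (times n (snd x)) s) (times n (snd x)) (fst x) s)))
      \<in> borel_measurable (simplex_space t n)"
    by measurable
  then show ?thesis
    by (subst measurable_cong[OF amplitude_formula[OF hop]])
qed

lemma action_measurable:
  "(\<lambda>x. S (times n (snd x)) (fst (fst x)) (snd (fst x)) t) \<in> borel_measurable (simplex_space t n)"
proof -
  define f where "f j x = (norm (snd x))\<^sup>2 / 2 - surface V j (fst x)" for j and x :: "(real^'m) \<times> (real^'m)"
  have f: "continuous_on UNIV (f j)" if "j < 2" for j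
    unfolding f_def by (intro continuous_intros continuous_on_compose2[OF C2_continuous(1)[OF C2_surface[OF that]]]) auto
  have fm: "(\<lambda>x. f j (state (times n (snd (fst x))) (fst (fst x)) (snd x))) \<in> borel_measurable (region_space t n)"
    if "j < 2" for j
    by (rule measurable_compose[OF measurable_state borel_measurable_continuous_onI[OF f[OF that]]])
  have lev: "(\<lambda>x. level (times n (snd (fst x))) (snd x)) \<in> region_space t n \<rightarrow>\<^sub>M count_space UNIV"
    by (rule measurable_restrict_space1[OF measurable_level])
  have "(\<lambda>x. if level (times n (snd (fst x))) (snd x) = 0 then f 0 (state (times n (snd (fst x))) (fst (fst x)) (snd x))
      else f 1 (state (times n (snd (fst x))) (fst (fst x)) (snd x))) \<in> borel_measurable (region_space t n)"
    by (intro measurable_If fm) (use lev in measurable)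
  moreover have "(if level ts s = 0 then f 0 z else f 1 z) = f (level ts s) z" for ts z s
    using level_less_2[of ts s] by (auto simp: less_2_cases_iff)
  ultimately have m: "(\<lambda>x. f (level (times n (snd (fst x))) (snd x)) (state (times n (snd (fst x))) (fst (fst x)) (snd x)))
      \<in> borel_measurable (region_space t n)"
    by (simp only:)
  have hop: "hop_times t (times n (snd x))"
    if "x \<in> space (simplex_space t n :: (((real^'m) \<times> (real^'m)) \<times> (nat \<Rightarrow> real)) measure)" for x
    using that by (simp add: space_restrict_space time_simplex_def)
  have fc: "continuous_on {0..t} (\<lambda>s. f j (state ts z s))" if "j < 2" "hop_times t ts" for j ts z
    by (intro continuous_on_compose2[OF f[OF that(1)] state_continuous[OF that(2)]]) auto
  have int: "set_integrable lborel {0..t} (\<lambda>s. f (level ts s) (state ts z s))" if "hop_times t ts" for ts z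
    using set_integrable_by_level[of t "\<lambda>j s. f j (state ts z s)"] fc[OF _ that] by blast
  have "(\<lambda>x. integral {0..t} (\<lambda>s. f (level (times n (snd x)) s) (state (times n (snd x)) (fst x) s)))
      \<in> borel_measurable (simplex_space t n)"
    by (rule measurable_time_integral[OF m, unfolded fst_conv snd_conv, OF int[OF hop]])
  then show ?thesis
    by (subst measurable_cong[OF action_formula[OF hop]]) (simp_all only: f_def)
qed

text \<open>Every ingredient is the flow evaluated at a hopping time or at \<open>t\<close>, or one of the time integrals in
\<open>amplitude_formula\<close> and \<open>action_formula\<close>.\<close>

lemma uF_integrand_measurable:
  "(\<lambda>x. uF_integrand V \<epsilon> t Q P S A y (fst (fst x)) (snd (fst x)) (times n (snd x))) \<in> borel_measurable (simplex_space t n)"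
proof -
  have hop: "hop_times t (times n (snd x))" "snd x \<in> time_simplex n t"
    if "x \<in> space (simplex_space t n :: (((real^'m) \<times> (real^'m)) \<times> (nat \<Rightarrow> real)) measure)" for x
    using that by (simp_all add: space_restrict_space time_simplex_def)
  have qj: "(\<lambda>x. V (j mod 2) ((j - 1) mod 2) (Q (times n (snd x)) (fst (fst x)) (snd (fst x)) (snd x j)))
      \<in> borel_measurable (simplex_space t n)" if j: "j \<in> {1..n}" for j
  proof -
    have "odd j \<noteq> odd (j - 1)" using j by (cases j) auto
    then have ne: "j mod 2 \<noteq> (j - 1) mod 2" by (metis even_iff_mod_2_eq_zero)
    have "snd x j \<in> {0..t}" if "x \<in> space (simplex_space t n :: (((real^'m) \<times> (real^'m)) \<times> (nat \<Rightarrow> real)) measure)" for x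
      using time_simplexD[OF hop(2)[OF that] j] by simp
    then have "(\<lambda>x. state (times n (snd x)) (fst x) (snd x j)) \<in> borel_measurable (simplex_space t n)"
      by (rule state_at_measurable[OF measurable_path_space_time[OF j]])
    moreover have "continuous_on UNIV (\<lambda>x. V (j mod 2) ((j - 1) mod 2) (fst x))"
      by (intro continuous_on_compose2[OF V_offdiag_continuous[OF _ _ ne]] continuous_intros) auto
    ultimately have "(\<lambda>x. V (j mod 2) ((j - 1) mod 2) (fst (state (times n (snd x)) (fst x) (snd x j))))
        \<in> borel_measurable (simplex_space t n)"
      by (rule measurable_compose[OF _ borel_measurable_continuous_onI])
    then show ?thesis by (simp only: state_def fst_conv)
  qed
  have prod: "(\<lambda>x. hop_prod V (times n (snd x)) (level (times n (snd x))) (Q (times n (snd x)) (fst (fst x)) (snd (fst x))))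
      \<in> borel_measurable (simplex_space t n)"
    by (subst measurable_cong[OF hop_prod_times[OF level_start[OF hop(1)] level_at_hop[OF hop(2)]]]; assumption?)
      (intro borel_measurable_prod qj)
  have st: "(\<lambda>x. state (times n (snd x)) (fst x) t) \<in> borel_measurable (simplex_space t n)"
    using t_nonneg by (intro state_at_measurable) auto
  have [measurable]: "(\<lambda>x. Q (times n (snd x)) (fst (fst x)) (snd (fst x)) t) \<in> borel_measurable (simplex_space t n)"
    using measurable_compose[OF st borel_measurable_continuous_onI[OF continuous_on_fst[OF continuous_on_id]]]
    by (simp only: state_def fst_conv)
  have [measurable]: "(\<lambda>x. P (times n (snd x)) (fst (fst x)) (snd (fst x)) t) \<in> borel_measurable (simplex_space t n)"
    using measurable_compose[OF st borel_measurable_continuous_onI[OF continuous_on_snd[OF continuous_on_id]]]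
    by (simp only: state_def snd_conv)
  note prod[measurable] amplitude_measurable[measurable] action_measurable[measurable]
  show ?thesis
    unfolding uF_integrand_def phase_def by measurable
qed

end

section \<open>Hopping intensity and path density\<close>

text \<open>The fundamental theorem of calculus for the exponential of the accumulated hazard. It is the computation
behind the exponential survival probabilities.\<close>

lemma nn_integral_exponential_hazard:
  fixes f :: "real \<Rightarrow> real"
  assumes f: "continuous_on {0..b} f" and nonneg: "\<And>s. s \<in> {0..b} \<Longrightarrow> 0 \<le> f s"
    and au: "0 \<le> a" "a \<le> u" "u \<le> b"
  shows "(\<integral>\<^sup>+s. indicator {a<..u} s * ennreal (f s * exp (integral {0..s} f - integral {0..a} f)) \<partial>lborel)
    = ennreal (exp (integral {0..u} f - integral {0..a} f) - 1)"
proof -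
  let ?F = "\<lambda>s. integral {0..s} f"
  have "((\<lambda>s. f s * exp (?F s - ?F a)) has_integral (exp (?F u - ?F a) - exp (?F a - ?F a))) {a..u}"
  proof (rule fundamental_theorem_of_calculus_interior_strong[of "{}"])
    have "continuous_on {0..b} ?F"
      by (intro indefinite_integral_continuous_1 integrable_continuous_interval f)
    then have "continuous_on {a..u} ?F" by (rule continuous_on_subset) (use au in auto)
    then show "continuous_on {a..u} (\<lambda>s. exp (?F s - ?F a))" by (intro continuous_intros)
    fix s assume s: "s \<in> {a<..<u} - {}"
    have "(?F has_real_derivative f s) (at s within {0..b})"
      using s au by (intro integral_has_real_derivative[OF f]) auto
    then have "(?F has_real_derivative f s) (at s)"
      using s au by (simp add: at_within_Icc_at)
    then have "((\<lambda>s. exp (?F s - ?F a)) has_real_derivative f s * exp (?F s - ?F a)) (at s)"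
      by (auto intro!: derivative_eq_intros)
    then show "((\<lambda>s. exp (?F s - ?F a)) has_vector_derivative f s * exp (?F s - ?F a)) (at s)"
      by (simp add: has_real_derivative_iff_has_vector_derivative)
  qed (use au in auto)
  note I = this
  have "(\<integral>\<^sup>+s. indicator {a..u} s * ennreal (f s * exp (?F s - ?F a)) \<partial>lborel)
      = (\<integral>\<^sup>+s. ennreal (indicator {a..u} s * (f s * exp (?F s - ?F a))) \<partial>lborel)"
    by (intro nn_integral_cong) (simp add: indicator_def)
  also have "\<dots> = ennreal (exp (?F u - ?F a) - exp (?F a - ?F a))"
    by (rule nn_integral_has_integral_lebesgue[OF _ I]) (use nonneg au in auto)
  finally have "(\<integral>\<^sup>+s. indicator {a..u} s * ennreal (f s * exp (?F s - ?F a)) \<partial>lborel) = ennreal (exp (?F u - ?F a) - 1)"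
    by simp
  moreover have "(\<integral>\<^sup>+s. indicator {a<..u} s * ennreal (f s * exp (?F s - ?F a)) \<partial>lborel)
      = (\<integral>\<^sup>+s. indicator {a..u} s * ennreal (f s * exp (?F s - ?F a)) \<partial>lborel)"
    by (rule nn_integral_cong_AE) (use AE_lborel_singleton[of a] in eventually_elim, auto simp: indicator_def)
  ultimately show ?thesis by simp
qed

lemma times_update: "times (Suc n) (\<tau>(Suc n := u)) = times n \<tau> @ [u]"
proof -
  have "map (\<tau>(Suc n := u)) [1..<Suc n] = map \<tau> [1..<Suc n]" by (intro map_cong) auto
  moreover have "[1..<Suc (Suc n)] = [1..<Suc n] @ [Suc n]" by (rule upt_Suc_append) simp
  ultimately show ?thesis by (simp del: upt_Suc)
qed

context hopping_model
begin

definition intensity :: "nat \<Rightarrow> ((real^'m) \<times> (real^'m)) \<times> (nat \<Rightarrow> real) \<Rightarrow> real \<Rightarrow> real" where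
  "intensity n x s = (if (x, s) \<in> hop_region t n
     then \<delta> / \<epsilon> * cmod (V 0 1 (fst (state (times n (snd x)) (fst x) s))) else 0)"

lemma intensity_nonneg: "0 \<le> intensity n x s"
  using eps_pos delta_pos by (simp add: intensity_def)

lemma intensity_measurable: "(\<lambda>p. intensity n (fst p) (snd p)) \<in> borel_measurable (path_space n \<Otimes>\<^sub>M borel)"
proof -
  have "continuous_on UNIV (\<lambda>x. \<delta> / \<epsilon> * cmod (V 0 1 (fst x)))"
    by (intro continuous_intros continuous_on_compose2[OF V01]) auto
  from measurable_compose[OF measurable_state borel_measurable_continuous_onI[OF this], of n]
  have "(\<lambda>p. if p \<in> hop_region t n
      then \<delta> / \<epsilon> * cmod (V 0 1 (fst (state (times n (snd (fst p))) (fst (fst p)) (snd p)))) else 0)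
      \<in> borel_measurable (path_space n \<Otimes>\<^sub>M borel)"
    using sets_hop_region[of n t] by (subst measurable_If_restrict_space_iff) auto
  then show ?thesis by (simp only: intensity_def prod.collapse)
qed

lemma intensity_measurable' [measurable (raw)]:
  assumes "f \<in> N \<rightarrow>\<^sub>M path_space n" "g \<in> borel_measurable N"
  shows "(\<lambda>y. intensity n (f y) (g y)) \<in> borel_measurable N"
  using measurable_compose[OF measurable_Pair[OF assms] intensity_measurable] by simp

lemma intensity_continuous: "continuous_on {0..t} (intensity n x)"
proof (cases "snd x \<in> time_simplex n t")
  case True
  then have "hop_times t (times n (snd x))" by (simp add: time_simplex_def)
  then have "continuous_on {0..t} (\<lambda>s. \<delta> / \<epsilon> * cmod (V 0 1 (fst (state (times n (snd x)) (fst x) s))))"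
    by (intro continuous_intros continuous_on_compose2[OF V01] state_continuous) auto
  then show ?thesis
    using True by (subst continuous_on_cong[OF refl, of _ _ "\<lambda>s. \<delta> / \<epsilon> * cmod (V 0 1 (fst (state (times n (snd x)) (fst x) s)))"])
      (auto simp: intensity_def hop_region_def)
next
  case False
  then have "intensity n x = (\<lambda>_. 0)" by (auto simp: intensity_def hop_region_def)
  then show ?thesis by simp
qed

definition cumulated :: "nat \<Rightarrow> ((real^'m) \<times> (real^'m)) \<times> (nat \<Rightarrow> real) \<Rightarrow> real \<Rightarrow> real" where
  "cumulated n x s = (LINT r:{0..s}|lborel. intensity n x r)"

lemma cumulated_eq: "s \<in> {0..t} \<Longrightarrow> cumulated n x s = integral {0..s} (intensity n x)"
  unfolding cumulated_def
  by (intro set_borel_integral_eq_integral(2) borel_integrable_atLeastAtMost' continuous_on_subset[OF intensity_continuous]) auto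

lemma cumulated_measurable: "(\<lambda>p. cumulated n (fst p) (snd p)) \<in> borel_measurable (path_space n \<Otimes>\<^sub>M borel)"
proof -
  have "(\<lambda>(p, r). (if 0 \<le> r \<and> r \<le> snd p then 1 else 0) *\<^sub>R intensity n (fst p) r)
      \<in> borel_measurable ((path_space n \<Otimes>\<^sub>M borel) \<Otimes>\<^sub>M lborel)"
    by measurable
  then have "(\<lambda>p. LINT r|lborel. (if 0 \<le> r \<and> r \<le> snd p then 1 else 0) *\<^sub>R intensity n (fst p) r)
      \<in> borel_measurable (path_space n \<Otimes>\<^sub>M borel)"
    by (rule lborel.borel_measurable_lebesgue_integral)
  then show ?thesis
    unfolding cumulated_def set_lebesgue_integral_def indicator_def of_bool_def atLeastAtMost_iff .
qed

lemma cumulated_measurable' [measurable (raw)]: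
  assumes "f \<in> N \<rightarrow>\<^sub>M path_space n" "g \<in> borel_measurable N"
  shows "(\<lambda>y. cumulated n (f y) (g y)) \<in> borel_measurable N"
  using measurable_compose[OF measurable_Pair[OF assms] cumulated_measurable] by simp

lemma last_time_measurable [measurable]: "(\<lambda>x. last_time n (snd x)) \<in> borel_measurable (path_space n)"
  unfolding last_time_def using measurable_path_space_time[of n n] by (cases "n = 0") auto

lemma cumulated_hazard:
  assumes "0 \<le> a" "a \<le> u" "u \<le> t"
  shows "(\<integral>\<^sup>+s. indicator {a<..u} s * ennreal (intensity n x s * exp (cumulated n x s - cumulated n x a)) \<partial>lborel)
    = ennreal (exp (cumulated n x u - cumulated n x a) - 1)"
proof -
  have "(\<integral>\<^sup>+s. indicator {a<..u} s * ennreal (intensity n x s * exp (cumulated n x s - cumulated n x a)) \<partial>lborel)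
    = (\<integral>\<^sup>+s. indicator {a<..u} s * ennreal (intensity n x s *
        exp (integral {0..s} (intensity n x) - integral {0..a} (intensity n x))) \<partial>lborel)"
    using assms by (intro nn_integral_cong) (auto simp: cumulated_eq indicator_def)
  also have "\<dots> = ennreal (exp (integral {0..u} (intensity n x) - integral {0..a} (intensity n x)) - 1)"
    using assms by (intro nn_integral_exponential_hazard[OF intensity_continuous intensity_nonneg])
  finally show ?thesis using assms by (simp add: cumulated_eq)
qed

lemma cumulated_mono: "a \<le> b \<Longrightarrow> b \<le> t \<Longrightarrow> 0 \<le> a \<Longrightarrow> cumulated n x a \<le> cumulated n x b"
  by (simp add: cumulated_eq)
    (intro integral_subset_le integrable_continuous_interval continuous_on_subset[OF intensity_continuous];
      auto intro: intensity_nonneg)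

lemma intensity_extend:
  assumes "snd x \<in> time_simplex n t" "last_time n (snd x) < u" "u < t" "r \<le> u"
  shows "intensity (Suc n) (fst x, (snd x)(Suc n := u)) r = intensity n x r"
proof -
  let ?\<tau> = "(snd x)(Suc n := u)"
  have s: "?\<tau> \<in> time_simplex (Suc n) t"
    using assms t_nonneg time_simplex_cong[of n "snd x" ?\<tau> t]
    by (simp add: time_simplex_Suc last_time_def split: if_splits)
  have eq: "times (Suc n) ?\<tau> = times n (snd x) @ [u]"
    by (rule times_update)
  have "hop_times t (times n (snd x) @ [u])"
    using s unfolding time_simplex_def eq by simp
  then have "state (times (Suc n) ?\<tau>) (fst x) r = state (times n (snd x)) (fst x) r" if "0 \<le> r"
    unfolding eq using assms that by (intro state_append) auto
  then show ?thesis
    using s assms(1) by (simp add: intensity_def hop_region_def del: upt_Suc)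
qed

lemma cumulated_extend:
  assumes "snd x \<in> time_simplex n t" "last_time n (snd x) < u" "u < t" "r \<le> u"
  shows "cumulated (Suc n) (fst x, (snd x)(Suc n := u)) r = cumulated n x r"
  unfolding cumulated_def using assms
  by (intro set_lebesgue_integral_cong) (auto intro: intensity_extend)

definition initial_density :: "(real^'m) \<times> (real^'m) \<Rightarrow> real" where
  "initial_density z = cmod (init_amp \<epsilon> u0 (fst z) (snd z)) / (LINT z|lborel. cmod (init_amp \<epsilon> u0 (fst z) (snd z)))"

lemma initial_density_nonneg: "0 \<le> initial_density z"
  by (simp add: initial_density_def)

lemma initial_density_measurable [measurable]: "initial_density \<in> borel_measurable borel"
  using measurable_init_amp[OF u0_measurable, of \<epsilon>] unfolding initial_density_def by measurable

text \<open>The joint density of the initial point and the first \<open>n\<close> jump times, whatever happens after the last of them; the exponential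
is the probability of no other jump up to that time.\<close>

definition hop_density :: "nat \<Rightarrow> ((real^'m) \<times> (real^'m)) \<times> (nat \<Rightarrow> real) \<Rightarrow> real" where
  "hop_density n x = (if snd x \<in> time_simplex n t
     then initial_density (fst x) * (\<Prod>j=1..n. intensity n x (snd x j)) * exp (- cumulated n x (last_time n (snd x)))
     else 0)"

lemma hop_density_nonneg: "0 \<le> hop_density n x"
  by (auto simp: hop_density_def intro!: mult_nonneg_nonneg prod_nonneg initial_density_nonneg intensity_nonneg)

lemma hop_density_measurable [measurable]: "hop_density n \<in> borel_measurable (path_space n)"
proof -
  have [measurable]: "(\<lambda>x. snd x j) \<in> borel_measurable (path_space n)" if "j \<in> {1..n}" for j
    by (rule measurable_path_space_time[OF that])
  have "(\<lambda>x. initial_density (fst x) * (\<Prod>j=1..n. intensity n x (snd x j)) * exp (- cumulated n x (last_time n (snd x))))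
      \<in> borel_measurable (path_space n)"
    by measurable
  then show ?thesis
    unfolding hop_density_def[abs_def] using sets_simplex by measurable
qed

lemma simplex_times_le_last:
  assumes "\<tau> \<in> time_simplex n t" "j \<in> {1..n}"
  shows "\<tau> j \<le> last_time n \<tau>"
  using assms by (cases "j = n") (auto simp: time_simplex_iff last_time_def intro!: less_imp_le)

lemma last_time_bounds:
  assumes "\<tau> \<in> time_simplex n t"
  shows "0 \<le> last_time n \<tau>" "last_time n \<tau> \<le> t"
  using time_simplexD[OF assms, of n] t_nonneg by (auto simp: last_time_def)

text \<open>The recursion that drives the induction on the number of jumps: one more jump contributes the
intensity at its time and the survival probability since the previous one.\<close>

lemma hop_density_extend:
  "hop_density (Suc n) (fst x, (snd x)(Suc n := u)) =
    (if last_time n (snd x) < u \<and> u < t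
     then hop_density n x * intensity n x u * exp (- (cumulated n x u - cumulated n x (last_time n (snd x)))) else 0)"
proof -
  let ?\<tau> = "(snd x)(Suc n := u)"
  have simp: "?\<tau> \<in> time_simplex (Suc n) t \<longleftrightarrow> snd x \<in> time_simplex n t \<and> last_time n (snd x) < u \<and> u < t"
    using time_simplex_cong[of n "snd x" ?\<tau> t] t_nonneg by (simp add: time_simplex_Suc last_time_def)
  show ?thesis
  proof (cases "?\<tau> \<in> time_simplex (Suc n) t")
    case True
    then have x: "snd x \<in> time_simplex n t" "last_time n (snd x) < u" "u < t" using simp by auto
    have "(\<Prod>j=1..Suc n. intensity (Suc n) (fst x, ?\<tau>) (?\<tau> j))
        = (\<Prod>j=1..n. intensity (Suc n) (fst x, ?\<tau>) (?\<tau> j)) * intensity n x u"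
      by (simp add: intensity_extend[OF x] atLeastAtMostSuc_conv mult.commute)
    also have "(\<Prod>j=1..n. intensity (Suc n) (fst x, ?\<tau>) (?\<tau> j)) = (\<Prod>j=1..n. intensity n x (snd x j))"
    proof (rule prod.cong)
      fix j assume j: "j \<in> {1..n}"
      then show "intensity (Suc n) (fst x, ?\<tau>) (?\<tau> j) = intensity n x (snd x j)"
        using simplex_times_le_last[OF x(1) j] x by (simp add: intensity_extend)
    qed simp
    finally have "(\<Prod>j=1..Suc n. intensity (Suc n) (fst x, ?\<tau>) (?\<tau> j))
      = (\<Prod>j=1..n. intensity n x (snd x j)) * intensity n x u" .
    moreover have "cumulated (Suc n) (fst x, ?\<tau>) (last_time (Suc n) ?\<tau>) = cumulated n x u"
      using cumulated_extend[OF x order_refl] by (simp add: last_time_def)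
    ultimately show ?thesis
      using True x by (simp add: hop_density_def mult_ac flip: exp_add)
  next
    case False
    then show ?thesis using simp by (auto simp: hop_density_def)
  qed
qed

text \<open>The random variable of the trajectory average, rewritten as a function of the initial point and the jump
times. The moduli of the couplings appear as intensities, which accounts for the power of \<open>\<delta> / \<epsilon>\<close>.\<close>

definition path_weight :: "real^'m \<Rightarrow> nat \<Rightarrow> ((real^'m) \<times> (real^'m)) \<times> (nat \<Rightarrow> real) \<Rightarrow> complex" where
  "path_weight y n x = (if snd x \<in> time_simplex n t
     then (- \<i> * \<delta> / \<epsilon>) ^ n * uF_integrand V \<epsilon> t Q P S A y (fst (fst x)) (snd (fst x)) (times n (snd x))
       / complex_of_real ((\<Prod>j=1..n. intensity n x (snd x j)) * cmod (init_amp \<epsilon> u0 (fst (fst x)) (snd (fst x))))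
       * complex_of_real (exp (cumulated n x t))
     else 0)"

lemma path_weight_measurable: "path_weight y n \<in> borel_measurable (path_space n)"
proof -
  have [measurable]: "(\<lambda>x. snd x j) \<in> borel_measurable (path_space n)" if "j \<in> {1..n}" for j
    by (rule measurable_path_space_time[OF that])
  have [measurable]: "(\<lambda>x. init_amp \<epsilon> u0 (fst (fst x)) (snd (fst x))) \<in> borel_measurable (path_space n)"
    by (rule measurable_compose[OF measurable_path_space_fst measurable_init_amp[OF u0_measurable]])
  have "(\<lambda>x. complex_of_real ((\<Prod>j=1..n. intensity n x (snd x j)) * cmod (init_amp \<epsilon> u0 (fst (fst x)) (snd (fst x)))))
      \<in> borel_measurable (path_space n)"
    "(\<lambda>x. complex_of_real (exp (cumulated n x t))) \<in> borel_measurable (path_space n)"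
    by measurable
  note m = this[THEN measurable_restrict_space1]
  have "(\<lambda>x. (- \<i> * \<delta> / \<epsilon>) ^ n * uF_integrand V \<epsilon> t Q P S A y (fst (fst x)) (snd (fst x)) (times n (snd x))
       / complex_of_real ((\<Prod>j=1..n. intensity n x (snd x j)) * cmod (init_amp \<epsilon> u0 (fst (fst x)) (snd (fst x))))
       * complex_of_real (exp (cumulated n x t))) \<in> borel_measurable (simplex_space t n)"
    by (intro borel_measurable_times borel_measurable_divide borel_measurable_const uF_integrand_measurable m)
  then show ?thesis
    unfolding path_weight_def[abs_def] using sets_simplex[of n t]
    by (subst measurable_If_restrict_space_iff) auto
qed

text \<open>Division by zero is harmless here. If the coupling vanishes at a hop, then so does the factor of the
integrand that belongs to this hop; if the initial amplitude vanishes, then so does the amplitude at time \<open>t\<close> by \<open>amplitude_formula\<close>.\<close>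

lemma density_times_weight:
  assumes x: "snd x \<in> time_simplex n t"
  shows "complex_of_real (initial_density (fst x) * (\<Prod>j=1..n. intensity n x (snd x j)) * exp (- cumulated n x t))
      * path_weight y n x
    = (- \<i> * \<delta> / \<epsilon>) ^ n / complex_of_real (LINT z|lborel. cmod (init_amp \<epsilon> u0 (fst z) (snd z)))
      * uF_integrand V \<epsilon> t Q P S A y (fst (fst x)) (snd (fst x)) (times n (snd x))"
proof -
  let ?a = "cmod (init_amp \<epsilon> u0 (fst (fst x)) (snd (fst x)))" and ?w = "\<Prod>j=1..n. intensity n x (snd x j)"
  let ?u = "uF_integrand V \<epsilon> t Q P S A y (fst (fst x)) (snd (fst x)) (times n (snd x))"
  have hop: "hop_times t (times n (snd x))" using x by (simp add: time_simplex_def)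
  have u0: "?u = 0" if "?a = 0"
    using that amplitude_formula[OF hop, of "fst x"] by (simp add: uF_integrand_def)
  have uw: "?u = 0" if w: "?w = 0"
  proof -
    obtain j where j: "j \<in> {1..n}" "intensity n x (snd x j) = 0" using w by (auto simp: prod_zero_iff)
    have "odd j \<noteq> odd (j - 1)" using j by (cases j) auto
    then have ne: "j mod 2 \<noteq> (j - 1) mod 2" by (metis even_iff_mod_2_eq_zero)
    have "cmod (V 0 1 (Q (times n (snd x)) (fst (fst x)) (snd (fst x)) (snd x j))) = 0"
      using j x time_simplexD[OF x j(1)] eps_pos delta_pos
      by (auto simp: intensity_def hop_region_def state_def split: if_splits simp del: upt_Suc)
    then have "V (j mod 2) ((j - 1) mod 2) (Q (times n (snd x)) (fst (fst x)) (snd (fst x)) (snd x j)) = 0"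
      using V_offdiag_norm[OF _ _ ne] by (metis mod_less_divisor norm_eq_zero pos2)
    then have "hop_prod V (times n (snd x)) (level (times n (snd x))) (Q (times n (snd x)) (fst (fst x)) (snd (fst x))) = 0"
      using j(1) by (subst hop_prod_times[OF level_start[OF hop] level_at_hop[OF x]]) (auto intro!: prod_zero)
    then show ?thesis by (simp add: uF_integrand_def del: upt_Suc)
  qed
  show ?thesis
  proof (cases "?a = 0 \<or> ?w = 0")
    case True
    then show ?thesis using u0 uw x by (auto simp: path_weight_def)
  next
    case False
    let ?N = "LINT z|lborel. cmod (init_amp \<epsilon> u0 (fst z) (snd z))"
    have ex: "complex_of_real (exp (- cumulated n x t)) * complex_of_real (exp (cumulated n x t)) = 1"
      by (simp flip: of_real_mult exp_add)
    have "complex_of_real (?a / N * w * e) * (c * u / complex_of_real (w * ?a) * e') = c / complex_of_real N * u"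
      if "w \<noteq> 0" "complex_of_real e * e' = 1" for w N e :: real and c u e' :: complex
    proof -
      have "complex_of_real (?a / N * w * e) * (c * u / complex_of_real (w * ?a) * e')
        = (c / complex_of_real N * u) * (complex_of_real e * e')"
        using that False by (simp add: field_simps)
      then show ?thesis using that by simp
    qed
    from this[OF _ ex, of ?w ?N] False show ?thesis
      unfolding path_weight_def if_P[OF x] initial_density_def by blast
  qed
qed

end

section \<open>Jump times of a two-level path\<close>

text \<open>Jump times have to be measurable with respect to the past of the process, and so may depend on
countably many times only. For a right-continuous path the rational times suffice, together with
the end time \<open>s\<close>, where a jump would otherwise go unnoticed.\<close>

definition grid :: "real \<Rightarrow> real set" where
  "grid s = insert s (\<rat> \<inter> {0..s})"

text \<open>The path has jumped at least \<open>i\<close> times up to time \<open>s\<close>: this can be seen from successive level changes along the grid.\<close>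

primrec reach :: "(real \<Rightarrow> nat) \<Rightarrow> nat \<Rightarrow> real \<Rightarrow> bool" where
  "reach L 0 s \<longleftrightarrow> True"
| "reach L (Suc i) s \<longleftrightarrow> (\<exists>r\<in>grid s. \<exists>r'\<in>\<rat> \<inter> {0..<r}. reach L i r' \<and> L r' \<noteq> L r)"

text \<open>The \<open>i\<close>-th jump time as far as it is known at time \<open>s\<close>; the value \<open>t + 1\<close> says that the jump has not occurred yet.\<close>

definition jump_time :: "real \<Rightarrow> (real \<Rightarrow> nat) \<Rightarrow> real \<Rightarrow> nat \<Rightarrow> real" where
  "jump_time t L s i = (INF r\<in>grid s. if reach L i r then r else t + 1)"

lemma grid_bounds: "0 \<le> s \<Longrightarrow> r \<in> grid s \<Longrightarrow> r \<in> {0..s}"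
  by (auto simp: grid_def)

locale level_path =
  fixes t :: real and L :: "real \<Rightarrow> nat"
  assumes t0: "0 \<le> t" and two_levels: "\<And>s. s \<in> {0..t} \<Longrightarrow> L s \<in> {0, 1}" and start: "L 0 = 0"
    and right_cont: "\<And>s. s \<in> {0..<t} \<Longrightarrow> \<forall>\<^sub>F r in at_right s. L r = L s"
    and finite_jumps: "finite (jump_set t L)"
begin

abbreviation jumps :: "real list" where
  "jumps \<equiv> sorted_list_of_set (jump_set t L)"

definition count :: "real \<Rightarrow> nat" where
  "count s = card {r \<in> jump_set t L. r \<le> s}"

definition tau :: "nat \<Rightarrow> real" where
  "tau i = jump_time t L t i"

lemma constant_between:
  assumes ab: "0 \<le> a" "a \<le> b" "b \<le> t" and no: "\<And>r. a < r \<Longrightarrow> r \<le> b \<Longrightarrow> r \<notin> jump_set t L"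
  shows "L b = L a"
proof -
  have "L constant_on {a..b}"
  proof (rule locally_constant_imp_constant)
    fix s assume s: "s \<in> {a..b}"
    have "\<forall>\<^sub>F r in at s within {a..b}. L r = L s"
    proof -
      have "\<forall>\<^sub>F r in at s within {s<..b}. L r = L s"
      proof (cases "s < b")
        case True
        then have "\<forall>\<^sub>F r in at_right s. L r = L s" using s ab by (intro right_cont) auto
        then show ?thesis by (rule filter_leD[rotated]) (intro at_le, auto)
      qed simp
      moreover have "\<forall>\<^sub>F r in at s within {a..<s}. L r = L s"
      proof (cases "a < s")
        case True
        then have "\<forall>\<^sub>F r in at_left s. L r = L s" using s ab no[of s] by (auto simp: jump_set_def)
        then show ?thesis by (rule filter_leD[rotated]) (intro at_le, auto)
      qed simp
      ultimately have "\<forall>\<^sub>F r in at s within ({a..<s} \<union> {s<..b}). L r = L s"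
        by (simp add: at_within_union eventually_sup)
      moreover have "{a..b} - {s} = ({a..<s} \<union> {s<..b}) - {s}" using s by auto
      then have "at s within {a..b} = at s within ({a..<s} \<union> {s<..b})" by (simp only: at_within_def)
      ultimately show ?thesis by (simp only:)
    qed
    then obtain U where U: "open U" "s \<in> U" "\<forall>r\<in>U. r \<noteq> s \<longrightarrow> r \<in> {a..b} \<longrightarrow> L r = L s"
      unfolding eventually_at_topological by blast
    show "\<exists>T. openin (top_of_set {a..b}) T \<and> s \<in> T \<and> (\<forall>x\<in>T. L x = L s)"
      using U s by (intro exI[of _ "{a..b} \<inter> U"]) (auto simp: openin_open)
  qed auto
  then show ?thesis using ab by (auto simp: constant_on_def)
qed

lemma flip_at_jump:
  assumes s: "s \<in> jump_set t L" and a: "0 \<le> a" "a < s" and no: "\<And>r. a < r \<Longrightarrow> r < s \<Longrightarrow> r \<notin> jump_set t L"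
  shows "L s \<noteq> L a"
proof
  assume eq: "L s = L a"
  have "\<forall>\<^sub>F r in at_left s. r \<in> {a<..<s}"
    using eventually_at_left_real[OF a(2)] .
  then have "\<forall>\<^sub>F r in at_left s. L r = L s"
  proof eventually_elim
    case (elim r)
    then show ?case
      using constant_between[of a r] no a s eq by (auto simp: jump_set_def)
  qed
  then show False using s by (simp add: jump_set_def)
qed

lemma count_mono: "r \<le> s \<Longrightarrow> count r \<le> count s"
  unfolding count_def by (intro card_mono) (auto simp: finite_jumps)

lemma jump_between:
  assumes "0 \<le> a" "a < b" "b \<le> t" "L a \<noteq> L b"
  shows "count a < count b"
proof -
  obtain r where r: "a < r" "r \<le> b" "r \<in> jump_set t L" using constant_between[of a b] assms by force
  then have "{r \<in> jump_set t L. r \<le> a} \<subset> {r \<in> jump_set t L. r \<le> b}" using assms by force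
  then show ?thesis unfolding count_def by (intro psubset_card_mono) (auto simp: finite_jumps)
qed

lemma sorted_jumps: "sorted_wrt (<) jumps" "set jumps = jump_set t L"
  using finite_jumps by (auto simp: strict_sorted_list_of_set)

lemma count_ge_iff:
  "i < length jumps \<Longrightarrow> Suc i \<le> count s \<longleftrightarrow> jumps ! i \<le> s"
  "count s \<le> length jumps"
proof -
  have "count s = length (filter (\<lambda>r. r \<le> s) jumps)"
  proof -
    have "count s = card (set (filter (\<lambda>r. r \<le> s) jumps))"
      by (simp add: count_def sorted_jumps(2) Collect_conj_eq)
    also have "\<dots> = length (filter (\<lambda>r. r \<le> s) jumps)"
      by (intro distinct_card distinct_filter) (simp add: distinct_sorted_list_of_set)
    finally show ?thesis .
  qed
  also have "\<dots> = card {i. i < length jumps \<and> jumps ! i \<le> s}" by (rule length_filter_conv_card)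
  finally have c: "count s = card {i. i < length jumps \<and> jumps ! i \<le> s}" .
  have mono: "jumps ! i < jumps ! j" if "i < j" "j < length jumps" for i j
    using sorted_wrt_nth_less[OF sorted_jumps(1) that] .
  have mono_le: "jumps ! i \<le> jumps ! j" if "i \<le> j" "j < length jumps" for i j
    using mono[of i j] that by (cases "i = j") auto
  show "count s \<le> length jumps"
    unfolding c using card_mono[of "{..<length jumps}" "{i. i < length jumps \<and> jumps ! i \<le> s}"] by auto
  assume i: "i < length jumps"
  show "Suc i \<le> count s \<longleftrightarrow> jumps ! i \<le> s"
  proof
    assume "jumps ! i \<le> s"
    then have "{..i} \<subseteq> {i. i < length jumps \<and> jumps ! i \<le> s}"
      using i mono_le[of _ i] by (auto intro: order_trans)
    then have "card {..i} \<le> count s" unfolding c by (intro card_mono) auto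
    then show "Suc i \<le> count s" by simp
  next
    assume le: "Suc i \<le> count s"
    show "jumps ! i \<le> s"
    proof (rule ccontr)
      assume not_le: "\<not> jumps ! i \<le> s"
      have "{i. i < length jumps \<and> jumps ! i \<le> s} \<subseteq> {..<i}"
      proof
        fix j assume "j \<in> {i. i < length jumps \<and> jumps ! i \<le> s}"
        then have j: "j < length jumps" "jumps ! j \<le> s" by blast+
        have "\<not> i \<le> j"
        proof
          assume "i \<le> j"
          from mono_le[OF this j(1)] j(2) not_le show False by linarith
        qed
        then show "j \<in> {..<i}" by simp
      qed
      then have "card {i. i < length jumps \<and> jumps ! i \<le> s} \<le> card {..<i}"
        by (rule card_mono[rotated]) simp
      then show False using le c by simp
    qed
  qed
qed

lemma jump_nth_bounds: "i < length jumps \<Longrightarrow> 0 < jumps ! i \<and> jumps ! i \<le> t"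
  using nth_mem[of i jumps] unfolding sorted_jumps(2) by (auto simp: jump_set_def)

lemma previous_jump:
  assumes "i < length jumps"
  shows "(if i = 0 then 0 else jumps ! (i - 1)) < jumps ! i" "0 \<le> (if i = 0 then 0 else jumps ! (i - 1))"
proof -
  have "(if i = 0 then 0 else jumps ! (i - 1)) < jumps ! i \<and> 0 \<le> (if i = 0 then 0 else jumps ! (i - 1))"
  proof (cases i)
    case 0
    then show ?thesis using jump_nth_bounds[OF assms] by simp
  next
    case (Suc j)
    then have "j < length jumps" using assms by simp
    from jump_nth_bounds[OF this] sorted_wrt_nth_less[OF sorted_jumps(1), of j i] assms Suc
    show ?thesis by (simp add: less_imp_le)
  qed
  then show "(if i = 0 then 0 else jumps ! (i - 1)) < jumps ! i" "0 \<le> (if i = 0 then 0 else jumps ! (i - 1))"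
    by blast+
qed

lemma no_jump_between_consecutive:
  assumes i: "i < length jumps" and r: "(if i = 0 then 0 else jumps ! (i - 1)) < r" "r < jumps ! i"
  shows "r \<notin> jump_set t L"
proof
  assume "r \<in> jump_set t L"
  then have "r \<in> set jumps" by (simp only: sorted_jumps(2))
  then obtain k where k: "k < length jumps" "r = jumps ! k" by (metis in_set_conv_nth)
  have mono: "jumps ! i \<le> jumps ! j" if "i \<le> j" "j < length jumps" for i j
    using sorted_wrt_nth_less[OF sorted_jumps(1), of i j] that by (cases "i = j") auto
  show False
  proof (cases "k < i")
    case True
    then have "jumps ! k \<le> jumps ! (i - 1)" using i by (intro mono) auto
    then show False using r k True by auto
  next
    case False
    then show False using mono[of i k] k r by auto
  qed
qed

lemma reach_iff:
  "s \<in> {0..t} \<Longrightarrow> reach L i s \<longleftrightarrow> i \<le> count s"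
proof (induction i arbitrary: s)
  case (Suc i)
  show ?case
  proof
    assume "reach L (Suc i) s"
    then obtain r r' where r: "r \<in> grid s" "r' \<in> \<rat>" "0 \<le> r'" "r' < r" "reach L i r'" "L r' \<noteq> L r" by auto
    have rs: "r \<in> {0..s}" using grid_bounds[OF _ r(1)] Suc.prems by auto
    have "i \<le> count r'" using Suc.IH[of r'] r rs Suc.prems by auto
    also have "\<dots> < count r" using r rs Suc.prems by (intro jump_between) auto
    also have "\<dots> \<le> count s" using rs by (intro count_mono) auto
    finally show "Suc i \<le> count s" by simp
  next
    assume le: "Suc i \<le> count s"
    then have i: "i < length jumps" using count_ge_iff(2)[of s] by simp
    let ?u = "jumps ! i" and ?p = "if i = 0 then 0 else jumps ! (i - 1)"
    have us: "?u \<le> s" using count_ge_iff(1)[OF i, of s] le by simp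
    have uJ: "?u \<in> jump_set t L" using i nth_mem[OF i] sorted_jumps(2) by simp
    have pu: "?p < ?u" "0 \<le> ?p"
      by (rule previous_jump[OF i])+
    obtain r' where r': "r' \<in> \<rat>" "?p < r'" "r' < ?u" using Rats_dense_in_real[OF pu(1)] by blast
    have "i \<le> count r'"
    proof (cases i)
      case (Suc j)
      then show ?thesis using count_ge_iff(1)[of j r'] i r' by auto
    qed simp
    then have reach': "reach L i r'" using Suc.IH[of r'] r' pu us Suc.prems by auto
    have ne: "L ?u \<noteq> L r'"
      by (rule flip_at_jump[OF uJ]) (use r' pu no_jump_between_consecutive[OF i] in auto)
    obtain r where r: "r \<in> grid s" "?u \<le> r" "L r = L ?u"
    proof (cases "?u = s")
      case True
      then show ?thesis using that[of s] by (auto simp: grid_def)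
    next
      case False
      then have lt: "?u < s" using us by simp
      have "\<forall>\<^sub>F r in at_right ?u. L r = L ?u"
        using jump_nth_bounds[OF i] lt Suc.prems by (intro right_cont) auto
      then obtain b where b: "b > ?u" "\<And>r. ?u < r \<Longrightarrow> r < b \<Longrightarrow> L r = L ?u"
        unfolding eventually_at_right_field by blast
      obtain r where "r \<in> \<rat>" "?u < r" "r < min b s" using Rats_dense_in_real[of ?u "min b s"] b lt by auto
      then show ?thesis using that[of r] b jump_nth_bounds[OF i] by (auto simp: grid_def)
    qed
    show "reach L (Suc i) s"
      unfolding reach.simps
      by (rule bexI[OF _ r(1)], rule bexI[of _ r']) (use reach' r ne r' pu in auto)
  qed
qed simp

lemma jump_time_eq:
  assumes s: "s \<in> {0..t}" and i: "0 < i"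
  shows "jump_time t L s i = (if i \<le> count s then jumps ! (i - 1) else t + 1)"
proof -
  let ?f = "\<lambda>r. if reach L i r then r else t + 1"
  have bdd: "bdd_below (?f ` grid s)"
    using s by (intro bdd_belowI[of _ 0]) (auto dest: grid_bounds[rotated])
  have ne: "grid s \<noteq> {}" by (simp add: grid_def)
  have sub: "r \<in> {0..t}" if "r \<in> grid s" for r using grid_bounds[OF _ that] s by auto
  show ?thesis
  proof (cases "i \<le> count s")
    case False
    have "?f r = t + 1" if "r \<in> grid s" for r
      using False count_mono[of r s] grid_bounds[OF _ that] s reach_iff[OF sub[OF that]] by auto
    then have "?f ` grid s = {t + 1}" using ne by auto
    then show ?thesis using False by (simp add: jump_time_def)
  next
    case True
    then have il: "i - 1 < length jumps" using count_ge_iff(2)[of s] i by auto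
    let ?u = "jumps ! (i - 1)"
    have re: "reach L i r \<longleftrightarrow> ?u \<le> r" if "r \<in> grid s" for r
      using reach_iff[OF sub[OF that]] count_ge_iff(1)[OF il] i by auto
    have us: "?u \<le> s" using count_ge_iff(1)[OF il, of s] True i by auto
    have u: "0 < ?u" "?u \<le> t" using jump_nth_bounds[OF il] by auto
    have "(INF r\<in>grid s. ?f r) = ?u"
    proof (rule antisym)
      show "?u \<le> (INF r\<in>grid s. ?f r)" using ne re u by (intro cINF_greatest) auto
      show "(INF r\<in>grid s. ?f r) \<le> ?u"
      proof (cases "?u = s")
        case True
        have "(INF r\<in>grid s. ?f r) \<le> ?f s" by (intro cINF_lower bdd) (simp add: grid_def)
        then show ?thesis using re[of s] True by (simp add: grid_def)
      next
        case False
        show ?thesis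
        proof (rule field_le_epsilon)
          fix e :: real assume "0 < e"
          then obtain r where r: "r \<in> \<rat>" "?u < r" "r < min (?u + e) s"
            using Rats_dense_in_real[of ?u "min (?u + e) s"] us False by auto
          then have "r \<in> grid s" using u by (auto simp: grid_def)
          from cINF_lower[OF bdd this] re[OF this] r show "(INF r\<in>grid s. ?f r) \<le> ?u + e" by auto
        qed
      qed
    qed
    then show ?thesis using True by (simp add: jump_time_def)
  qed
qed

lemma tau_le_iff:
  assumes "s \<in> {0..t}" "0 < i"
  shows "tau i \<le> s \<longleftrightarrow> i \<le> count s"
proof -
  have "tau i = (if i \<le> count t then jumps ! (i - 1) else t + 1)"
    unfolding tau_def using t0 assms by (intro jump_time_eq) auto
  moreover have "count s \<le> count t" using assms by (intro count_mono) auto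
  moreover have "i - 1 < length jumps" if "i \<le> count t" using that count_ge_iff(2)[of t] assms by auto
  ultimately show ?thesis using count_ge_iff(1)[of "i - 1" s] assms by auto
qed

lemma tau_cases: "0 < i \<Longrightarrow> (i \<le> count t \<and> 0 < tau i \<and> tau i \<le> t) \<or> (count t < i \<and> tau i = t + 1)"
  using jump_time_eq[of t i] t0 jump_nth_bounds[of "i - 1"] count_ge_iff(2)[of t] by (auto simp: tau_def)

lemma tau_pos: "0 < i \<Longrightarrow> 0 < tau i"
  using tau_cases[of i] t0 by auto

lemma jump_time_tau:
  assumes "s \<in> {0..t}" "0 < i"
  shows "jump_time t L s i = (if tau i \<le> s then tau i else t + 1)"
  using jump_time_eq[OF assms] tau_le_iff[OF assms] jump_time_eq[of t i] count_mono[of s t] assms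
  by (auto simp: tau_def)

lemma tau_strict_mono: "0 < i \<Longrightarrow> i < j \<Longrightarrow> tau i \<le> t \<Longrightarrow> tau i < tau j"
  using jump_time_eq[of t i] jump_time_eq[of t j] t0 sorted_wrt_nth_less[OF sorted_jumps(1), of "i - 1" "j - 1"]
    count_ge_iff(2)[of t] tau_cases[of i] tau_cases[of j]
  by (auto simp: tau_def split: if_splits)

lemma last_tau_less: "last_time k tau \<le> t \<Longrightarrow> last_time k tau < tau (Suc k)"
  using tau_strict_mono[of k "Suc k"] tau_pos[of 1] by (auto simp: last_time_def)

lemma count_eq_iff:
  assumes "s \<in> {0..t}"
  shows "count s = k \<longleftrightarrow> last_time k tau \<le> s \<and> s < tau (Suc k)"
  using tau_le_iff[OF assms, of "Suc k"] tau_le_iff[OF assms, of k] assms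
  by (auto simp: last_time_def not_less[symmetric])

lemma jumps_eq_tau: "jumps = times (count t) tau"
proof (rule nth_equalityI)
  have "count t = length jumps"
  proof -
    have "{r \<in> jump_set t L. r \<le> t} = jump_set t L" by (auto simp: jump_set_def)
    then show ?thesis by (simp add: count_def)
  qed
  then show len: "length jumps = length (times (count t) tau)" by simp
  fix i assume "i < length jumps"
  then show "jumps ! i = times (count t) tau ! i"
    using jump_time_eq[of t "Suc i"] t0 len by (simp add: nth_times tau_def del: upt_Suc)
qed

lemma tau_simplex:
  assumes "k = 0 \<or> tau k < t"
  shows "tau \<in> time_simplex k t"
proof -
  have "tau i < t" if "i \<in> {1..k}" for i
    using tau_strict_mono[of i k] tau_cases[of i] tau_cases[of k] assms that by (cases "i = k") auto
  then show ?thesis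
    using tau_strict_mono tau_pos by (auto simp: time_simplex_iff less_imp_le)
qed

lemma parity:
  assumes "s \<in> {0..t}"
  shows "L s = count s mod 2"
  using assms
proof (induction "count s" arbitrary: s)
  case 0
  then have "{r \<in> jump_set t L. r \<le> s} = {}" using finite_jumps by (simp add: count_def)
  then have "L s = L 0" using 0 by (intro constant_between) auto
  then show ?case using 0 start by simp
next
  case (Suc i)
  then have i: "i < length jumps" using count_ge_iff(2)[of s] by simp
  let ?u = "jumps ! i" and ?p = "if i = 0 then 0 else jumps ! (i - 1)"
  have us: "?u \<le> s" using count_ge_iff(1)[OF i, of s] Suc.hyps(2) by simp
  have uJ: "?u \<in> jump_set t L" using nth_mem[OF i] sorted_jumps(2) by simp
  have pu: "?p < ?u" "0 \<le> ?p"
    by (rule previous_jump[OF i])+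
  have cp: "count ?p = i"
  proof -
    have "\<not> Suc i \<le> count ?p" using count_ge_iff(1)[OF i, of ?p] pu by simp
    moreover have "i \<le> count ?p" using count_ge_iff(1)[of "i - 1" ?p] i by (cases "i = 0") auto
    ultimately show ?thesis by simp
  qed
  have "L ?u \<noteq> L ?p"
    by (rule flip_at_jump[OF uJ]) (use pu no_jump_between_consecutive[OF i] in auto)
  moreover have "L ?p = i mod 2" using Suc.hyps(1)[of ?p] cp pu us Suc.prems by auto
  moreover have "L s = L ?u"
  proof (rule constant_between)
    fix r assume r: "?u < r" "r \<le> s"
    have "count ?u = count s"
      using count_ge_iff(1)[OF i, of ?u] count_mono[OF us] Suc.hyps(2) by auto
    then have "{q \<in> jump_set t L. q \<le> ?u} = {q \<in> jump_set t L. q \<le> s}"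
      using us finite_jumps unfolding count_def by (intro card_subset_eq) auto
    then have "r \<in> {q \<in> jump_set t L. q \<le> jumps ! i} \<longleftrightarrow> r \<in> {q \<in> jump_set t L. q \<le> s}"
      by (simp only:)
    then show "r \<notin> jump_set t L" using r by simp
  qed (use us Suc.prems jump_nth_bounds[OF i] in auto)
  moreover have "L ?u \<in> {0, 1}" "L ?p \<in> {0, 1}" using two_levels us pu Suc.prems by auto
  ultimately have "L s = Suc i mod 2" by (auto simp: mod_Suc)
  then show ?case using Suc.hyps(2) by simp
qed

text \<open>The level of the path agrees with the level of the deterministic trajectory that hops at the first \<open>k\<close> jump times,
as long as there are no further jumps.\<close>

lemma level_tau:
  assumes "s \<in> {0..t}" "count s \<le> k"
  shows "level (times k tau) s = L s"
proof -
  have "{i\<in>{1..k}. tau i \<le> s} = {1..count s}"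
    using tau_le_iff[OF assms(1)] assms(2) by auto
  then show ?thesis
    unfolding level_def length_filter_times by (simp add: parity[OF assms(1)])
qed

end

lemma (in smooth_surfaces) hopping_path_level_path:
  assumes "0 \<le> t" "hopping_path V t X Y L"
  shows "level_path t L"
  using assms by (auto simp: hopping_path_def level_path_def)

text \<open>Both curves solve the same locally Lipschitz equation up to time \<open>s\<close>, off a finite set of times.\<close>

lemma (in hopping_flow) path_follows_state:
  assumes path: "hopping_path V t X Y L" and ts: "hop_times t ts" and s: "s \<in> {0..t}"
    and lev: "\<And>r. 0 \<le> r \<Longrightarrow> r < s \<Longrightarrow> level ts r = L r"
  shows "(X s, Y s) = state ts (X 0, Y 0) s"
proof -
  have sub: "{0..s} \<subseteq> {0..t}" using s by auto
  have fin: "finite (jump_set t L)" using path by (simp add: hopping_path_def)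
  show ?thesis
  proof (rule field_curve_unique[where S = "insert s (jump_set t L \<union> set ts)" and l = L and l' = "level ts" and b = s])
    show "continuous_on {0..s} (\<lambda>s. (X s, Y s))"
      using path sub by (intro continuous_intros) (auto simp: hopping_path_def intro: continuous_on_subset)
    show "continuous_on {0..s} (state ts (X 0, Y 0))"
      by (rule continuous_on_subset[OF state_continuous[OF ts] sub])
    show "finite (insert s (jump_set t L \<union> set ts))" using fin by simp
    show "(X 0, Y 0) = state ts (X 0, Y 0) 0" by (simp add: state_0[OF ts])
    show "s \<in> {0..s}" using s by simp
    fix r assume r: "r \<in> {0..s} - insert s (jump_set t L \<union> set ts)"
    then have rt: "r \<in> {0..t} - jump_set t L" "r \<in> {0..t} - set ts" using s by auto
    have "(X has_vector_derivative Y r) (at r within {0..t})"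
      "(Y has_vector_derivative - grad (surface V (L r)) (X r)) (at r within {0..t})"
      using path rt by (auto simp: hopping_path_def)
    from has_vector_derivative_Pair[OF this]
    have "((\<lambda>s. (X s, Y s)) has_vector_derivative field V (L r) (X r, Y r)) (at r within {0..t})"
      by (simp add: field_def)
    then show "((\<lambda>s. (X s, Y s)) has_vector_derivative field V (L r) (X r, Y r)) (at r within {0..s})"
      by (rule has_vector_derivative_within_subset[OF _ sub])
    show "(state ts (X 0, Y 0) has_vector_derivative field V (level ts r) (state ts (X 0, Y 0) r)) (at r within {0..s})"
      by (rule has_vector_derivative_within_subset[OF state_derivative[OF ts rt(2)] sub])
    show "L r = level ts r" using lev[of r] r by auto
    then show "L r < 2" by (simp add: level_less_2)
  qed
qed


section \<open>The hopping process and its history\<close>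

lemma countable_grid: "countable (grid s)"
  by (simp add: grid_def countable_rat countable_Int1)

locale hopping_process_model = hopping_model V u0 \<epsilon> t Q P S A \<delta>
  for V :: "'m::finite potential" and u0 :: "real^'m \<Rightarrow> complex" and \<epsilon> t :: real
    and Q P :: "real list \<Rightarrow> real^'m \<Rightarrow> real^'m \<Rightarrow> real \<Rightarrow> real^'m"
    and S :: "real list \<Rightarrow> real^'m \<Rightarrow> real^'m \<Rightarrow> real \<Rightarrow> real"
    and A :: "real list \<Rightarrow> real^'m \<Rightarrow> real^'m \<Rightarrow> real \<Rightarrow> complex" and \<delta> :: real +
  fixes M :: "'w measure" and Qp Pp :: "real \<Rightarrow> 'w \<Rightarrow> real^'m" and l :: "real \<Rightarrow> 'w \<Rightarrow> nat"
  assumes process: "hopping_process M V \<epsilon> \<delta> u0 t Qp Pp l"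
begin

abbreviation X :: "real \<Rightarrow> 'w \<Rightarrow> (real^'m) \<times> (real^'m) \<times> nat" where
  "X s \<omega> \<equiv> (Qp s \<omega>, Pp s \<omega>, l s \<omega>)"

abbreviation history :: "real \<Rightarrow> 'w measure" where
  "history s \<equiv> past M X s"

definition start_point :: "'w \<Rightarrow> (real^'m) \<times> (real^'m)" where
  "start_point \<omega> = (Qp 0 \<omega>, Pp 0 \<omega>)"

definition hop_time :: "nat \<Rightarrow> 'w \<Rightarrow> real" where
  "hop_time i \<omega> = jump_time t (\<lambda>s. l s \<omega>) t i"

text \<open>The initial point and the first \<open>k\<close> jump times as far as they are known at time \<open>s\<close>. This depends on the history up to \<open>s\<close> only, and
coincides with \<open>hops\<close> as soon as \<open>k\<close> jumps have occurred.\<close>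

definition hop_history :: "real \<Rightarrow> nat \<Rightarrow> 'w \<Rightarrow> ((real^'m) \<times> (real^'m)) \<times> (nat \<Rightarrow> real)" where
  "hop_history s k \<omega> = (start_point \<omega>, \<lambda>i\<in>{1..k}. jump_time t (\<lambda>r. l r \<omega>) s i)"

abbreviation hops :: "nat \<Rightarrow> 'w \<Rightarrow> ((real^'m) \<times> (real^'m)) \<times> (nat \<Rightarrow> real)" where
  "hops k \<equiv> hop_history t k"

lemma prob: "prob_space M"
  using process by (simp add: hopping_process_def)

sublocale prob_space M by (rule prob)

lemma measurable_X:
  assumes "s \<in> {0..t}"
  shows "X s \<in> borel_measurable M"
proof -
  have "l s \<in> borel_measurable M"
    using process assms measurable_compose[of "l s" M "count_space UNIV" "\<lambda>x. x" borel]
    by (auto simp: hopping_process_def)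
  moreover have "Qp s \<in> borel_measurable M" "Pp s \<in> borel_measurable M"
    using process assms by (auto simp: hopping_process_def)
  ultimately show ?thesis by (intro borel_measurable_Pair)
qed

lemma history_generator: "{X r -` B \<inter> space M |r B. r \<in> {0..s} \<and> B \<in> sets borel} \<subseteq> Pow (space M)"
  by auto

lemma space_history [simp]: "space (history s) = space M"
  unfolding past_def by (rule space_measure_of[OF history_generator])

lemma sets_history: "sets (history s) = sigma_sets (space M) {X r -` B \<inter> space M |r B. r \<in> {0..s} \<and> B \<in> sets borel}"
  unfolding past_def by (rule sets_measure_of[OF history_generator])

lemma measurable_X_history:
  assumes "r \<in> {0..s}"
  shows "X r \<in> borel_measurable (history s)"
proof (rule measurableI)
  fix B :: "((real^'m) \<times> (real^'m) \<times> nat) set" assume "B \<in> sets borel"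
  then show "X r -` B \<inter> space (history s) \<in> sets (history s)"
    using assms by (auto simp: sets_history intro!: sigma_sets.Basic)
qed simp

lemma history_subalgebra:
  assumes "s \<le> t"
  shows "subalgebra M (history s)"
proof -
  have "sets (history s) \<subseteq> sets M"
    unfolding sets_history
  proof (rule sets.sigma_sets_subset, safe)
    fix r and B :: "((real^'m) \<times> (real^'m) \<times> nat) set" assume "r \<in> {0..s}" "B \<in> sets borel"
    then show "X r -` B \<inter> space M \<in> sets M"
      using measurable_sets[OF measurable_X[of r]] assms by auto
  qed
  then show ?thesis by (simp add: subalgebra_def)
qed

lemma measurable_history_M: "s \<le> t \<Longrightarrow> f \<in> history s \<rightarrow>\<^sub>M N \<Longrightarrow> f \<in> M \<rightarrow>\<^sub>M N"
  by (rule measurable_from_subalg[OF history_subalgebra])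

lemma measurable_position_history:
  assumes "r \<in> {0..s}"
  shows "(\<lambda>\<omega>. (Qp r \<omega>, Pp r \<omega>)) \<in> borel_measurable (history s)"
    and "Qp r \<in> borel_measurable (history s)"
    and "l r \<in> history s \<rightarrow>\<^sub>M count_space UNIV"
proof -
  have c: "(\<lambda>\<omega>. f (X r \<omega>)) \<in> borel_measurable (history s)"
    if "continuous_on UNIV f" for f :: "_ \<Rightarrow> 'b::topological_space"
    by (rule measurable_compose[OF measurable_X_history[OF assms] borel_measurable_continuous_onI[OF that]])
  have "(\<lambda>\<omega>. (fst (X r \<omega>), fst (snd (X r \<omega>)))) \<in> borel_measurable (history s)"
    by (rule c) (intro continuous_intros)
  then show "(\<lambda>\<omega>. (Qp r \<omega>, Pp r \<omega>)) \<in> borel_measurable (history s)" by simp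
  have "(\<lambda>\<omega>. fst (X r \<omega>)) \<in> borel_measurable (history s)"
    by (rule c) (intro continuous_intros)
  then show "Qp r \<in> borel_measurable (history s)" by simp
  have "(\<lambda>\<omega>. snd (snd (X r \<omega>))) \<in> borel_measurable (history s)"
    by (rule c) (intro continuous_intros)
  then have "l r \<in> borel_measurable (history s)" by simp
  then show "l r \<in> history s \<rightarrow>\<^sub>M count_space UNIV"
    using measurable_sets[of "l r" "history s" borel "{a}" for a] by (auto simp: measurable_count_space_eq2_countable)
qed

lemma reach_history:
  "r \<in> {0..s} \<Longrightarrow> {\<omega> \<in> space M. reach (\<lambda>q. l q \<omega>) i r} \<in> sets (history s)"
proof (induction i arbitrary: r)
  case 0
  show ?case using sets.top[of "history s"] by simp
next
  case (Suc i)
  have "{\<omega> \<in> space M. reach (\<lambda>q. l q \<omega>) (Suc i) r}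
      = (\<Union>q\<in>grid r. \<Union>q'\<in>\<rat> \<inter> {0..<q}.
          {\<omega> \<in> space M. reach (\<lambda>q. l q \<omega>) i q'} \<inter> {\<omega> \<in> space M. l q' \<omega> \<noteq> l q \<omega>})"
    by auto
  also have "\<dots> \<in> sets (history s)"
  proof (intro sets.countable_UN'' countable_grid countable_Int1 countable_rat sets.Int)
    fix q q' assume "q \<in> grid r" "q' \<in> \<rat> \<inter> {0..<q}"
    then have q: "q \<in> {0..s}" "q' \<in> {0..s}" using grid_bounds[of r q] Suc.prems by auto
    show "{\<omega> \<in> space M. reach (\<lambda>q. l q \<omega>) i q'} \<in> sets (history s)" by (rule Suc.IH[OF q(2)])
    have v: "l p -` {a} \<inter> space M \<in> sets (history s)" if "p \<in> {0..s}" for p a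
      using measurable_sets[OF measurable_position_history(3)[OF that], of "{a}"] by simp
    have "{\<omega> \<in> space M. l q' \<omega> \<noteq> l q \<omega>}
        = space M - (\<Union>a. (l q' -` {a} \<inter> space M) \<inter> (l q -` {a} \<inter> space M))"
      by auto
    also have "\<dots> \<in> sets (history s)"
      using sets.top[of "history s"] by (intro sets.Diff sets.countable_UN'' sets.Int v q) auto
    finally show "{\<omega> \<in> space M. l q' \<omega> \<noteq> l q \<omega>} \<in> sets (history s)" .
  qed
  finally show ?case .
qed

lemma jump_time_history:
  assumes "0 \<le> s"
  shows "(\<lambda>\<omega>. jump_time t (\<lambda>r. l r \<omega>) s i) \<in> borel_measurable (history s)"
  unfolding jump_time_def
proof (rule borel_measurable_cINF_real[OF countable_grid])
  fix r assume "r \<in> grid s"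
  then have "{\<omega> \<in> space (history s). reach (\<lambda>q. l q \<omega>) i r} \<in> sets (history s)"
    using reach_history[of r s i] grid_bounds[OF assms] by simp
  then show "(\<lambda>\<omega>. if reach (\<lambda>q. l q \<omega>) i r then r else t + 1) \<in> borel_measurable (history s)"
    by (intro measurable_If) auto
qed

lemma hop_history_measurable:
  assumes "0 \<le> s"
  shows "hop_history s k \<in> history s \<rightarrow>\<^sub>M path_space k"
proof -
  have "(\<lambda>\<omega>. \<lambda>i\<in>{1..k}. jump_time t (\<lambda>r. l r \<omega>) s i) \<in> history s \<rightarrow>\<^sub>M Pi\<^sub>M {1..k} (\<lambda>_. lborel)"
    by (rule measurable_restrict) (simp add: jump_time_history[OF assms])
  moreover have "start_point \<in> borel_measurable (history s)"
    unfolding start_point_def[abs_def] using assms by (intro measurable_position_history) auto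
  then have "start_point \<in> history s \<rightarrow>\<^sub>M lborel" by simp
  ultimately show ?thesis
    unfolding hop_history_def[abs_def] path_space_def by (intro measurable_Pair)
qed

lemma hops_measurable [measurable]: "hops k \<in> M \<rightarrow>\<^sub>M path_space k"
  by (rule measurable_history_M[OF order_refl hop_history_measurable[OF t_nonneg]])

lemma hop_time_measurable [measurable]: "hop_time i \<in> borel_measurable M"
  unfolding hop_time_def[abs_def] by (rule measurable_history_M[OF order_refl jump_time_history[OF t_nonneg]])

definition good :: "'w \<Rightarrow> bool" where
  "good \<omega> \<longleftrightarrow> hopping_path V t (\<lambda>s. Qp s \<omega>) (\<lambda>s. Pp s \<omega>) (\<lambda>s. l s \<omega>)"

lemma AE_good: "AE \<omega> in M. good \<omega>"
  using process by (simp add: hopping_process_def good_def)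

lemma good_level_path: "good \<omega> \<Longrightarrow> level_path t (\<lambda>s. l s \<omega>)"
  unfolding good_def by (rule hopping_path_level_path[OF t_nonneg])

lemma hop_time_eq_tau: "good \<omega> \<Longrightarrow> hop_time i \<omega> = level_path.tau t (\<lambda>s. l s \<omega>) i"
  using level_path.tau_def[OF good_level_path] by (simp add: hop_time_def)

definition last_hop :: "nat \<Rightarrow> 'w \<Rightarrow> real" where
  "last_hop k \<omega> = (if k = 0 then 0 else hop_time k \<omega>)"

lemma last_hop_measurable [measurable]: "last_hop k \<in> borel_measurable M"
  unfolding last_hop_def[abs_def] by measurable

lemma last_hop_eq: "last_hop k \<omega> = last_time k (\<lambda>i. hop_time i \<omega>)"
  by (simp add: last_hop_def last_time_def)

lemma hops_eq: "hops k \<omega> = (start_point \<omega>, \<lambda>i\<in>{1..k}. hop_time i \<omega>)"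
  by (simp add: hop_history_def hop_time_def)

lemma last_time_hops: "last_time k (snd (hops k \<omega>)) = last_hop k \<omega>"
  by (simp add: hops_eq last_time_def last_hop_def)

lemma times_hops: "times k (snd (hops k \<omega>)) = times k (\<lambda>i. hop_time i \<omega>)"
  unfolding hops_eq by (intro map_cong) auto

lemma hops_Suc: "hops (Suc k) \<omega> = (start_point \<omega>, (snd (hops k \<omega>))(Suc k := hop_time (Suc k) \<omega>))"
  by (auto simp: hops_eq fun_eq_iff)

lemma last_hop_nonneg: "good \<omega> \<Longrightarrow> 0 \<le> last_hop k \<omega>"
  using level_path.tau_pos[OF good_level_path, of \<omega> k] by (simp add: last_hop_def hop_time_eq_tau less_imp_le)

lemma last_hop_less: "good \<omega> \<Longrightarrow> last_hop k \<omega> \<le> t \<Longrightarrow> last_hop k \<omega> < hop_time (Suc k) \<omega>"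
  using level_path.last_tau_less[OF good_level_path, of \<omega> k] by (simp add: last_hop_def hop_time_eq_tau last_time_def split: if_splits)

lemma hop_time_range: "good \<omega> \<Longrightarrow> 0 < hop_time (Suc k) \<omega> \<and> (hop_time (Suc k) \<omega> \<le> t \<or> hop_time (Suc k) \<omega> = t + 1)"
  using level_path.tau_cases[OF good_level_path, of \<omega> "Suc k"] t_nonneg by (auto simp: hop_time_eq_tau)

lemma hops_simplex:
  assumes "good \<omega>" "last_hop k \<omega> < t \<or> k = 0"
  shows "snd (hops k \<omega>) \<in> time_simplex k t"
proof -
  have "level_path.tau t (\<lambda>s. l s \<omega>) \<in> time_simplex k t"
    using assms by (intro level_path.tau_simplex[OF good_level_path]) (auto simp: last_hop_def hop_time_eq_tau split: if_splits)
  then show ?thesis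
    using assms(1) by (subst time_simplex_cong[of k _ "level_path.tau t (\<lambda>s. l s \<omega>)"]) (auto simp: hops_eq hop_time_eq_tau)
qed

text \<open>The left limit of the path at a jump time still follows the trajectory with the earlier jumps
  only, which is why the upper bound on the time is not strict.\<close>

lemma state_hops:
  assumes good: "good \<omega>" and s: "s \<in> {0..t}" and k: "last_hop k \<omega> < t \<or> k = 0" "s \<le> hop_time (Suc k) \<omega>"
  shows "(Qp s \<omega>, Pp s \<omega>) = state (times k (snd (hops k \<omega>))) (fst (hops k \<omega>)) s"
proof -
  interpret level_path t "\<lambda>s. l s \<omega>" by (rule good_level_path[OF good])
  have eq: "times k (snd (hops k \<omega>)) = times k tau"
    unfolding times_hops by (simp only: hop_time_eq_tau[OF good])
  have ts: "hop_times t (times k tau)"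
    using hops_simplex[OF good k(1)] unfolding time_simplex_def eq mem_Collect_eq .
  have "level (times k tau) r = l r \<omega>" if r: "0 \<le> r" "r < s" for r
  proof (rule level_tau)
    show "r \<in> {0..t}" using r s by auto
    then show "count r \<le> k" using tau_le_iff[of r "Suc k"] k(2) r by (auto simp: hop_time_eq_tau[OF good])
  qed
  from path_follows_state[OF good[unfolded good_def] ts s this] show ?thesis
    unfolding eq by (simp add: hop_history_def start_point_def)
qed


section \<open>Infinitesimal jump probabilities\<close>

lemma hop_intensity_bound:
  assumes "compact K"
  obtains B where "0 \<le> B" "\<And>z. z \<in> K \<Longrightarrow> \<delta> / \<epsilon> * cmod (V 0 1 (fst z)) \<le> B"
proof -
  have "continuous_on K (\<lambda>z. \<delta> / \<epsilon> * cmod (V 0 1 (fst z)))"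
    by (intro continuous_intros continuous_on_compose2[OF V01]) auto
  then have "bounded ((\<lambda>z. \<delta> / \<epsilon> * cmod (V 0 1 (fst z))) ` K)"
    by (intro compact_imp_bounded compact_continuous_image assms)
  then obtain B where "0 < B" "\<And>z. z \<in> K \<Longrightarrow> norm (\<delta> / \<epsilon> * cmod (V 0 1 (fst z))) \<le> B"
    unfolding bounded_pos by auto
  then show ?thesis using that[of B] eps_pos delta_pos by auto
qed

text \<open>By the Markov property the conditional probability given the history equals the one given the present state, to which the
first-order expansion applies. The factor two adds the errors of the transitions from \<open>0\<close> to \<open>1\<close> and from \<open>1\<close> to \<open>0\<close>.\<close>

lemma one_step:
  assumes K: "compact K"
  obtains R where "R \<in> o[at_right 0](\<lambda>h. h)"
    "\<And>s h Y. 0 \<le> s \<Longrightarrow> 0 < h \<Longrightarrow> s + h \<le> t \<Longrightarrow> Y \<in> borel_measurable (history s) \<Longrightarrow>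
      (\<And>\<omega>. 0 \<le> Y \<omega> \<and> Y \<omega> \<le> 1) \<Longrightarrow> (\<And>\<omega>. Y \<omega> \<noteq> 0 \<Longrightarrow> (Qp s \<omega>, Pp s \<omega>) \<in> K) \<Longrightarrow>
      \<bar>(LINT \<omega>|M. Y \<omega> * of_bool (l (s + h) \<omega> \<noteq> l s \<omega>)) - h * (LINT \<omega>|M. Y \<omega> * (\<delta> / \<epsilon> * cmod (V 0 1 (Qp s \<omega>))))\<bar> \<le> 2 * \<bar>R h\<bar>"
proof -
  note unif = process[unfolded hopping_process_def, THEN conjunct2, THEN conjunct2, THEN conjunct2, THEN conjunct2,
    THEN conjunct2, THEN spec, THEN mp, OF K]
  from unif obtain R where R1: "R \<in> o[at_right 0](\<lambda>h. h)"
    and R2: "\<forall>s h. \<forall>j<2. \<forall>k<2. 0 \<le> s \<and> 0 < h \<and> s + h \<le> t \<longrightarrow>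
          (AE \<omega> in M. (Qp s \<omega>, Pp s \<omega>) \<in> K \<and> l s \<omega> = j \<longrightarrow>
             \<bar>cond_prob_given M (present M X s) {\<omega>' \<in> space M. l (s + h) \<omega>' = k} \<omega>
               - (of_bool (j = k) + hop_rate V \<epsilon> \<delta> j k (Qp s \<omega>) * h)\<bar> \<le> R h)"
    by (rule bexE)
  have R: "R \<in> o[at_right 0](\<lambda>h. h)"
    "\<And>s h j k. j < 2 \<Longrightarrow> k < 2 \<Longrightarrow> 0 \<le> s \<Longrightarrow> 0 < h \<Longrightarrow> s + h \<le> t \<Longrightarrow>
          (AE \<omega> in M. (Qp s \<omega>, Pp s \<omega>) \<in> K \<and> l s \<omega> = j \<longrightarrow>
             \<bar>cond_prob_given M (present M X s) {\<omega>' \<in> space M. l (s + h) \<omega>' = k} \<omega>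
               - (of_bool (j = k) + hop_rate V \<epsilon> \<delta> j k (Qp s \<omega>) * h)\<bar> \<le> R h)"
    by (rule R1) (rule R2[THEN spec, THEN spec, THEN spec, THEN mp, THEN spec, THEN mp, THEN mp]; simp)
  have markov: "markov M t X" using process by (simp add: hopping_process_def)
  obtain B where B: "0 \<le> B" "\<And>z. z \<in> K \<Longrightarrow> \<delta> / \<epsilon> * cmod (V 0 1 (fst z)) \<le> B"
    using hop_intensity_bound[OF K] by blast
  let ?v = "\<lambda>s \<omega>. \<delta> / \<epsilon> * cmod (V 0 1 (Qp s \<omega>))"
  show ?thesis
  proof (rule that[OF R(1)])
    fix s h :: real and Y :: "'w \<Rightarrow> real"
    assume s: "0 \<le> s" "0 < h" "s + h \<le> t" and Y: "Y \<in> borel_measurable (history s)"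
      and Y01: "\<And>\<omega>. 0 \<le> Y \<omega> \<and> Y \<omega> \<le> 1" and YK: "\<And>\<omega>. Y \<omega> \<noteq> 0 \<Longrightarrow> (Qp s \<omega>, Pp s \<omega>) \<in> K"
    have st: "s \<in> {0..t}" "s + h \<in> {0..t}" "s \<le> t" using s by auto
    interpret past: finite_measure_subalgebra M "history s"
      by unfold_locales (rule history_subalgebra[OF st(3)])
    have [measurable]: "Y \<in> borel_measurable M" by (rule measurable_history_M[OF st(3) Y])
    have [measurable]: "Qp s \<in> borel_measurable M" "l s \<in> M \<rightarrow>\<^sub>M count_space UNIV" "l (s + h) \<in> M \<rightarrow>\<^sub>M count_space UNIV"
      using process st by (auto simp: hopping_process_def)
    have [measurable]: "V 0 1 \<in> borel_measurable borel" by (rule borel_measurable_continuous_onI[OF V01])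
    have "Measurable.pred M (\<lambda>\<omega>. \<exists>a. l (s + h) \<omega> = a \<and> l s \<omega> \<noteq> a)"
      by measurable
    then have [measurable]: "Measurable.pred M (\<lambda>\<omega>. l (s + h) \<omega> \<noteq> l s \<omega>)"
      by (rule arg_cong[where f = "Measurable.pred M", THEN iffD1, rotated]) auto
    have lh: "l s \<in> history s \<rightarrow>\<^sub>M count_space UNIV"
      using s by (intro measurable_position_history) auto
    have vint: "integrable M (\<lambda>\<omega>. Y \<omega> * indicator {\<omega>. l s \<omega> = j} \<omega> * ?v s \<omega>)" for j
    proof (rule integrable_const_bound)
      show "AE \<omega> in M. norm (Y \<omega> * indicator {\<omega>. l s \<omega> = j} \<omega> * ?v s \<omega>) \<le> B"
      proof (rule AE_I2)
        fix \<omega>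
        show "norm (Y \<omega> * indicator {\<omega>. l s \<omega> = j} \<omega> * ?v s \<omega>) \<le> B"
        proof (cases "Y \<omega> = 0")
          case False
          have v: "?v s \<omega> \<le> B" "0 \<le> ?v s \<omega>" using B(2)[OF YK[OF False]] eps_pos delta_pos by auto
          have "norm (Y \<omega> * indicator {\<omega>. l s \<omega> = j} \<omega> * ?v s \<omega>) \<le> 1 * 1 * B"
            unfolding norm_mult using Y01[of \<omega>] v by (intro mult_mono) (auto simp: indicator_def)
          then show ?thesis by simp
        qed (simp add: B)
      qed
    qed measurable
    have step: "\<bar>(LINT \<omega>|M. Y \<omega> * indicator {\<omega>. l s \<omega> = j} \<omega> * indicator {\<omega>' \<in> space M. l (s + h) \<omega>' = k} \<omega>)
        - h * (LINT \<omega>|M. Y \<omega> * indicator {\<omega>. l s \<omega> = j} \<omega> * ?v s \<omega>)\<bar> \<le> \<bar>R h\<bar>"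
      if jk: "j < 2" "k < 2" "j \<noteq> k" for j k
    proof -
      let ?E = "{\<omega>' \<in> space M. l (s + h) \<omega>' = k}" and ?Y = "\<lambda>\<omega>. Y \<omega> * indicator {\<omega>. l s \<omega> = j} \<omega>"
      let ?c = "real_cond_exp M (history s) (indicator ?E)"
      have E: "?E \<in> sets M" by measurable
      have "open (UNIV \<times> UNIV \<times> {k} :: ((real^'m) \<times> (real^'m) \<times> nat) set)"
        by (intro open_Times open_UNIV topological_space_class.open_UNIV discrete_topology_class.open_discrete)
      then have "UNIV \<times> UNIV \<times> {k} \<in> sets (borel :: ((real^'m) \<times> (real^'m) \<times> nat) measure)" by simp
      then have "AE \<omega> in M. cond_prob_given M (history s) (X (s + h) -` (UNIV \<times> UNIV \<times> {k}) \<inter> space M) \<omega>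
          = cond_prob_given M (present M X s) (X (s + h) -` (UNIV \<times> UNIV \<times> {k}) \<inter> space M) \<omega>"
        using s by (intro markov[unfolded markov_def, rule_format]) simp
      moreover have "X (s + h) -` (UNIV \<times> UNIV \<times> {k}) \<inter> space M = ?E" by auto
      ultimately have AE1: "AE \<omega> in M. ?c \<omega> = cond_prob_given M (present M X s) ?E \<omega>"
        by (simp only: cond_prob_given_def)
      have AE2: "AE \<omega> in M. (Qp s \<omega>, Pp s \<omega>) \<in> K \<and> l s \<omega> = j \<longrightarrow> \<bar>?c \<omega> - ?v s \<omega> * h\<bar> \<le> R h"
        using AE1 R(2)[OF jk(1,2) s] by eventually_elim (use jk in \<open>auto simp: hop_rate_def\<close>)
      have "(\<lambda>\<omega>. Y \<omega> * indicator {\<omega>. l s \<omega> = j} \<omega>) \<in> borel_measurable (history s)"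
        using Y lh by measurable
      have int0: "integrable M (\<lambda>\<omega>. ?Y \<omega> * indicator ?E \<omega>)"
        by (rule integrable_const_bound[of _ 1]) (use Y01 in \<open>auto simp: indicator_def\<close>)
      note ce = past.real_cond_exp_intg[OF int0 \<open>?Y \<in> borel_measurable (history s)\<close>]
      have c_int: "integrable M (\<lambda>\<omega>. ?Y \<omega> * ?c \<omega>)" by (rule ce(1)) (use E in measurable)
      have "(LINT \<omega>|M. ?Y \<omega> * indicator ?E \<omega>) = (LINT \<omega>|M. ?Y \<omega> * ?c \<omega>)"
        by (rule ce(2)[symmetric]) (use E in measurable)
      then have "(LINT \<omega>|M. ?Y \<omega> * indicator ?E \<omega>) - h * (LINT \<omega>|M. ?Y \<omega> * ?v s \<omega>)
          = (LINT \<omega>|M. ?Y \<omega> * ?c \<omega>) - (LINT \<omega>|M. h * (?Y \<omega> * ?v s \<omega>))"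
        by simp
      also have "\<dots> = (LINT \<omega>|M. ?Y \<omega> * ?c \<omega> - h * (?Y \<omega> * ?v s \<omega>))"
        by (rule Bochner_Integration.integral_diff[symmetric, OF c_int integrable_mult_right[OF vint]])
      finally have eq: "(LINT \<omega>|M. ?Y \<omega> * indicator ?E \<omega>) - h * (LINT \<omega>|M. ?Y \<omega> * ?v s \<omega>)
          = (LINT \<omega>|M. ?Y \<omega> * ?c \<omega> - h * (?Y \<omega> * ?v s \<omega>))" .
      have "\<bar>(LINT \<omega>|M. ?Y \<omega> * indicator ?E \<omega>) - h * (LINT \<omega>|M. ?Y \<omega> * ?v s \<omega>)\<bar>
          \<le> (LINT \<omega>|M. \<bar>?Y \<omega> * ?c \<omega> - h * (?Y \<omega> * ?v s \<omega>)\<bar>)"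
        unfolding eq by (rule integral_abs_bound)
      also have "\<dots> \<le> (LINT \<omega>|M. \<bar>R h\<bar>)"
      proof (rule integral_mono_AE)
        show "integrable M (\<lambda>\<omega>. \<bar>?Y \<omega> * ?c \<omega> - h * (?Y \<omega> * ?v s \<omega>)\<bar>)"
          by (intro integrable_abs Bochner_Integration.integrable_diff integrable_mult_right c_int vint)
        show "AE \<omega> in M. \<bar>?Y \<omega> * ?c \<omega> - h * (?Y \<omega> * ?v s \<omega>)\<bar> \<le> \<bar>R h\<bar>"
          using AE2
        proof eventually_elim
          case (elim \<omega>)
          show ?case
          proof (cases "Y \<omega> = 0 \<or> l s \<omega> \<noteq> j")
            case True
            then show ?thesis by (auto simp: indicator_def)
          next
            case False
            then have b: "\<bar>?c \<omega> - ?v s \<omega> * h\<bar> \<le> \<bar>R h\<bar>" using elim YK by force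
            have "\<bar>?Y \<omega> * ?c \<omega> - h * (?Y \<omega> * ?v s \<omega>)\<bar> = \<bar>Y \<omega> * (?c \<omega> - ?v s \<omega> * h)\<bar>"
              using False by (simp add: indicator_def algebra_simps)
            also have "\<dots> = Y \<omega> * \<bar>?c \<omega> - ?v s \<omega> * h\<bar>" using Y01[of \<omega>] by (simp add: abs_mult)
            also have "\<dots> \<le> 1 * \<bar>R h\<bar>" using Y01[of \<omega>] b by (intro mult_mono) auto
            finally show ?thesis by simp
          qed
        qed
      qed simp
      finally show ?thesis by (simp add: prob_space)
    qed
    have ind_int: "integrable M (\<lambda>\<omega>. Y \<omega> * indicator {\<omega>. l s \<omega> = j} \<omega> * indicator {\<omega>' \<in> space M. l (s + h) \<omega>' = k} \<omega>)" for j k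
      by (rule integrable_const_bound[of _ 1]) (use Y01 in \<open>auto simp: indicator_def\<close>)
    have lev: "AE \<omega> in M. l s \<omega> \<in> {0, 1} \<and> l (s + h) \<omega> \<in> {0, 1}"
      using AE_good by eventually_elim (use st in \<open>auto simp: good_def hopping_path_def\<close>)
    have "(LINT \<omega>|M. Y \<omega> * of_bool (l (s + h) \<omega> \<noteq> l s \<omega>))
        = (LINT \<omega>|M. Y \<omega> * indicator {\<omega>. l s \<omega> = 0} \<omega> * indicator {\<omega>' \<in> space M. l (s + h) \<omega>' = 1} \<omega>
           + Y \<omega> * indicator {\<omega>. l s \<omega> = 1} \<omega> * indicator {\<omega>' \<in> space M. l (s + h) \<omega>' = 0} \<omega>)"
    proof (rule integral_cong_AE)
      show "AE \<omega> in M. Y \<omega> * of_bool (l (s + h) \<omega> \<noteq> l s \<omega>)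
          = Y \<omega> * indicator {\<omega>. l s \<omega> = 0} \<omega> * indicator {\<omega>' \<in> space M. l (s + h) \<omega>' = 1} \<omega>
            + Y \<omega> * indicator {\<omega>. l s \<omega> = 1} \<omega> * indicator {\<omega>' \<in> space M. l (s + h) \<omega>' = 0} \<omega>"
        using lev AE_space by eventually_elim (auto simp: indicator_def)
    qed measurable
    also have "\<dots> = (LINT \<omega>|M. Y \<omega> * indicator {\<omega>. l s \<omega> = 0} \<omega> * indicator {\<omega>' \<in> space M. l (s + h) \<omega>' = 1} \<omega>)
           + (LINT \<omega>|M. Y \<omega> * indicator {\<omega>. l s \<omega> = 1} \<omega> * indicator {\<omega>' \<in> space M. l (s + h) \<omega>' = 0} \<omega>)"
      by (intro Bochner_Integration.integral_add ind_int)
    finally have 1: "(LINT \<omega>|M. Y \<omega> * of_bool (l (s + h) \<omega> \<noteq> l s \<omega>))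
      = (LINT \<omega>|M. Y \<omega> * indicator {\<omega>. l s \<omega> = 0} \<omega> * indicator {\<omega>' \<in> space M. l (s + h) \<omega>' = 1} \<omega>)
           + (LINT \<omega>|M. Y \<omega> * indicator {\<omega>. l s \<omega> = 1} \<omega> * indicator {\<omega>' \<in> space M. l (s + h) \<omega>' = 0} \<omega>)" .
    have "(LINT \<omega>|M. Y \<omega> * ?v s \<omega>)
        = (LINT \<omega>|M. Y \<omega> * indicator {\<omega>. l s \<omega> = 0} \<omega> * ?v s \<omega> + Y \<omega> * indicator {\<omega>. l s \<omega> = 1} \<omega> * ?v s \<omega>)"
    proof (rule integral_cong_AE)
      show "AE \<omega> in M. Y \<omega> * ?v s \<omega>
          = Y \<omega> * indicator {\<omega>. l s \<omega> = 0} \<omega> * ?v s \<omega> + Y \<omega> * indicator {\<omega>. l s \<omega> = 1} \<omega> * ?v s \<omega>"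
        using lev by eventually_elim (auto simp: indicator_def)
    qed measurable
    also have "\<dots> = (LINT \<omega>|M. Y \<omega> * indicator {\<omega>. l s \<omega> = 0} \<omega> * ?v s \<omega>)
        + (LINT \<omega>|M. Y \<omega> * indicator {\<omega>. l s \<omega> = 1} \<omega> * ?v s \<omega>)"
      by (intro Bochner_Integration.integral_add vint)
    finally have 2: "(LINT \<omega>|M. Y \<omega> * ?v s \<omega>) = (LINT \<omega>|M. Y \<omega> * indicator {\<omega>. l s \<omega> = 0} \<omega> * ?v s \<omega>)
        + (LINT \<omega>|M. Y \<omega> * indicator {\<omega>. l s \<omega> = 1} \<omega> * ?v s \<omega>)" .
    show "\<bar>(LINT \<omega>|M. Y \<omega> * of_bool (l (s + h) \<omega> \<noteq> l s \<omega>)) - h * (LINT \<omega>|M. Y \<omega> * ?v s \<omega>)\<bar> \<le> 2 * \<bar>R h\<bar>"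
    proof -
      have combine: "\<bar>a + b - h * (c + d)\<bar> \<le> 2 * r" if "\<bar>a - h * c\<bar> \<le> r" "\<bar>b - h * d\<bar> \<le> r" for a b c d r :: real
        using that unfolding distrib_left by linarith
      show ?thesis unfolding 1 2 by (rule combine[OF step step]) simp_all
    qed
  qed
qed

end

section \<open>Time grids\<close>

text \<open>The index of the grid interval, open on the left and closed on the right, that contains \<open>u\<close>.\<close>

definition cell :: "real \<Rightarrow> real \<Rightarrow> real \<Rightarrow> nat" where
  "cell a h u = nat (\<lceil>(u - a) / h\<rceil> - 1)"

lemma cell_iff:
  assumes h: "0 < h" and u: "a < u"
  shows "a + real i * h < u \<and> u \<le> a + real (Suc i) * h \<longleftrightarrow> i = cell a h u"
proof -
  let ?x = "(u - a) / h"
  have x0: "0 < ?x" using h u by simp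
  have "a + real i * h < u \<and> u \<le> a + real (Suc i) * h \<longleftrightarrow> real i < ?x \<and> ?x \<le> real (Suc i)"
    using h by (simp add: pos_less_divide_eq pos_divide_le_eq algebra_simps)
  also have "\<dots> \<longleftrightarrow> \<lceil>?x\<rceil> = int i + 1"
    by (subst ceiling_eq_iff) auto
  also have "\<dots> \<longleftrightarrow> i = cell a h u"
    using x0 zero_less_ceiling[of ?x] unfolding cell_def by auto
  finally show ?thesis .
qed

lemma cell_bounds:
  assumes h: "0 < h" and u: "a < u"
  shows "a + real (cell a h u) * h < u" "u \<le> a + real (cell a h u) * h + h"
    "u \<le> a + real N * h \<Longrightarrow> cell a h u < N"
proof -
  have c: "a + real (cell a h u) * h < u" "u \<le> a + real (Suc (cell a h u)) * h"
    using cell_iff[OF h u, of "cell a h u"] by auto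
  then show "a + real (cell a h u) * h < u" "u \<le> a + real (cell a h u) * h + h"
    by (simp_all add: algebra_simps)
  assume "u \<le> a + real N * h"
  with c(1) have "real (cell a h u) * h < real N * h" by linarith
  then show "cell a h u < N" using h by simp
qed

lemma sum_step_function_integral:
  assumes "0 < h"
  shows "(LINT s|lborel. (\<Sum>i<N. indicator {a + real i * h<..a + real (Suc i) * h} s * F i)) = (\<Sum>i<N. h * F i)"
    (is "(LINT s|lborel. (\<Sum>i<N. ?I i s * F i)) = _")
proof -
  have "a + real i * h \<le> a + real (Suc i) * h" for i using assms by (simp add: distrib_right)
  then have "integrable lborel (\<lambda>s. ?I i s * F i)" for i
    by (intro integrable_mult_left integrable_real_indicator) (simp_all del: of_nat_Suc)
  then have "(LINT s|lborel. (\<Sum>i<N. ?I i s * F i)) = (\<Sum>i<N. (LINT s|lborel. ?I i s * F i))"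
    by (intro Bochner_Integration.integral_sum)
  also have "(LINT s|lborel. ?I i s * F i) = h * F i" for i
    using assms by (simp add: algebra_simps)
  then have "(\<Sum>i<N. (LINT s|lborel. ?I i s * F i)) = (\<Sum>i<N. h * F i)" by (intro sum.cong refl)
  finally show ?thesis .
qed

lemma step_function_eq:
  assumes h: "0 < h" and s: "a < s" "s \<le> a + real N * h"
  shows "(\<Sum>i<N. indicator {a + real i * h<..a + real (Suc i) * h} s * F i) = (F (cell a h s) :: real)"
proof -
  have "(\<Sum>i<N. indicator {a + real i * h<..a + real (Suc i) * h} s * F i) = (\<Sum>i<N. if i = cell a h s then F i else 0)"
    using cell_iff[OF h s(1)] by (intro sum.cong) (auto simp: indicator_def)
  also have "\<dots> = F (cell a h s)" using cell_bounds(3)[OF h s] by simp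
  finally show ?thesis .
qed

lemma step_function_outside:
  assumes h: "0 < h" and s: "\<not> (a < s \<and> s \<le> a + real N * h)"
  shows "(\<Sum>i<N. indicator {a + real i * h<..a + real (Suc i) * h} s * F i) = (0 :: real)"
proof (rule sum.neutral, rule ballI)
  fix i assume "i \<in> {..<N}"
  then have "0 \<le> real i * h" "real (Suc i) * h \<le> real N * h" using h by (auto intro!: mult_right_mono simp del: of_nat_Suc)
  with s have "s \<notin> {a + real i * h<..a + real (Suc i) * h}" by auto
  then show "indicator {a + real i * h<..a + real (Suc i) * h} s * F i = 0" by simp
qed


section \<open>Grid sums along the process\<close>

definition cutoff :: "real \<Rightarrow> 'a::real_normed_vector \<Rightarrow> real" where
  "cutoff r z = max 0 (min 1 (r + 1 - norm z))"

lemma cutoff_bounds: "0 \<le> cutoff r z" "cutoff r z \<le> 1"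
  by (auto simp: cutoff_def)

lemma cutoff_continuous: "continuous_on A (cutoff r)"
  unfolding cutoff_def by (intro continuous_intros)

lemma cutoff_support: "cutoff r z \<noteq> 0 \<Longrightarrow> z \<in> cball 0 (r + 1)"
  by (auto simp: cutoff_def max_def split: if_splits)

lemma cutoff_one: "norm z \<le> r \<Longrightarrow> cutoff r z = 1"
  by (auto simp: cutoff_def)

context hopping_process_model
begin

text \<open>A test observable of the history at time \<open>s\<close>: exactly \<open>k\<close> jumps so far, with initial point and jump times in
\<open>C\<close>, and the phase-space point cut off to a ball.\<close>

definition obs :: "nat \<Rightarrow> (((real^'m) \<times> (real^'m)) \<times> (nat \<Rightarrow> real)) set \<Rightarrow> real \<Rightarrow> real \<Rightarrow> 'w \<Rightarrow> real" where
  "obs k C r s \<omega> = of_bool (reach (\<lambda>q. l q \<omega>) k s \<and> \<not> reach (\<lambda>q. l q \<omega>) (Suc k) s)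
     * indicator C (hop_history s k \<omega>) * cutoff r (Qp s \<omega>, Pp s \<omega>)"

lemma obs_bounds: "0 \<le> obs k C r s \<omega>" "obs k C r s \<omega> \<le> 1"
  using cutoff_bounds[of r "(Qp s \<omega>, Pp s \<omega>)"] by (auto simp: obs_def indicator_def)

lemma obs_support: "obs k C r s \<omega> \<noteq> 0 \<Longrightarrow> (Qp s \<omega>, Pp s \<omega>) \<in> cball 0 (r + 1)"
  by (rule cutoff_support) (auto simp: obs_def)

lemma obs_history:
  assumes C: "C \<in> sets (path_space k)" and s: "0 \<le> s"
  shows "obs k C r s \<in> borel_measurable (history s)"
proof -
  have "{\<omega> \<in> space (history s). reach (\<lambda>q. l q \<omega>) i s} \<in> sets (history s)" for i
    using reach_history[of s s i] s by simp
  then have [measurable]: "Measurable.pred (history s) (\<lambda>\<omega>. reach (\<lambda>q. l q \<omega>) i s)" for i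
    by (simp add: pred_def)
  note [measurable] = hop_history_measurable[OF s, of k] C
    borel_measurable_continuous_onI[OF cutoff_continuous]
  have "(\<lambda>\<omega>. cutoff r (Qp s \<omega>, Pp s \<omega>)) \<in> borel_measurable (history s)"
    using s by (intro measurable_compose[OF measurable_position_history(1) borel_measurable_continuous_onI[OF cutoff_continuous]]) auto
  moreover have "(\<lambda>\<omega>. of_bool (reach (\<lambda>q. l q \<omega>) k s \<and> \<not> reach (\<lambda>q. l q \<omega>) (Suc k) s) * indicator C (hop_history s k \<omega>) :: real)
      \<in> borel_measurable (history s)"
    by (simp del: reach.simps) measurable
  ultimately show ?thesis unfolding obs_def[abs_def] by (rule borel_measurable_times[rotated])
qed

lemma obs_good:
  assumes good: "good \<omega>" and s: "s \<in> {0..t}"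
  shows "obs k C r s \<omega> = of_bool (last_hop k \<omega> \<le> s \<and> s < hop_time (Suc k) \<omega>)
     * indicator C (hops k \<omega>) * cutoff r (Qp s \<omega>, Pp s \<omega>)"
proof -
  interpret level_path t "\<lambda>s. l s \<omega>" by (rule good_level_path[OF good])
  have c: "(reach (\<lambda>q. l q \<omega>) k s \<and> \<not> reach (\<lambda>q. l q \<omega>) (Suc k) s) \<longleftrightarrow> count s = k"
    by (auto simp: reach_iff[OF s] simp del: reach.simps)
  have c': "count s = k \<longleftrightarrow> last_hop k \<omega> \<le> s \<and> s < hop_time (Suc k) \<omega>"
    using count_eq_iff[OF s, of k] by (simp add: last_hop_def last_time_def hop_time_eq_tau[OF good])
  have "hop_history s k \<omega> = hops k \<omega>" if "count s = k"
  proof -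
    have "jump_time t (\<lambda>r. l r \<omega>) s i = jump_time t (\<lambda>r. l r \<omega>) t i" if "i \<in> {1..k}" for i
      using that jump_time_tau[OF s, of i] tau_le_iff[OF s, of i] \<open>count s = k\<close> by (auto simp: tau_def)
    then show ?thesis by (auto simp: hop_history_def intro!: restrict_ext)
  qed
  then show ?thesis unfolding obs_def c c' by auto
qed

lemma good_path_continuous:
  assumes "good \<omega>" "continuous_on UNIV f" "\<And>n. p n \<in> {0..t}" "p \<longlonglongrightarrow> s" "s \<in> {0..t}"
  shows "(\<lambda>n. f (Qp (p n) \<omega>, Pp (p n) \<omega>)) \<longlonglongrightarrow> f (Qp s \<omega>, Pp s \<omega>)"
proof -
  have "continuous_on {0..t} (\<lambda>s. (Qp s \<omega>, Pp s \<omega>))"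
    using assms(1) unfolding good_def hopping_path_def by (intro continuous_intros) auto
  then have "continuous_on {0..t} (\<lambda>s. f (Qp s \<omega>, Pp s \<omega>))"
    by (rule continuous_on_compose2[OF assms(2)]) auto
  from continuous_on_tendsto_compose[OF this assms(4,5)] show ?thesis
    using assms(3) by (simp only: eventually_True)
qed

lemma good_level:
  assumes good: "good \<omega>" and s: "s \<in> {0..t}" and k: "last_hop k \<omega> \<le> s" "s < hop_time (Suc k) \<omega>"
  shows "l s \<omega> = k mod 2"
proof -
  interpret level_path t "\<lambda>s. l s \<omega>" by (rule good_level_path[OF good])
  have "last_time k tau = last_hop k \<omega>"
    by (simp add: last_hop_def last_time_def hop_time_eq_tau[OF good])
  then have "count s = k"
    using count_eq_iff[OF s, of k] k by (simp add: hop_time_eq_tau[OF good])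
  then show ?thesis using parity[OF s] by simp
qed

lemma flip_bracket:
  assumes good: "good \<omega>" and s: "0 \<le> s" "s < u" "u \<le> t"
    and k: "last_hop k \<omega> \<le> s" "s < hop_time (Suc k) \<omega>" and flip: "l u \<omega> \<noteq> l s \<omega>"
  shows "hop_time (Suc k) \<omega> \<le> u"
proof (rule ccontr)
  assume "\<not> hop_time (Suc k) \<omega> \<le> u"
  then have "l u \<omega> = k mod 2" "l s \<omega> = k mod 2"
    using s k by (auto intro!: good_level[OF good])
  then show False using flip by simp
qed

text \<open>Of all grid intervals only the one that contains the jump number \<open>Suc k\<close> contributes, since the observable demands exactly
\<open>k\<close> jumps at the left end and the level changes across the interval.\<close>

lemma grid_sum_good:
  fixes k :: nat and C :: "(((real^'m) \<times> (real^'m)) \<times> (nat \<Rightarrow> real)) set" and r :: real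
  assumes good: "good \<omega>" and h: "0 < h" and a: "0 \<le> a" "a + real N * h \<le> t"
  defines "\<tau> \<equiv> hop_time (Suc k) \<omega>" and "f \<equiv> \<lambda>i. obs k C r (a + real i * h) \<omega> * of_bool (l (a + real i * h + h) \<omega> \<noteq> l (a + real i * h) \<omega>)"
  shows "(\<Sum>i<N. f i) = (if a < \<tau> \<and> \<tau> \<le> a + real N * h then f (cell a h \<tau>) else 0)"
proof -
  have bracket: "a < \<tau> \<and> \<tau> \<le> a + real N * h \<and> i = cell a h \<tau>" if i: "i < N" "f i \<noteq> 0" for i
  proof -
    let ?p = "a + real i * h"
    have "real (Suc i) * h \<le> real N * h" using i h by (intro mult_right_mono) auto
    then have up: "?p + h \<le> a + real N * h" by (simp add: algebra_simps)
    have p: "0 \<le> ?p" "?p < ?p + h" "?p + h \<le> t" using a h up by auto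
    have ne: "obs k C r ?p \<omega> \<noteq> 0" "l (?p + h) \<omega> \<noteq> l ?p \<omega>" using i(2) by (auto simp: f_def)
    have k: "last_hop k \<omega> \<le> ?p" "?p < hop_time (Suc k) \<omega>"
      using ne(1) p by (auto simp: obs_good[OF good])
    have le: "\<tau> \<le> ?p + h" unfolding \<tau>_def by (rule flip_bracket[OF good p k ne(2)])
    have "0 \<le> real i * h" using h by simp
    then have "a < \<tau>" using k(2) by (simp add: \<tau>_def)
    moreover have "?p < \<tau>" using k(2) by (simp add: \<tau>_def)
    ultimately show ?thesis using cell_iff[OF h, of a \<tau> i] le up by (auto simp: algebra_simps)
  qed
  show ?thesis
  proof (cases "a < \<tau> \<and> \<tau> \<le> a + real N * h")
    case True
    have "(\<Sum>i<N. f i) = (\<Sum>i<N. if i = cell a h \<tau> then f i else 0)"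
      using bracket by (intro sum.cong) auto
    also have "\<dots> = f (cell a h \<tau>)" using cell_bounds(3)[OF h] True by simp
    finally show ?thesis using True by simp
  next
    case False
    then have "f i = 0" if "i < N" for i using bracket[OF that] by blast
    then have "(\<Sum>i<N. f i) = 0" by (intro sum.neutral) auto
    then show ?thesis by (simp only: False if_False)
  qed
qed

definition grid_point :: "real \<Rightarrow> real \<Rightarrow> real \<Rightarrow> nat \<Rightarrow> real" where
  "grid_point a b s n = a + real (cell a ((b - a) / real (Suc n)) s) * ((b - a) / real (Suc n))"

lemma grid_point_bounds:
  assumes "a < b" "a < s"
  shows "a \<le> grid_point a b s n" "grid_point a b s n < s" "s \<le> grid_point a b s n + (b - a) / real (Suc n)"
  using cell_bounds(1,2)[of "(b - a) / real (Suc n)" a s] assms by (auto simp: grid_point_def)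

lemma step_tendsto: "(\<lambda>n. (b - a) / real (Suc n)) \<longlonglongrightarrow> (0 :: real)"
  using tendsto_mult[OF tendsto_const[of "b - a"] LIMSEQ_Suc[OF lim_1_over_n]] by simp

lemma grid_point_tendsto:
  assumes "a < b" "a < s"
  shows "grid_point a b s \<longlonglongrightarrow> s"
proof (rule real_tendsto_sandwich)
  show "\<forall>\<^sub>F n in sequentially. s - (b - a) / real (Suc n) \<le> grid_point a b s n"
    using grid_point_bounds(3)[OF assms] by (simp add: algebra_simps)
  show "\<forall>\<^sub>F n in sequentially. grid_point a b s n \<le> s"
    using grid_point_bounds(2)[OF assms] by (simp add: less_imp_le)
  show "(\<lambda>n. s - (b - a) / real (Suc n)) \<longlonglongrightarrow> s"
    using tendsto_diff[OF tendsto_const step_tendsto, of s b a] by simp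
qed simp

text \<open>The grid points approach \<open>s\<close> strictly from below, hence the condition on the jumps at the limit time \<open>s\<close> is
open on the left and closed on the right.\<close>

lemma obs_grid_tendsto:
  assumes good: "good \<omega>" and ab: "0 \<le> a" "a < b" "b \<le> t" and s: "a < s" "s \<le> b" and f: "continuous_on UNIV f"
  shows "(\<lambda>n. obs k C r (grid_point a b s n) \<omega> * f (Qp (grid_point a b s n) \<omega>, Pp (grid_point a b s n) \<omega>))
    \<longlonglongrightarrow> of_bool (last_hop k \<omega> < s \<and> s \<le> hop_time (Suc k) \<omega>) * indicator C (hops k \<omega>)
        * cutoff r (Qp s \<omega>, Pp s \<omega>) * f (Qp s \<omega>, Pp s \<omega>)"
proof -
  let ?p = "grid_point a b s" and ?\<tau> = "hop_time (Suc k) \<omega>" and ?\<sigma> = "last_hop k \<omega>"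
  have p: "?p n \<in> {0..t}" "?p n < s" for n
    using grid_point_bounds[OF ab(2) s(1), of n] ab s by auto
  note lim = grid_point_tendsto[OF ab(2) s(1)]
  have "(\<lambda>n. cutoff r (Qp (?p n) \<omega>, Pp (?p n) \<omega>) * f (Qp (?p n) \<omega>, Pp (?p n) \<omega>))
      \<longlonglongrightarrow> cutoff r (Qp s \<omega>, Pp s \<omega>) * f (Qp s \<omega>, Pp s \<omega>)"
    using good_path_continuous[OF good _ p(1) lim, of "\<lambda>z. cutoff r z * f z"] ab s f
    by (auto intro!: continuous_intros cutoff_continuous)
  then have "(\<lambda>n. of_bool (?\<sigma> < s \<and> s \<le> ?\<tau>) * indicator C (hops k \<omega>)
      * (cutoff r (Qp (?p n) \<omega>, Pp (?p n) \<omega>) * f (Qp (?p n) \<omega>, Pp (?p n) \<omega>)))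
      \<longlonglongrightarrow> of_bool (?\<sigma> < s \<and> s \<le> ?\<tau>) * indicator C (hops k \<omega>)
      * (cutoff r (Qp s \<omega>, Pp s \<omega>) * f (Qp s \<omega>, Pp s \<omega>))"
    by (rule tendsto_mult[OF tendsto_const])
  moreover have "\<forall>\<^sub>F n in sequentially. of_bool (?\<sigma> \<le> ?p n \<and> ?p n < ?\<tau>) = (of_bool (?\<sigma> < s \<and> s \<le> ?\<tau>) :: real)"
  proof -
    consider "s \<le> ?\<sigma>" | "?\<tau> < s" | "?\<sigma> < s" "s \<le> ?\<tau>" by linarith
    then show ?thesis
    proof cases
      case 1
      then have "\<not> ?\<sigma> \<le> ?p n" for n using p(2)[of n] by simp
      then show ?thesis using 1 by simp
    next
      case 2
      from order_tendstoD(1)[OF lim 2] show ?thesis by eventually_elim (use 2 in auto)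
    next
      case 3
      from order_tendstoD(1)[OF lim 3(1)] show ?thesis
        by eventually_elim (use 3 p(2) in \<open>auto intro: less_le_trans\<close>)
    qed
  qed
  then have "\<forall>\<^sub>F n in sequentially.
      of_bool (?\<sigma> < s \<and> s \<le> ?\<tau>) * indicator C (hops k \<omega>)
        * (cutoff r (Qp (?p n) \<omega>, Pp (?p n) \<omega>) * f (Qp (?p n) \<omega>, Pp (?p n) \<omega>))
      = obs k C r (?p n) \<omega> * f (Qp (?p n) \<omega>, Pp (?p n) \<omega>)"
    by eventually_elim (simp add: obs_good[OF good p(1)])
  ultimately show ?thesis
    by (simp only: mult.assoc) (rule Lim_transform_eventually)
qed

lemma last_hop_less_hop_time:
  assumes good: "good \<omega>" and le: "hop_time (Suc k) \<omega> \<le> t"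
  shows "last_hop k \<omega> < hop_time (Suc k) \<omega>"
proof (cases "last_hop k \<omega> \<le> t")
  case True
  then show ?thesis by (rule last_hop_less[OF good])
next
  case False
  then have "hop_time k \<omega> > t \<and> k > 0" using t_nonneg by (auto simp: last_hop_def split: if_splits)
  then show ?thesis
    using level_path.tau_cases[OF good_level_path[OF good], of k] level_path.tau_cases[OF good_level_path[OF good], of "Suc k"] le
    by (auto simp: hop_time_eq_tau[OF good])
qed

text \<open>On a fine grid no interval contains two jumps, so that the next jump is not masked by the one after it.\<close>

lemma grid_sum_tendsto:
  fixes k :: nat
  assumes good: "good \<omega>" and ab: "0 \<le> a" "a < b" "b \<le> t"
  defines "h \<equiv> \<lambda>n. (b - a) / real (Suc n)" and "\<tau> \<equiv> hop_time (Suc k) \<omega>"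
  shows "(\<lambda>n. \<Sum>i<Suc n. obs k C r (a + real i * h n) \<omega> * of_bool (l (a + real i * h n + h n) \<omega> \<noteq> l (a + real i * h n) \<omega>))
    \<longlonglongrightarrow> of_bool (a < \<tau> \<and> \<tau> \<le> b) * indicator C (hops k \<omega>) * cutoff r (Qp \<tau> \<omega>, Pp \<tau> \<omega>)"
proof -
  have h: "0 < h n" "a + real (Suc n) * h n = b" for n using ab by (auto simp: h_def)
  have sum: "(\<Sum>i<Suc n. obs k C r (a + real i * h n) \<omega> * of_bool (l (a + real i * h n + h n) \<omega> \<noteq> l (a + real i * h n) \<omega>))
    = (if a < \<tau> \<and> \<tau> \<le> b then obs k C r (grid_point a b \<tau> n) \<omega>
        * of_bool (l (grid_point a b \<tau> n + h n) \<omega> \<noteq> l (grid_point a b \<tau> n) \<omega>) else 0)" for n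
  proof -
    have le: "a + real (Suc n) * h n \<le> t" unfolding h(2) by (rule ab(3))
    have gp: "grid_point a b \<tau> n = a + real (cell a (h n) \<tau>) * h n" by (simp add: grid_point_def h_def)
    show ?thesis
      using grid_sum_good[OF good h(1)[of n] ab(1) le, of k C r] unfolding h(2) gp[unfolded \<tau>_def] \<tau>_def .
  qed
  show ?thesis
  proof (cases "a < \<tau> \<and> \<tau> \<le> b")
    case False
    then show ?thesis
      unfolding sum by (simp only: False if_False of_bool_eq mult_zero_left tendsto_const)
  next
    case True
    let ?p = "grid_point a b \<tau>"
    have p: "?p n \<in> {0..t}" "?p n < \<tau>" "\<tau> \<le> ?p n + h n" "a \<le> ?p n" for n
      using grid_point_bounds[OF ab(2), of \<tau> n] ab True by (auto simp: h_def)
    have ph: "?p n + h n \<le> t" for n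
    proof -
      have "cell a (h n) \<tau> < Suc n" using cell_bounds(3)[OF h(1)[of n], of a \<tau> "Suc n"] True h(2)[of n] by simp
      then have "real (Suc (cell a (h n) \<tau>)) * h n \<le> real (Suc n) * h n" using h(1)[of n] by (intro mult_right_mono) auto
      then have "a + real (cell a (h n) \<tau>) * h n + h n \<le> b" using h(2)[of n] by (simp add: algebra_simps)
      then show ?thesis using ab by (simp add: grid_point_def h_def)
    qed
    have lim: "?p \<longlonglongrightarrow> \<tau>" using grid_point_tendsto[OF ab(2)] True by simp
    have "(\<lambda>n. ?p n + h n) \<longlonglongrightarrow> \<tau> + 0"
      unfolding h_def by (intro tendsto_add lim step_tendsto)
    then have lim2: "(\<lambda>n. ?p n + h n) \<longlonglongrightarrow> \<tau>" by simp
    have \<tau>t: "\<tau> \<le> t" using True ab by simp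
    have next_hop: "\<tau> < hop_time (Suc (Suc k)) \<omega>"
      using last_hop_less[OF good, of "Suc k"] \<tau>t by (simp add: last_hop_def \<tau>_def)
    have last: "last_hop k \<omega> < \<tau>"
      using last_hop_less_hop_time[OF good] \<tau>t by (simp add: \<tau>_def)
    have "(\<lambda>n. obs k C r (?p n) \<omega> * 1) \<longlonglongrightarrow>
        of_bool (last_hop k \<omega> < \<tau> \<and> \<tau> \<le> hop_time (Suc k) \<omega>) * indicator C (hops k \<omega>) * cutoff r (Qp \<tau> \<omega>, Pp \<tau> \<omega>) * 1"
      using True by (intro obs_grid_tendsto[OF good ab, where f = "\<lambda>_. 1"]) auto
    then have "(\<lambda>n. obs k C r (?p n) \<omega>) \<longlonglongrightarrow> of_bool (a < \<tau> \<and> \<tau> \<le> b) * indicator C (hops k \<omega>) * cutoff r (Qp \<tau> \<omega>, Pp \<tau> \<omega>)"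
      using last True by (simp add: \<tau>_def)
    moreover have "\<forall>\<^sub>F n in sequentially. obs k C r (?p n) \<omega>
        = (if a < \<tau> \<and> \<tau> \<le> b then obs k C r (?p n) \<omega> * of_bool (l (?p n + h n) \<omega> \<noteq> l (?p n) \<omega>) else 0)"
      using order_tendstoD(1)[OF lim last] order_tendstoD(2)[OF lim2 next_hop]
    proof eventually_elim
      case (elim n)
      have "l (?p n) \<omega> = k mod 2"
        using elim p(1)[of n] p(2)[of n] by (intro good_level[OF good]) (auto simp: \<tau>_def)
      moreover have "l (?p n + h n) \<omega> = Suc k mod 2"
        using elim p(1)[of n] p(3)[of n] ph[of n] h(1)[of n] by (intro good_level[OF good]) (auto simp: \<tau>_def last_hop_def)
      ultimately have "l (?p n + h n) \<omega> \<noteq> l (?p n) \<omega>" by (simp add: mod_Suc)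
      then show ?case using True by simp
    qed
    ultimately show ?thesis unfolding sum by (rule Lim_transform_eventually)
  qed
qed

section \<open>Intensity of the next jump\<close>

text \<open>The cutoff, evaluated along the deterministic trajectory. In this form it depends on the initial point and the jump times, and
no longer on the path.\<close>

definition cutoff_state :: "real \<Rightarrow> nat \<Rightarrow> (((real^'m) \<times> (real^'m)) \<times> (nat \<Rightarrow> real)) \<times> real \<Rightarrow> real" where
  "cutoff_state r k p = (if p \<in> hop_region t k
     then cutoff r (state (times k (snd (fst p))) (fst (fst p)) (snd p)) else 0)"

lemma cutoff_state_bounds: "0 \<le> cutoff_state r k p" "cutoff_state r k p \<le> 1"
  by (auto simp: cutoff_state_def cutoff_bounds)

lemma cutoff_state_measurable: "cutoff_state r k \<in> borel_measurable (path_space k \<Otimes>\<^sub>M borel)"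
proof -
  from measurable_compose[OF measurable_state borel_measurable_continuous_onI[OF cutoff_continuous]]
  have "(\<lambda>x. cutoff r (state (times k (snd (fst x))) (fst (fst x)) (snd x))) \<in> borel_measurable (region_space t k)" .
  then show ?thesis
    unfolding cutoff_state_def[abs_def] using sets_hop_region[of k t]
    by (subst measurable_If_restrict_space_iff) auto
qed

lemma cutoff_state_measurable' [measurable (raw)]:
  assumes "f \<in> N \<rightarrow>\<^sub>M path_space k" "g \<in> borel_measurable N"
  shows "(\<lambda>y. cutoff_state r k (f y, g y)) \<in> borel_measurable N"
  using measurable_compose[OF measurable_Pair[OF assms] cutoff_state_measurable] by simp

lemma hops_region:
  assumes good: "good \<omega>" and s: "s \<in> {0..t}" "last_hop k \<omega> < s"
  shows "(hops k \<omega>, s) \<in> hop_region t k"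
  using hops_simplex[OF good, of k] s by (auto simp: hop_region_def)

lemma path_at_hops:
  assumes good: "good \<omega>" and s: "s \<in> {0..t}" "last_hop k \<omega> < s" "s \<le> hop_time (Suc k) \<omega>"
  shows "cutoff r (Qp s \<omega>, Pp s \<omega>) = cutoff_state r k (hops k \<omega>, s)"
    and "\<delta> / \<epsilon> * cmod (V 0 1 (Qp s \<omega>)) = intensity k (hops k \<omega>) s"
proof -
  have "last_hop k \<omega> < t" using s by auto
  then have st: "(Qp s \<omega>, Pp s \<omega>) = state (times k (snd (hops k \<omega>))) (fst (hops k \<omega>)) s"
    using s by (intro state_hops[OF good]) auto
  show "cutoff r (Qp s \<omega>, Pp s \<omega>) = cutoff_state r k (hops k \<omega>, s)"
    unfolding cutoff_state_def if_P[OF hops_region[OF good s(1,2)]] by (simp only: fst_conv snd_conv st)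
  show "\<delta> / \<epsilon> * cmod (V 0 1 (Qp s \<omega>)) = intensity k (hops k \<omega>) s"
    unfolding intensity_def if_P[OF hops_region[OF good s(1,2)]] st[symmetric] by simp
qed

lemma level_neq_measurable:
  assumes "s \<in> {0..t}" "u \<in> {0..t}"
  shows "Measurable.pred M (\<lambda>\<omega>. l u \<omega> \<noteq> l s \<omega>)"
proof -
  have [measurable]: "l s \<in> M \<rightarrow>\<^sub>M count_space UNIV" "l u \<in> M \<rightarrow>\<^sub>M count_space UNIV"
    using process assms by (auto simp: hopping_process_def)
  have "Measurable.pred M (\<lambda>\<omega>. \<exists>a. l u \<omega> = a \<and> l s \<omega> \<noteq> a)"
    by measurable
  then show ?thesis
    by (rule arg_cong[where f = "Measurable.pred M", THEN iffD1, rotated]) auto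
qed

lemma obs_measurable:
  assumes "C \<in> sets (path_space k)" "s \<in> {0..t}"
  shows "obs k C r s \<in> borel_measurable M"
  using assms by (intro measurable_history_M[OF _ obs_history]) auto

text \<open>Both sides are limits over the uniform grids on the interval from \<open>a\<close> to \<open>b\<close>. The left side is the limit of the probabilities of
level changes across grid intervals, the right side the limit of the Riemann sums of the expected
intensity. By \<open>one_step\<close> they differ by at most a number of order \<open>1 / h\<close> of errors \<open>o(h)\<close>.\<close>

lemma jump_intensity_cutoff:
  assumes C: "C \<in> sets (path_space k)" and ab: "0 \<le> a" "a < b" "b \<le> t"
  shows "(LINT \<omega>|M. of_bool (a < hop_time (Suc k) \<omega> \<and> hop_time (Suc k) \<omega> \<le> b) * indicator C (hops k \<omega>)
      * cutoff_state r k (hops k \<omega>, hop_time (Suc k) \<omega>))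
    = (LINT s|lborel. indicator {a<..b} s * (LINT \<omega>|M. of_bool (last_hop k \<omega> < s \<and> s \<le> hop_time (Suc k) \<omega>)
        * indicator C (hops k \<omega>) * cutoff_state r k (hops k \<omega>, s) * intensity k (hops k \<omega>) s))"
    (is "?W = (LINT s|lborel. indicator {a<..b} s * ?G s)")
proof (rule hop_intensity_bound[OF compact_cball[of "0 :: (real^'m) \<times> (real^'m)" "r + 1"]], rule one_step[OF compact_cball[of 0 "r + 1"]])
  fix B :: real and R :: "real \<Rightarrow> real"
  assume B: "0 \<le> B" "\<And>z :: (real^'m) \<times> (real^'m). z \<in> cball 0 (r + 1) \<Longrightarrow> \<delta> / \<epsilon> * cmod (V 0 1 (fst z)) \<le> B"
    and R: "R \<in> o[at_right 0](\<lambda>h. h)"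
    "\<And>s h Y. 0 \<le> s \<Longrightarrow> 0 < h \<Longrightarrow> s + h \<le> t \<Longrightarrow> Y \<in> borel_measurable (history s) \<Longrightarrow>
      (\<And>\<omega>. 0 \<le> Y \<omega> \<and> Y \<omega> \<le> 1) \<Longrightarrow> (\<And>\<omega>. Y \<omega> \<noteq> 0 \<Longrightarrow> (Qp s \<omega>, Pp s \<omega>) \<in> cball 0 (r + 1)) \<Longrightarrow>
      \<bar>(LINT \<omega>|M. Y \<omega> * of_bool (l (s + h) \<omega> \<noteq> l s \<omega>)) - h * (LINT \<omega>|M. Y \<omega> * (\<delta> / \<epsilon> * cmod (V 0 1 (Qp s \<omega>))))\<bar> \<le> 2 * \<bar>R h\<bar>"
  let ?v = "\<lambda>s \<omega>. \<delta> / \<epsilon> * cmod (V 0 1 (Qp s \<omega>))" and ?h = "\<lambda>n. (b - a) / real (Suc n)"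
  let ?p = "\<lambda>n i. a + real i * ?h n"
  let ?\<tau> = "hop_time (Suc k)"
  let ?f = "\<lambda>n i \<omega>. obs k C r (?p n i) \<omega> * of_bool (l (?p n i + ?h n) \<omega> \<noteq> l (?p n i) \<omega>)"
  define E where "E s = (LINT \<omega>|M. obs k C r s \<omega> * ?v s \<omega>)" for s
  have h: "0 < ?h n" "a + real (Suc n) * ?h n = b" for n using ab by auto
  have p: "?p n i \<in> {0..t}" "?p n i + ?h n \<in> {0..t}" if "i < Suc n" for n i
  proof -
    have "real (Suc i) * ?h n \<le> real (Suc n) * ?h n" using that h(1)[of n] by (intro mult_right_mono) auto
    then have "?p n i + ?h n \<le> b" using h(2)[of n] by (simp only: of_nat_Suc distrib_right mult_1_left)
    moreover have "0 \<le> real i * ?h n" using h(1)[of n] by (intro mult_nonneg_nonneg) auto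
    ultimately show "?p n i \<in> {0..t}" "?p n i + ?h n \<in> {0..t}" using ab h(1)[of n] unfolding atLeastAtMost_iff by linarith+
  qed
  have [measurable]: "V 0 1 \<in> borel_measurable borel" by (rule borel_measurable_continuous_onI[OF V01])
  have Qm: "Qp s \<in> borel_measurable M" if "s \<in> {0..t}" for s using process that by (auto simp: hopping_process_def)
  have ov_bound: "\<bar>obs k C r s \<omega> * ?v s \<omega>\<bar> \<le> B" for s \<omega>
  proof (cases "obs k C r s \<omega> = 0")
    case False
    have v: "?v s \<omega> \<le> B" "0 \<le> ?v s \<omega>" using B(2)[OF obs_support[OF False]] eps_pos delta_pos by auto
    have "obs k C r s \<omega> * ?v s \<omega> \<le> 1 * B"
      by (rule mult_mono[OF obs_bounds(2) v(1) zero_le_one v(2)])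
    moreover have "0 \<le> obs k C r s \<omega> * ?v s \<omega>"
      by (rule mult_nonneg_nonneg[OF obs_bounds(1) v(2)])
    ultimately show ?thesis by (simp only: abs_of_nonneg mult_1_left)
  qed (simp add: B)
  have ov_meas: "(\<lambda>\<omega>. obs k C r s \<omega> * ?v s \<omega>) \<in> borel_measurable M" if "s \<in> {0..t}" for s
    using obs_measurable[OF C that, of r] Qm[OF that] by measurable
  have E_bound: "\<bar>E s\<bar> \<le> B" if "s \<in> {0..t}" for s
  proof -
    have "\<bar>E s\<bar> \<le> (LINT \<omega>|M. \<bar>obs k C r s \<omega> * ?v s \<omega>\<bar>)" unfolding E_def by (rule integral_abs_bound)
    also have "\<dots> \<le> (LINT \<omega>|M. B)"
    proof (rule integral_mono)
      show "integrable M (\<lambda>\<omega>. \<bar>obs k C r s \<omega> * ?v s \<omega>\<bar>)"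
        by (rule integrable_abs, rule integrable_const_bound[OF AE_I2 ov_meas[OF that]], unfold real_norm_def, rule ov_bound)
      show "\<bar>obs k C r s \<omega> * ?v s \<omega>\<bar> \<le> B" for \<omega> by (rule ov_bound)
    qed simp
    finally show ?thesis by (simp add: prob_space)
  qed
  have f_meas: "?f n i \<in> borel_measurable M" if "i < Suc n" for n i
    using obs_measurable[OF C p(1)[OF that], of r] level_neq_measurable[OF p[OF that]] by measurable

  \<comment> \<open>The grid sums are bounded by one, as they have at most one nonzero summand.\<close>
  have lhs: "(\<lambda>n. LINT \<omega>|M. (\<Sum>i<Suc n. ?f n i \<omega>)) \<longlonglongrightarrow> ?W"
  proof (rule integral_dominated_convergence[where w = "\<lambda>_. 1"])
    show "(\<lambda>\<omega>. of_bool (a < ?\<tau> \<omega> \<and> ?\<tau> \<omega> \<le> b) * indicator C (hops k \<omega>) * cutoff_state r k (hops k \<omega>, ?\<tau> \<omega>)) \<in> borel_measurable M"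
      using C by measurable
    show "(\<lambda>\<omega>. \<Sum>i<Suc n. ?f n i \<omega>) \<in> borel_measurable M" for n
      using f_meas by (intro borel_measurable_sum) auto
    show "AE \<omega> in M. (\<lambda>n. \<Sum>i<Suc n. ?f n i \<omega>) \<longlonglongrightarrow>
        of_bool (a < ?\<tau> \<omega> \<and> ?\<tau> \<omega> \<le> b) * indicator C (hops k \<omega>) * cutoff_state r k (hops k \<omega>, ?\<tau> \<omega>)"
      using AE_good
    proof eventually_elim
      case (elim \<omega>)
      have "of_bool (a < ?\<tau> \<omega> \<and> ?\<tau> \<omega> \<le> b) * indicator C (hops k \<omega>) * cutoff r (Qp (?\<tau> \<omega>) \<omega>, Pp (?\<tau> \<omega>) \<omega>)
          = of_bool (a < ?\<tau> \<omega> \<and> ?\<tau> \<omega> \<le> b) * indicator C (hops k \<omega>) * cutoff_state r k (hops k \<omega>, ?\<tau> \<omega>)"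
      proof (cases "a < ?\<tau> \<omega> \<and> ?\<tau> \<omega> \<le> b")
        case True
        then have "cutoff r (Qp (?\<tau> \<omega>) \<omega>, Pp (?\<tau> \<omega>) \<omega>) = cutoff_state r k (hops k \<omega>, ?\<tau> \<omega>)"
          using ab last_hop_less_hop_time[OF elim, of k] by (intro path_at_hops[OF elim]) auto
        then show ?thesis by (simp only:)
      qed simp
      with grid_sum_tendsto[OF elim ab, of k C r] show ?case by (simp only:)
    qed
    show "AE \<omega> in M. norm (\<Sum>i<Suc n. ?f n i \<omega>) \<le> 1" for n
      using AE_good
    proof eventually_elim
      case (elim \<omega>)
      have "a + real (Suc n) * ?h n \<le> t" unfolding h(2) by (rule ab(3))
      note sum = grid_sum_good[OF elim h(1)[of n] ab(1) this, of k C r]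
      have single: "norm (if P then x else 0) \<le> 1" if "norm x \<le> 1" for P and x :: real using that by simp
      have "norm (?f n j \<omega>) \<le> 1" for j using obs_bounds[of k C r "?p n j" \<omega>] by auto
      then show ?case unfolding sum by (rule single)
    qed
  qed simp

  \<comment> \<open>The Riemann sum is the integral of a step function, whose value at \<open>s\<close> is the expectation at the grid point to the left of \<open>s\<close>.\<close>
  have step_eq: "(\<Sum>i<Suc n. indicator {?p n i<..a + real (Suc i) * ?h n} s * E (?p n i)) = indicator {a<..b} s * E (grid_point a b s n)" for n s
  proof (cases "s \<in> {a<..b}")
    case True
    then have "a < s" "s \<le> a + real (Suc n) * ?h n" unfolding h(2) by auto
    from step_function_eq[OF h(1) this, of "\<lambda>i. E (?p n i)"] True show ?thesis by (simp add: grid_point_def)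
  next
    case False
    then have "\<not> (a < s \<and> s \<le> a + real (Suc n) * ?h n)" unfolding h(2) by auto
    from step_function_outside[OF h(1) this, of "\<lambda>i. E (?p n i)"] False show ?thesis by simp
  qed
  have step_meas: "(\<lambda>s. indicator {a<..b} s * E (grid_point a b s n)) \<in> borel_measurable lborel" for n
    unfolding step_eq[symmetric] by measurable
  have step_lim: "(\<lambda>n. indicator {a<..b} s * E (grid_point a b s n)) \<longlonglongrightarrow> indicator {a<..b} s * ?G s" for s
  proof (cases "s \<in> {a<..b}")
    case True
    then have s: "a < s" "s \<le> b" "s \<in> {0..t}" using ab by auto
    have gp: "grid_point a b s n \<in> {0..t}" for n
      using grid_point_bounds(1,2)[OF ab(2) s(1), of n] ab s by auto
    have "(\<lambda>n. E (grid_point a b s n)) \<longlonglongrightarrow> ?G s"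
      unfolding E_def
    proof (rule integral_dominated_convergence[where w = "\<lambda>_. B"])
      show "(\<lambda>\<omega>. of_bool (last_hop k \<omega> < s \<and> s \<le> ?\<tau> \<omega>) * indicator C (hops k \<omega>) * cutoff_state r k (hops k \<omega>, s)
          * intensity k (hops k \<omega>) s) \<in> borel_measurable M"
        using C by measurable
      show "(\<lambda>\<omega>. obs k C r (grid_point a b s n) \<omega> * ?v (grid_point a b s n) \<omega>) \<in> borel_measurable M" for n
        by (rule ov_meas[OF gp])
      show "AE \<omega> in M. norm (obs k C r (grid_point a b s n) \<omega> * ?v (grid_point a b s n) \<omega>) \<le> B" for n
        unfolding real_norm_def by (rule AE_I2) (rule ov_bound)
      show "AE \<omega> in M. (\<lambda>n. obs k C r (grid_point a b s n) \<omega> * ?v (grid_point a b s n) \<omega>) \<longlonglongrightarrow>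
          of_bool (last_hop k \<omega> < s \<and> s \<le> ?\<tau> \<omega>) * indicator C (hops k \<omega>) * cutoff_state r k (hops k \<omega>, s) * intensity k (hops k \<omega>) s"
        using AE_good
      proof eventually_elim
        case (elim \<omega>)
        have "continuous_on UNIV (\<lambda>z. \<delta> / \<epsilon> * cmod (V 0 1 (fst z)))"
          by (intro continuous_intros continuous_on_compose2[OF V01]) auto
        from obs_grid_tendsto[OF elim ab s(1,2) this, of k C r]
        have "(\<lambda>n. obs k C r (grid_point a b s n) \<omega> * ?v (grid_point a b s n) \<omega>) \<longlonglongrightarrow>
            of_bool (last_hop k \<omega> < s \<and> s \<le> ?\<tau> \<omega>) * indicator C (hops k \<omega>) * cutoff r (Qp s \<omega>, Pp s \<omega>) * ?v s \<omega>"
          by (simp only: fst_conv)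
        moreover have "of_bool (last_hop k \<omega> < s \<and> s \<le> ?\<tau> \<omega>) * indicator C (hops k \<omega>) * cutoff r (Qp s \<omega>, Pp s \<omega>) * ?v s \<omega>
            = of_bool (last_hop k \<omega> < s \<and> s \<le> ?\<tau> \<omega>) * indicator C (hops k \<omega>) * cutoff_state r k (hops k \<omega>, s) * intensity k (hops k \<omega>) s"
        proof (cases "last_hop k \<omega> < s \<and> s \<le> ?\<tau> \<omega>")
          case True
          then show ?thesis using path_at_hops[OF elim s(3), of k] by (simp only:)
        next
          case False
          then show ?thesis by (simp only: of_bool_eq mult_zero_left)
        qed
        ultimately show ?case by (simp only:)
      qed
    qed simp
    then show ?thesis by (rule tendsto_mult[OF tendsto_const])
  qed simp
  have rhs: "(\<lambda>n. LINT s|lborel. indicator {a<..b} s * E (grid_point a b s n)) \<longlonglongrightarrow> (LINT s|lborel. indicator {a<..b} s * ?G s)"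
  proof (rule integral_dominated_convergence[where w = "\<lambda>s. indicator {a<..b} s * B"])
    show "(\<lambda>s. indicator {a<..b} s * ?G s) \<in> borel_measurable lborel"
      by (rule borel_measurable_LIMSEQ_real[OF step_lim step_meas])
    show "integrable lborel (\<lambda>s. indicator {a<..b} s * B)"
      using ab by (intro integrable_mult_left integrable_real_indicator) auto
    show "AE s in lborel. norm (indicator {a<..b} s * E (grid_point a b s n)) \<le> indicator {a<..b} s * B" for n
    proof (rule AE_I2)
      fix s
      show "norm (indicator {a<..b} s * E (grid_point a b s n)) \<le> indicator {a<..b} s * B"
      proof (cases "s \<in> {a<..b}")
        case True
        then have "grid_point a b s n \<in> {0..t}" using grid_point_bounds(1,2)[OF ab(2), of s n] ab by auto
        from E_bound[OF this] True show ?thesis by simp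
      qed simp
    qed
  qed (use step_lim step_meas in auto)

  \<comment> \<open>There are \<open>Suc n\<close> errors of size \<open>R h\<close> with \<open>h = (b - a) / Suc n\<close>.\<close>
  have diff: "\<bar>(LINT \<omega>|M. (\<Sum>i<Suc n. ?f n i \<omega>)) - (LINT s|lborel. indicator {a<..b} s * E (grid_point a b s n))\<bar>
      \<le> 2 * (b - a) * \<bar>R (?h n) / ?h n\<bar>" for n
  proof -
    have f_int: "integrable M (?f n i)" if "i < Suc n" for i
      using f_meas[OF that] obs_bounds[of k C r "?p n i"] by (intro integrable_const_bound[of _ 1]) auto
    have 1: "(LINT \<omega>|M. (\<Sum>i<Suc n. ?f n i \<omega>)) = (\<Sum>i<Suc n. (LINT \<omega>|M. ?f n i \<omega>))"
      using f_int by (intro Bochner_Integration.integral_sum) auto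
    have 2: "(LINT s|lborel. indicator {a<..b} s * E (grid_point a b s n)) = (\<Sum>i<Suc n. ?h n * E (?p n i))"
      unfolding step_eq[symmetric] by (rule sum_step_function_integral[OF h(1)])
    have "\<bar>(LINT \<omega>|M. (\<Sum>i<Suc n. ?f n i \<omega>)) - (LINT s|lborel. indicator {a<..b} s * E (grid_point a b s n))\<bar>
        = \<bar>\<Sum>i<Suc n. (LINT \<omega>|M. ?f n i \<omega>) - ?h n * E (?p n i)\<bar>"
      unfolding 1 2 by (simp only: sum_subtractf)
    also have "\<dots> \<le> (\<Sum>i<Suc n. \<bar>(LINT \<omega>|M. ?f n i \<omega>) - ?h n * E (?p n i)\<bar>)" by (rule sum_abs)
    also have "\<dots> \<le> (\<Sum>i<Suc n. 2 * \<bar>R (?h n)\<bar>)"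
    proof (rule sum_mono)
      fix i assume "i \<in> {..<Suc n}"
      then have i: "i < Suc n" by simp
      have "0 \<le> ?p n i" "?p n i + ?h n \<le> t" using p[OF i] by auto
      then show "\<bar>(LINT \<omega>|M. ?f n i \<omega>) - ?h n * E (?p n i)\<bar> \<le> 2 * \<bar>R (?h n)\<bar>"
        unfolding E_def using obs_bounds obs_support h(1)
        by (intro R(2) obs_history C) blast+
    qed
    also have "\<dots> = real (Suc n) * (2 * \<bar>R (?h n)\<bar>)" by (simp only: sum_constant card_lessThan)
    also have "\<dots> = 2 * (b - a) * \<bar>R (?h n) / ?h n\<bar>"
    proof -
      have rescale: "N * (2 * \<bar>x\<bar>) = 2 * d * \<bar>x / (d / N)\<bar>" if "0 < N" "0 < d" for N d x :: real
        using that by (simp add: abs_divide abs_mult)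
      show ?thesis by (rule rescale) (use ab in simp_all)
    qed
    finally show ?thesis .
  qed
  have norm_diff: "norm ((LINT \<omega>|M. (\<Sum>i<Suc n. ?f n i \<omega>)) - (LINT s|lborel. indicator {a<..b} s * E (grid_point a b s n)))
      \<le> 2 * (b - a) * \<bar>R (?h n) / ?h n\<bar>" for n
    unfolding real_norm_def by (rule diff)
  have "(\<lambda>n. R (?h n) / ?h n) \<longlonglongrightarrow> 0"
  proof -
    have "filterlim ?h (at_right 0) sequentially"
      using step_tendsto[of b a] h(1) by (auto simp: filterlim_at)
    from filterlim_compose[OF smalloD_tendsto[OF R(1)] this] show ?thesis .
  qed
  then have "(\<lambda>n. 2 * (b - a) * \<bar>R (?h n) / ?h n\<bar>) \<longlonglongrightarrow> 0"
    by (intro tendsto_mult_right_zero tendsto_rabs_zero)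
  then have "(\<lambda>n. (LINT \<omega>|M. (\<Sum>i<Suc n. ?f n i \<omega>)) - (LINT s|lborel. indicator {a<..b} s * E (grid_point a b s n))) \<longlonglongrightarrow> 0"
    by (rule Lim_null_comparison[OF always_eventually[OF allI[OF norm_diff]]])
  moreover have "(\<lambda>n. (LINT \<omega>|M. (\<Sum>i<Suc n. ?f n i \<omega>)) - (LINT s|lborel. indicator {a<..b} s * E (grid_point a b s n)))
      \<longlonglongrightarrow> ?W - (LINT s|lborel. indicator {a<..b} s * ?G s)"
    by (intro tendsto_diff lhs rhs)
  ultimately have "?W - (LINT s|lborel. indicator {a<..b} s * ?G s) = 0"
    by (rule LIMSEQ_unique[rotated])
  then show ?thesis by simp
qed

end

text \<open>For a fixed set in the first component, the slices are finite measures on the line, which rays determine; and products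
of measurable sets determine a measure on the product.\<close>

lemma measure_eqI_product_rays:
  fixes \<mu> \<nu> :: "('a \<times> real) measure"
  assumes sets: "sets \<mu> = sets (N \<Otimes>\<^sub>M borel)" "sets \<nu> = sets (N \<Otimes>\<^sub>M borel)"
    and fin: "emeasure \<mu> (space \<mu>) < \<infinity>"
    and eq: "\<And>C x. C \<in> sets N \<Longrightarrow> emeasure \<mu> (C \<times> {x<..}) = emeasure \<nu> (C \<times> {x<..})"
  shows "\<mu> = \<nu>"
proof -
  have snd_meas: "snd \<in> borel_measurable \<eta>" if "sets \<eta> = sets (N \<Otimes>\<^sub>M borel)" for \<eta> :: "('a \<times> real) measure"
    unfolding measurable_cong_sets[OF that refl] by measurable
  have slice: "emeasure (distr (density \<eta> (indicator (C \<times> UNIV))) borel snd) B = emeasure \<eta> (C \<times> B)"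
    if \<eta>: "sets \<eta> = sets (N \<Otimes>\<^sub>M borel)" and C: "C \<in> sets N" and B: "B \<in> sets borel" for \<eta> :: "('a \<times> real) measure" and C B
  proof -
    have sp: "space \<eta> = space N \<times> UNIV" using sets_eq_imp_space_eq[OF \<eta>] by (simp add: space_pair_measure)
    have CU: "C \<times> UNIV \<in> sets \<eta>" "C \<times> B \<in> sets \<eta>" using C B by (auto simp: \<eta>)
    have pre: "snd -` B \<inter> space \<eta> \<in> sets \<eta>" by (rule measurable_sets[OF snd_meas[OF \<eta>] B])
    have "emeasure (distr (density \<eta> (indicator (C \<times> UNIV))) borel snd) B
        = emeasure (density \<eta> (indicator (C \<times> UNIV))) (snd -` B \<inter> space \<eta>)"
      using snd_meas[OF \<eta>] B by (subst emeasure_distr) auto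
    also have "\<dots> = (\<integral>\<^sup>+x. indicator (C \<times> UNIV) x * indicator (snd -` B \<inter> space \<eta>) x \<partial>\<eta>)"
      using CU pre by (intro emeasure_density) auto
    also have "\<dots> = (\<integral>\<^sup>+x. indicator (C \<times> B) x \<partial>\<eta>)"
      by (intro nn_integral_cong) (auto simp: indicator_def)
    also have "\<dots> = emeasure \<eta> (C \<times> B)" using CU by simp
    finally show ?thesis .
  qed
  have rect: "emeasure \<mu> (C \<times> B) = emeasure \<nu> (C \<times> B)" if C: "C \<in> sets N" and B: "B \<in> sets borel" for C B
  proof -
    have "distr (density \<mu> (indicator (C \<times> UNIV))) borel snd = distr (density \<nu> (indicator (C \<times> UNIV))) borel snd"
    proof (rule measure_eqI_lessThan)
      fix x :: real
      have "{x<..} \<in> sets borel" by simp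
      note s = slice[OF sets(1) C this] slice[OF sets(2) C this]
      show "emeasure (distr (density \<mu> (indicator (C \<times> UNIV))) borel snd) {x<..}
          = emeasure (distr (density \<nu> (indicator (C \<times> UNIV))) borel snd) {x<..}"
        unfolding s by (rule eq[OF C])
      have "emeasure \<mu> (C \<times> {x<..}) \<le> emeasure \<mu> (space \<mu>)" by (rule emeasure_space)
      with fin show "emeasure (distr (density \<mu> (indicator (C \<times> UNIV))) borel snd) {x<..} < \<infinity>"
        unfolding s by (rule le_less_trans[rotated])
    qed simp_all
    then show ?thesis using slice[OF sets(1) C B] slice[OF sets(2) C B] by simp
  qed
  have sp: "space \<mu> = space N \<times> UNIV" using sets_eq_imp_space_eq[OF sets(1)] by (simp add: space_pair_measure)
  show ?thesis
  proof (rule measure_eqI_generator_eq[where \<Omega> = "space N \<times> UNIV" and A = "\<lambda>_. space N \<times> UNIV"])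
    show "Int_stable {a \<times> b |a b. a \<in> sets N \<and> b \<in> sets (borel :: real measure)}"
      by (rule Int_stable_pair_measure_generator)
    show "{a \<times> b |a b. a \<in> sets N \<and> b \<in> sets (borel :: real measure)} \<subseteq> Pow (space N \<times> UNIV)"
      using sets.sets_into_space[of _ N] by auto
    show "emeasure \<mu> E = emeasure \<nu> E" if "E \<in> {a \<times> b |a b. a \<in> sets N \<and> b \<in> sets (borel :: real measure)}" for E
      using that rect by auto
    show "sets \<mu> = sigma_sets (space N \<times> UNIV) {a \<times> b |a b. a \<in> sets N \<and> b \<in> sets (borel :: real measure)}"
      "sets \<nu> = sigma_sets (space N \<times> UNIV) {a \<times> b |a b. a \<in> sets N \<and> b \<in> sets (borel :: real measure)}"
      using sets_pair_measure[of N "borel :: real measure"] sets by simp_all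
    have U: "(UNIV :: real set) \<in> sets borel" by simp
    have "space N \<times> (UNIV :: real set) \<in> {a \<times> b |a b. a \<in> sets N \<and> b \<in> sets (borel :: real measure)}"
      by (rule CollectI, rule exI[of _ "space N"], rule exI[of _ UNIV]) (use U in auto)
    then show "range (\<lambda>_::nat. space N \<times> UNIV) \<subseteq> {a \<times> b |a b. a \<in> sets N \<and> b \<in> sets (borel :: real measure)}"
      by auto
    show "emeasure \<mu> (space N \<times> UNIV) \<noteq> \<infinity>" using fin by (simp add: sp[symmetric])
  qed auto
qed

context hopping_process_model
begin

sublocale time: pair_sigma_finite M lborel ..

lemma cutoff_intensity_bound:
  obtains B where "0 \<le> B" "\<And>x s. cutoff_state r k (x, s) * intensity k x s \<le> B"
proof (rule hop_intensity_bound[OF compact_cball[of "0 :: (real^'m) \<times> (real^'m)" "r + 1"]])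
  fix B :: real
  assume B: "0 \<le> B" "\<And>z :: (real^'m) \<times> (real^'m). z \<in> cball 0 (r + 1) \<Longrightarrow> \<delta> / \<epsilon> * cmod (V 0 1 (fst z)) \<le> B"
  have "cutoff_state r k (x, s) * intensity k x s \<le> B" for x s
  proof (cases "cutoff_state r k (x, s) = 0")
    case False
    then have reg: "(x, s) \<in> hop_region t k" by (auto simp: cutoff_state_def split: if_splits)
    have "state (times k (snd x)) (fst x) s \<in> cball 0 (r + 1)"
      using False unfolding cutoff_state_def if_P[OF reg] fst_conv snd_conv by (rule cutoff_support)
    then have "intensity k x s \<le> B" unfolding intensity_def if_P[OF reg] by (rule B(2))
    then have "cutoff_state r k (x, s) * intensity k x s \<le> 1 * B"
      using cutoff_state_bounds intensity_nonneg by (intro mult_mono) auto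
    then show ?thesis by simp
  qed (simp add: B)
  then show ?thesis using B(1) by (intro that)
qed

lemma jump_intensity_cutoff_nn:
  assumes C: "C \<in> sets (path_space k)" and ab: "0 \<le> a" "a < b" "b \<le> t"
  shows "(\<integral>\<^sup>+\<omega>. ennreal (of_bool (a < hop_time (Suc k) \<omega> \<and> hop_time (Suc k) \<omega> \<le> b) * indicator C (hops k \<omega>)
      * cutoff_state r k (hops k \<omega>, hop_time (Suc k) \<omega>)) \<partial>M)
    = (\<integral>\<^sup>+p. ennreal (indicator {a<..b} (snd p) * (of_bool (last_hop k (fst p) < snd p \<and> snd p \<le> hop_time (Suc k) (fst p))
        * indicator C (hops k (fst p)) * cutoff_state r k (hops k (fst p), snd p) * intensity k (hops k (fst p)) (snd p))) \<partial>(M \<Otimes>\<^sub>M lborel))"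
    (is "(\<integral>\<^sup>+\<omega>. ennreal (?W \<omega>) \<partial>M) = (\<integral>\<^sup>+p. ennreal (indicator {a<..b} (snd p) * ?G (fst p) (snd p)) \<partial>_)")
proof (rule cutoff_intensity_bound[of r k])
  fix B assume B: "0 \<le> B" "\<And>x s. cutoff_state r k (x, s) * intensity k x s \<le> B"
  note C[measurable]
  have G0: "0 \<le> ?G \<omega> s" for \<omega> s
    by (auto intro!: mult_nonneg_nonneg cutoff_state_bounds intensity_nonneg)
  have GB: "?G \<omega> s \<le> B" for \<omega> s
    using B(1) B(2)[of "hops k \<omega>" s] by (auto simp: of_bool_def indicator_def)
  have Gm: "(\<lambda>p. ?G (fst p) (snd p)) \<in> borel_measurable (M \<Otimes>\<^sub>M lborel)"
    by measurable
  have Gs: "(\<lambda>\<omega>. ?G \<omega> s) \<in> borel_measurable M" for s by measurable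
  have Gint: "integrable M (\<lambda>\<omega>. ?G \<omega> s)" for s
  proof (rule integrable_const_bound[of _ B])
    show "AE \<omega> in M. norm (?G \<omega> s) \<le> B"
      unfolding real_norm_def abs_of_nonneg[OF G0] by (rule AE_I2) (rule GB)
  qed (rule Gs)
  have inner: "(\<integral>\<^sup>+\<omega>. ennreal (indicator {a<..b} s * ?G \<omega> s) \<partial>M) = ennreal (indicator {a<..b} s * (LINT \<omega>|M. ?G \<omega> s))" for s
  proof -
    have "(\<integral>\<^sup>+\<omega>. ennreal (indicator {a<..b} s * ?G \<omega> s) \<partial>M) = ennreal (LINT \<omega>|M. indicator {a<..b} s * ?G \<omega> s)"
      by (rule nn_integral_eq_integral[OF integrable_mult_right[OF Gint]]) (rule AE_I2, rule mult_nonneg_nonneg[OF _ G0], simp)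
    also have "(LINT \<omega>|M. indicator {a<..b} s * ?G \<omega> s) = indicator {a<..b} s * (LINT \<omega>|M. ?G \<omega> s)" by (rule integral_mult_right_zero)
    finally show ?thesis .
  qed
  have E0: "0 \<le> (LINT \<omega>|M. ?G \<omega> s)" for s by (rule Bochner_Integration.integral_nonneg[OF G0])
  have EB: "(LINT \<omega>|M. ?G \<omega> s) \<le> B" for s
  proof -
    have "(LINT \<omega>|M. ?G \<omega> s) \<le> (LINT \<omega>|M. B)" by (rule integral_mono[OF Gint _ GB]) simp
    then show ?thesis by (simp add: prob_space)
  qed
  have "case_prod (\<lambda>s \<omega>. ?G \<omega> s) \<in> borel_measurable (lborel \<Otimes>\<^sub>M M)"
    using measurable_compose[OF measurable_pair_swap' Gm] by (simp add: case_prod_unfold)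
  then have Em: "(\<lambda>s. LINT \<omega>|M. ?G \<omega> s) \<in> borel_measurable lborel"
    by (rule borel_measurable_lebesgue_integral)
  have int_out: "integrable lborel (\<lambda>s. indicator {a<..b} s * (LINT \<omega>|M. ?G \<omega> s))"
  proof (rule Bochner_Integration.integrable_bound)
    show "integrable lborel (\<lambda>s. indicator {a<..b} s * B)"
      using ab by (intro integrable_mult_left integrable_real_indicator) auto
    show "(\<lambda>s. indicator {a<..b} s * (LINT \<omega>|M. ?G \<omega> s)) \<in> borel_measurable lborel"
      by (rule borel_measurable_times[OF _ Em]) simp
    show "AE s in lborel. norm (indicator {a<..b} s * (LINT \<omega>|M. ?G \<omega> s)) \<le> norm (indicator {a<..b} s * B)"
    proof (rule AE_I2)
      fix s
      have "\<bar>LINT \<omega>|M. ?G \<omega> s\<bar> \<le> \<bar>B\<bar>" using E0[of s] EB[of s] B(1) by linarith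
      then show "norm (indicator {a<..b} s * (LINT \<omega>|M. ?G \<omega> s)) \<le> norm (indicator {a<..b} s * B)"
        unfolding real_norm_def abs_mult by (rule mult_left_mono) simp
    qed
  qed
  have W0: "0 \<le> ?W \<omega>" for \<omega> by (auto intro!: mult_nonneg_nonneg cutoff_state_bounds)
  have Wint: "integrable M ?W"
  proof (rule integrable_const_bound[of _ 1])
    show "AE \<omega> in M. norm (?W \<omega>) \<le> 1"
      using cutoff_state_bounds by (intro AE_I2) (auto simp: of_bool_def indicator_def)
  qed measurable
  have "(\<integral>\<^sup>+\<omega>. ennreal (?W \<omega>) \<partial>M) = ennreal (LINT \<omega>|M. ?W \<omega>)"
    by (rule nn_integral_eq_integral[OF Wint]) (rule AE_I2, rule W0)
  also have "\<dots> = ennreal (LINT s|lborel. indicator {a<..b} s * (LINT \<omega>|M. ?G \<omega> s))"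
    by (simp only: jump_intensity_cutoff[OF C ab])
  also have "\<dots> = (\<integral>\<^sup>+s. ennreal (indicator {a<..b} s * (LINT \<omega>|M. ?G \<omega> s)) \<partial>lborel)"
    by (rule nn_integral_eq_integral[symmetric, OF int_out]) (rule AE_I2, rule mult_nonneg_nonneg[OF _ E0], simp)
  also have "\<dots> = (\<integral>\<^sup>+s. (\<integral>\<^sup>+\<omega>. ennreal (indicator {a<..b} s * ?G \<omega> s) \<partial>M) \<partial>lborel)"
    by (simp only: inner)
  also have "\<dots> = (\<integral>\<^sup>+p. ennreal (indicator {a<..b} (snd p) * ?G (fst p) (snd p)) \<partial>(M \<Otimes>\<^sub>M lborel))"
  proof -
    have "(\<lambda>p. ennreal (indicator {a<..b} (snd p) * ?G (fst p) (snd p))) \<in> borel_measurable (M \<Otimes>\<^sub>M lborel)"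
      using Gm by measurable
    from time.nn_integral_snd[OF this] show ?thesis by (simp only: fst_conv snd_conv)
  qed
  finally show ?thesis .
qed

text \<open>The rate measure against which the jumps are compared: it lives on paths together with a time at which jump number
\<open>Suc k\<close> is pending.\<close>

definition jump_density :: "real \<Rightarrow> nat \<Rightarrow> 'w \<times> real \<Rightarrow> ennreal" where
  "jump_density r k p = ennreal (of_bool (0 < snd p \<and> snd p \<le> t \<and> last_hop k (fst p) < snd p \<and> snd p \<le> hop_time (Suc k) (fst p))
     * cutoff_state r k (hops k (fst p), snd p) * intensity k (hops k (fst p)) (snd p))"

definition jump_event :: "real \<Rightarrow> nat \<Rightarrow> 'w \<Rightarrow> ennreal" where
  "jump_event r k \<omega> = ennreal (of_bool (0 < hop_time (Suc k) \<omega> \<and> hop_time (Suc k) \<omega> \<le> t)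
     * cutoff_state r k (hops k \<omega>, hop_time (Suc k) \<omega>))"

lemma jump_density_measurable [measurable]: "jump_density r k \<in> borel_measurable (M \<Otimes>\<^sub>M lborel)"
  unfolding jump_density_def[abs_def] by measurable

lemma jump_event_measurable [measurable]: "jump_event r k \<in> borel_measurable M"
  unfolding jump_event_def[abs_def] by measurable

text \<open>Two finite measures on jump histories and times that agree on products with rays by
\<open>jump_intensity_cutoff\<close>.\<close>

lemma jump_measures_eq:
  "distr (density M (jump_event r k)) (path_space k \<Otimes>\<^sub>M borel) (\<lambda>\<omega>. (hops k \<omega>, hop_time (Suc k) \<omega>))
    = distr (density (M \<Otimes>\<^sub>M lborel) (jump_density r k)) (path_space k \<Otimes>\<^sub>M borel) (\<lambda>p. (hops k (fst p), snd p))"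
    (is "?\<mu> = ?\<nu>")
proof (rule measure_eqI_product_rays)
  show "sets ?\<mu> = sets (path_space k \<Otimes>\<^sub>M borel)" "sets ?\<nu> = sets (path_space k \<Otimes>\<^sub>M borel)" by simp_all
  have f1: "(\<lambda>\<omega>. (hops k \<omega>, hop_time (Suc k) \<omega>)) \<in> M \<rightarrow>\<^sub>M path_space k \<Otimes>\<^sub>M borel" by measurable
  have f2: "(\<lambda>p. (hops k (fst p), snd p)) \<in> M \<Otimes>\<^sub>M lborel \<rightarrow>\<^sub>M path_space k \<Otimes>\<^sub>M borel" by measurable
  have em: "emeasure ?\<mu> E = (\<integral>\<^sup>+\<omega>. jump_event r k \<omega> * indicator E (hops k \<omega>, hop_time (Suc k) \<omega>) \<partial>M)"
    if "E \<in> sets (path_space k \<Otimes>\<^sub>M borel)" for E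
  proof -
    have "emeasure ?\<mu> E = (\<integral>\<^sup>+y. indicator E y \<partial>?\<mu>)" using that by simp
    also have "\<dots> = (\<integral>\<^sup>+\<omega>. indicator E (hops k \<omega>, hop_time (Suc k) \<omega>) \<partial>density M (jump_event r k))"
      using that f1 by (intro nn_integral_distr) auto
    also have "\<dots> = (\<integral>\<^sup>+\<omega>. jump_event r k \<omega> * indicator E (hops k \<omega>, hop_time (Suc k) \<omega>) \<partial>M)"
      using that f1 by (intro nn_integral_density) auto
    finally show ?thesis .
  qed
  have en: "emeasure ?\<nu> E = (\<integral>\<^sup>+p. jump_density r k p * indicator E (hops k (fst p), snd p) \<partial>(M \<Otimes>\<^sub>M lborel))"
    if "E \<in> sets (path_space k \<Otimes>\<^sub>M borel)" for E
  proof -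
    have "emeasure ?\<nu> E = (\<integral>\<^sup>+y. indicator E y \<partial>?\<nu>)" using that by simp
    also have "\<dots> = (\<integral>\<^sup>+p. indicator E (hops k (fst p), snd p) \<partial>density (M \<Otimes>\<^sub>M lborel) (jump_density r k))"
      using that f2 by (intro nn_integral_distr) auto
    also have "\<dots> = (\<integral>\<^sup>+p. jump_density r k p * indicator E (hops k (fst p), snd p) \<partial>(M \<Otimes>\<^sub>M lborel))"
      using that f2 by (intro nn_integral_density) auto
    finally show ?thesis .
  qed
  show "emeasure ?\<mu> (space ?\<mu>) < \<infinity>"
  proof -
    have "emeasure ?\<mu> (space ?\<mu>) = (\<integral>\<^sup>+\<omega>. jump_event r k \<omega> * indicator (space ?\<mu>) (hops k \<omega>, hop_time (Suc k) \<omega>) \<partial>M)"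
      by (rule em) (simp only: space_distr sets.top)
    also have "\<dots> \<le> (\<integral>\<^sup>+\<omega>. 1 \<partial>M)"
    proof (rule nn_integral_mono)
      fix \<omega>
      have "jump_event r k \<omega> \<le> 1"
        unfolding jump_event_def using cutoff_state_bounds[of r k] by (auto simp: of_bool_def ennreal_le_1)
      then have "jump_event r k \<omega> * indicator (space ?\<mu>) (hops k \<omega>, hop_time (Suc k) \<omega>) \<le> 1 * 1"
        by (rule mult_mono) (auto simp: indicator_def)
      then show "jump_event r k \<omega> * indicator (space ?\<mu>) (hops k \<omega>, hop_time (Suc k) \<omega>) \<le> 1" by simp
    qed
    finally show ?thesis by (simp add: emeasure_space_1 le_less_trans)
  qed
  fix C and x :: real assume C: "C \<in> sets (path_space k :: (((real^'m) \<times> (real^'m)) \<times> (nat \<Rightarrow> real)) measure)"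
  then have E: "C \<times> {x<..} \<in> sets (path_space k \<Otimes>\<^sub>M borel)" by simp
  show "emeasure ?\<mu> (C \<times> {x<..}) = emeasure ?\<nu> (C \<times> {x<..})"
  proof (cases "max 0 x < t")
    case True
    have 1: "jump_event r k \<omega> * indicator (C \<times> {x<..}) (hops k \<omega>, hop_time (Suc k) \<omega>)
        = ennreal (of_bool (max 0 x < hop_time (Suc k) \<omega> \<and> hop_time (Suc k) \<omega> \<le> t) * indicator C (hops k \<omega>)
            * cutoff_state r k (hops k \<omega>, hop_time (Suc k) \<omega>))" for \<omega>
      by (auto simp: jump_event_def of_bool_def indicator_def)
    have 2: "jump_density r k p * indicator (C \<times> {x<..}) (hops k (fst p), snd p)
        = ennreal (indicator {max 0 x<..t} (snd p) * (of_bool (last_hop k (fst p) < snd p \<and> snd p \<le> hop_time (Suc k) (fst p))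
        * indicator C (hops k (fst p)) * cutoff_state r k (hops k (fst p), snd p) * intensity k (hops k (fst p)) (snd p)))" for p
      by (auto simp: jump_density_def of_bool_def indicator_def)
    show ?thesis
      unfolding em[OF E] en[OF E] 1 2 using True by (intro jump_intensity_cutoff_nn C) auto
  next
    case False
    have 1: "jump_event r k \<omega> * indicator (C \<times> {x<..}) (hops k \<omega>, hop_time (Suc k) \<omega>) = 0" for \<omega>
      using False by (auto simp: jump_event_def of_bool_def indicator_def)
    have 2: "jump_density r k p * indicator (C \<times> {x<..}) (hops k (fst p), snd p) = 0" for p
      using False by (auto simp: jump_density_def of_bool_def indicator_def)
    show ?thesis unfolding em[OF E] en[OF E] 1 2 by simp
  qed
qed

lemma jump_intensity_cutoff_test:
  assumes \<phi>: "\<phi> \<in> borel_measurable (path_space k \<Otimes>\<^sub>M borel)"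
  shows "(\<integral>\<^sup>+\<omega>. jump_event r k \<omega> * \<phi> (hops k \<omega>, hop_time (Suc k) \<omega>) \<partial>M)
    = (\<integral>\<^sup>+p. jump_density r k p * \<phi> (hops k (fst p), snd p) \<partial>(M \<Otimes>\<^sub>M lborel))"
proof -
  have f1: "(\<lambda>\<omega>. (hops k \<omega>, hop_time (Suc k) \<omega>)) \<in> M \<rightarrow>\<^sub>M path_space k \<Otimes>\<^sub>M borel" by measurable
  have f2: "(\<lambda>p. (hops k (fst p), snd p)) \<in> M \<Otimes>\<^sub>M lborel \<rightarrow>\<^sub>M path_space k \<Otimes>\<^sub>M borel" by measurable
  have m: "(\<lambda>\<omega>. \<phi> (hops k \<omega>, hop_time (Suc k) \<omega>)) \<in> borel_measurable M"
    "(\<lambda>p. \<phi> (hops k (fst p), snd p)) \<in> borel_measurable (M \<Otimes>\<^sub>M lborel)"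
    by (rule measurable_compose[OF f1 \<phi>], rule measurable_compose[OF f2 \<phi>])
  have "(\<integral>\<^sup>+\<omega>. jump_event r k \<omega> * \<phi> (hops k \<omega>, hop_time (Suc k) \<omega>) \<partial>M)
      = (\<integral>\<^sup>+\<omega>. \<phi> (hops k \<omega>, hop_time (Suc k) \<omega>) \<partial>density M (jump_event r k))"
    using m by (intro nn_integral_density[symmetric]) auto
  also have "\<dots> = (\<integral>\<^sup>+y. \<phi> y \<partial>distr (density M (jump_event r k)) (path_space k \<Otimes>\<^sub>M borel) (\<lambda>\<omega>. (hops k \<omega>, hop_time (Suc k) \<omega>)))"
    using f1 \<phi> by (intro nn_integral_distr[symmetric]) auto
  also have "\<dots> = (\<integral>\<^sup>+p. \<phi> (hops k (fst p), snd p) \<partial>density (M \<Otimes>\<^sub>M lborel) (jump_density r k))"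
    unfolding jump_measures_eq using f2 \<phi> by (intro nn_integral_distr) auto
  also have "\<dots> = (\<integral>\<^sup>+p. jump_density r k p * \<phi> (hops k (fst p), snd p) \<partial>(M \<Otimes>\<^sub>M lborel))"
    using m by (intro nn_integral_density) auto
  finally show ?thesis .
qed

lemma cutoff_state_mono: "r \<le> r' \<Longrightarrow> cutoff_state r k p \<le> cutoff_state r' k p"
  by (auto simp: cutoff_state_def cutoff_def)

lemma cutoff_state_eventually: "\<forall>\<^sub>F r in sequentially. cutoff_state (real r) k p = of_bool (p \<in> hop_region t k)"
proof -
  let ?z = "state (times k (snd (fst p))) (fst (fst p)) (snd p)"
  have "\<forall>\<^sub>F r in sequentially. norm ?z \<le> real r"
    using eventually_ge_at_top[of "nat \<lceil>norm ?z\<rceil>"] by eventually_elim linarith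
  then show ?thesis by eventually_elim (simp add: cutoff_state_def cutoff_one del: upt_Suc)
qed

text \<open>The cutoff is removed by monotone convergence. The identity states that \<open>intensity\<close> is the stochastic intensity of
the jump number \<open>Suc k\<close> in the sense of point processes.\<close>

lemma jump_intensity:
  assumes \<phi>: "\<phi> \<in> borel_measurable (path_space k \<Otimes>\<^sub>M borel)"
  shows "(\<integral>\<^sup>+\<omega>. of_bool (hop_time (Suc k) \<omega> \<le> t) * \<phi> (hops k \<omega>, hop_time (Suc k) \<omega>) \<partial>M)
    = (\<integral>\<^sup>+p. of_bool (0 < snd p \<and> snd p \<le> t \<and> last_hop k (fst p) < snd p \<and> snd p \<le> hop_time (Suc k) (fst p))
        * (\<phi> (hops k (fst p), snd p) * ennreal (intensity k (hops k (fst p)) (snd p))) \<partial>(M \<Otimes>\<^sub>M lborel))"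
proof -
  let ?\<tau> = "hop_time (Suc k)"
  have f1: "(\<lambda>\<omega>. (hops k \<omega>, ?\<tau> \<omega>)) \<in> M \<rightarrow>\<^sub>M path_space k \<Otimes>\<^sub>M borel" by measurable
  have f2: "(\<lambda>p. (hops k (fst p), snd p)) \<in> M \<Otimes>\<^sub>M lborel \<rightarrow>\<^sub>M path_space k \<Otimes>\<^sub>M borel" by measurable
  note m = measurable_compose[OF f1 \<phi>] measurable_compose[OF f2 \<phi>]
  have 1: "(\<lambda>r. \<integral>\<^sup>+\<omega>. jump_event (real r) k \<omega> * \<phi> (hops k \<omega>, ?\<tau> \<omega>) \<partial>M) \<longlonglongrightarrow>
      (\<integral>\<^sup>+\<omega>. ennreal (of_bool (0 < ?\<tau> \<omega> \<and> ?\<tau> \<omega> \<le> t) * of_bool ((hops k \<omega>, ?\<tau> \<omega>) \<in> hop_region t k)) * \<phi> (hops k \<omega>, ?\<tau> \<omega>) \<partial>M)"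
  proof (rule nn_integral_LIMSEQ)
    show "incseq (\<lambda>r \<omega>. jump_event (real r) k \<omega> * \<phi> (hops k \<omega>, ?\<tau> \<omega>))"
      unfolding incseq_def le_fun_def jump_event_def
      by (intro allI impI mult_right_mono ennreal_leI mult_left_mono cutoff_state_mono) auto
    show "(\<lambda>\<omega>. jump_event (real r) k \<omega> * \<phi> (hops k \<omega>, ?\<tau> \<omega>)) \<in> borel_measurable M" for r
      using m(1) by measurable
    show "(\<lambda>r. jump_event (real r) k \<omega> * \<phi> (hops k \<omega>, ?\<tau> \<omega>)) \<longlonglongrightarrow>
        ennreal (of_bool (0 < ?\<tau> \<omega> \<and> ?\<tau> \<omega> \<le> t) * of_bool ((hops k \<omega>, ?\<tau> \<omega>) \<in> hop_region t k)) * \<phi> (hops k \<omega>, ?\<tau> \<omega>)" for \<omega>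
      using cutoff_state_eventually[of k "(hops k \<omega>, ?\<tau> \<omega>)"]
      by (intro tendsto_eventually) (auto simp: jump_event_def elim!: eventually_mono)
  qed
  have 2: "(\<lambda>r. \<integral>\<^sup>+p. jump_density (real r) k p * \<phi> (hops k (fst p), snd p) \<partial>(M \<Otimes>\<^sub>M lborel)) \<longlonglongrightarrow>
      (\<integral>\<^sup>+p. ennreal (of_bool (0 < snd p \<and> snd p \<le> t \<and> last_hop k (fst p) < snd p \<and> snd p \<le> ?\<tau> (fst p))
         * of_bool ((hops k (fst p), snd p) \<in> hop_region t k) * intensity k (hops k (fst p)) (snd p)) * \<phi> (hops k (fst p), snd p) \<partial>(M \<Otimes>\<^sub>M lborel))"
  proof (rule nn_integral_LIMSEQ)
    show "incseq (\<lambda>r p. jump_density (real r) k p * \<phi> (hops k (fst p), snd p))"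
      unfolding incseq_def le_fun_def jump_density_def
      by (intro allI impI mult_right_mono ennreal_leI mult_left_mono cutoff_state_mono intensity_nonneg) auto
    show "(\<lambda>p. jump_density (real r) k p * \<phi> (hops k (fst p), snd p)) \<in> borel_measurable (M \<Otimes>\<^sub>M lborel)" for r
      using m(2) by measurable
    show "(\<lambda>r. jump_density (real r) k p * \<phi> (hops k (fst p), snd p)) \<longlonglongrightarrow>
        ennreal (of_bool (0 < snd p \<and> snd p \<le> t \<and> last_hop k (fst p) < snd p \<and> snd p \<le> ?\<tau> (fst p))
         * of_bool ((hops k (fst p), snd p) \<in> hop_region t k) * intensity k (hops k (fst p)) (snd p)) * \<phi> (hops k (fst p), snd p)" for p
      using cutoff_state_eventually[of k "(hops k (fst p), snd p)"]
      by (intro tendsto_eventually) (auto simp: jump_density_def elim!: eventually_mono)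
  qed
  have "(\<integral>\<^sup>+\<omega>. of_bool (?\<tau> \<omega> \<le> t) * \<phi> (hops k \<omega>, ?\<tau> \<omega>) \<partial>M)
      = (\<integral>\<^sup>+\<omega>. ennreal (of_bool (0 < ?\<tau> \<omega> \<and> ?\<tau> \<omega> \<le> t) * of_bool ((hops k \<omega>, ?\<tau> \<omega>) \<in> hop_region t k)) * \<phi> (hops k \<omega>, ?\<tau> \<omega>) \<partial>M)"
  proof (rule nn_integral_cong_AE)
    show "AE \<omega> in M. of_bool (?\<tau> \<omega> \<le> t) * \<phi> (hops k \<omega>, ?\<tau> \<omega>)
        = ennreal (of_bool (0 < ?\<tau> \<omega> \<and> ?\<tau> \<omega> \<le> t) * of_bool ((hops k \<omega>, ?\<tau> \<omega>) \<in> hop_region t k)) * \<phi> (hops k \<omega>, ?\<tau> \<omega>)"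
      using AE_good
    proof eventually_elim
      case (elim \<omega>)
      have "(hops k \<omega>, ?\<tau> \<omega>) \<in> hop_region t k" if "?\<tau> \<omega> \<le> t"
        using that hop_time_range[OF elim, of k] last_hop_less_hop_time[OF elim that] by (intro hops_region[OF elim]) auto
      then show ?case using hop_time_range[OF elim, of k] by (auto simp: of_bool_def)
    qed
  qed
  also have "\<dots> = (\<integral>\<^sup>+p. ennreal (of_bool (0 < snd p \<and> snd p \<le> t \<and> last_hop k (fst p) < snd p \<and> snd p \<le> ?\<tau> (fst p))
         * of_bool ((hops k (fst p), snd p) \<in> hop_region t k) * intensity k (hops k (fst p)) (snd p)) * \<phi> (hops k (fst p), snd p) \<partial>(M \<Otimes>\<^sub>M lborel))"
    using 1 2 unfolding jump_intensity_cutoff_test[OF \<phi>] by (rule LIMSEQ_unique)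
  also have "\<dots> = (\<integral>\<^sup>+p. of_bool (0 < snd p \<and> snd p \<le> t \<and> last_hop k (fst p) < snd p \<and> snd p \<le> ?\<tau> (fst p))
        * (\<phi> (hops k (fst p), snd p) * ennreal (intensity k (hops k (fst p)) (snd p))) \<partial>(M \<Otimes>\<^sub>M lborel))"
    by (intro nn_integral_cong) (auto simp: of_bool_def intensity_def mult.commute)
  finally show ?thesis .
qed

end


section \<open>Joint law of the jump times\<close>

lemma path_space_nn_integral:
  fixes f :: "('a::euclidean_space \<times> (nat \<Rightarrow> real)) \<Rightarrow> ennreal"
  assumes "f \<in> borel_measurable (path_space n)"
  shows "integral\<^sup>N (path_space n) f = (\<integral>\<^sup>+z. \<integral>\<^sup>+\<tau>. f (z, \<tau>) \<partial>Pi\<^sub>M {1..n} (\<lambda>_. lborel) \<partial>lborel)"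
proof -
  interpret product_sigma_finite "\<lambda>_::nat. lborel :: real measure" ..
  interpret sigma_finite_measure "Pi\<^sub>M {1..n} (\<lambda>_. lborel :: real measure)" by (rule sigma_finite) simp
  show ?thesis
    unfolding path_space_def by (rule nn_integral_fst[symmetric]) (use assms in \<open>simp add: path_space_def\<close>)
qed

lemma measurable_extend_path:
  "(\<lambda>p. (fst (fst p), (snd (fst p))(Suc n := snd p)))
    \<in> path_space n \<Otimes>\<^sub>M borel \<rightarrow>\<^sub>M (path_space (Suc n) :: ('a::euclidean_space \<times> (nat \<Rightarrow> real)) measure)"
  unfolding path_space_def
proof (rule measurable_Pair)
  show "(\<lambda>p. fst (fst p)) \<in> (lborel \<Otimes>\<^sub>M Pi\<^sub>M {1..n} (\<lambda>_. lborel)) \<Otimes>\<^sub>M borel \<rightarrow>\<^sub>M (lborel :: 'a measure)"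
    by measurable
  show "(\<lambda>p. (snd (fst p))(Suc n := snd p))
      \<in> ((lborel :: 'a measure) \<Otimes>\<^sub>M Pi\<^sub>M {1..n} (\<lambda>_. lborel)) \<Otimes>\<^sub>M borel \<rightarrow>\<^sub>M Pi\<^sub>M {1..Suc n} (\<lambda>_. lborel)"
    by (rule measurable_fun_upd[where J = "{1..n}"]) (auto simp: measurable_lborel1)
qed

lemma path_space_Suc_nn_integral:
  fixes f :: "('a::euclidean_space \<times> (nat \<Rightarrow> real)) \<Rightarrow> ennreal"
  assumes f: "f \<in> borel_measurable (path_space (Suc n))"
  shows "integral\<^sup>N (path_space (Suc n)) f
    = (\<integral>\<^sup>+x. \<integral>\<^sup>+s. f (fst x, (snd x)(Suc n := s)) \<partial>lborel \<partial>path_space n)"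
proof -
  interpret product_sigma_finite "\<lambda>_::nat. lborel :: real measure" ..
  have g: "(\<lambda>p. f (fst (fst p), (snd (fst p))(Suc n := snd p))) \<in> borel_measurable (path_space n \<Otimes>\<^sub>M borel)"
    by (rule measurable_compose[OF measurable_extend_path f])
  have ins: "insert (Suc n) {1..n} = {1..Suc n}" by auto
  have section_meas: "(\<lambda>\<tau>. f (z, \<tau>)) \<in> borel_measurable (Pi\<^sub>M {1..Suc n} (\<lambda>_. lborel))" for z
    using f unfolding path_space_def by (rule measurable_compose[rotated]) simp
  have "integral\<^sup>N (path_space (Suc n)) f
      = (\<integral>\<^sup>+z. \<integral>\<^sup>+\<tau>. f (z, \<tau>) \<partial>Pi\<^sub>M {1..Suc n} (\<lambda>_. lborel) \<partial>lborel)"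
    by (rule path_space_nn_integral[OF f])
  also have "\<dots> = (\<integral>\<^sup>+z. \<integral>\<^sup>+\<tau>. \<integral>\<^sup>+s. f (z, \<tau>(Suc n := s)) \<partial>lborel \<partial>Pi\<^sub>M {1..n} (\<lambda>_. lborel) \<partial>lborel)"
    using product_nn_integral_insert[of "{1..n}" "Suc n", unfolded ins, OF _ _ section_meas] by simp
  also have "\<dots> = (\<integral>\<^sup>+x. \<integral>\<^sup>+s. f (fst x, (snd x)(Suc n := s)) \<partial>lborel \<partial>path_space n)"
  proof (subst path_space_nn_integral)
    have "case_prod (\<lambda>x s. f (fst x, (snd x)(Suc n := s))) \<in> borel_measurable (path_space n \<Otimes>\<^sub>M lborel)"
      unfolding case_prod_unfold measurable_cong_sets[OF sets_pair_measure_cong[OF refl sets_lborel] refl] by (rule g)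
    then show "(\<lambda>x. \<integral>\<^sup>+s. f (fst x, (snd x)(Suc n := s)) \<partial>lborel) \<in> borel_measurable (path_space n)"
      by (rule lborel.borel_measurable_nn_integral)
  qed (simp only: fst_conv snd_conv)
  finally show ?thesis .
qed

context hopping_process_model
begin

definition survival :: "nat \<Rightarrow> ((real^'m) \<times> (real^'m)) \<times> (nat \<Rightarrow> real) \<Rightarrow> real \<Rightarrow> real" where
  "survival k x s = exp (- (cumulated k x s - cumulated k x (last_time k (snd x))))"

lemma cumulated_nonneg: "0 \<le> cumulated k x s"
  unfolding cumulated_def set_lebesgue_integral_def
  by (rule Bochner_Integration.integral_nonneg) (simp add: intensity_nonneg)

lemma survival_measurable [measurable (raw)]:
  assumes [measurable]: "f \<in> N \<rightarrow>\<^sub>M path_space k" "g \<in> borel_measurable N"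
  shows "(\<lambda>y. survival k (f y) (g y)) \<in> borel_measurable N"
proof -
  have "(\<lambda>y. last_time k (snd (f y))) \<in> borel_measurable N"
    by (rule measurable_compose[OF assms(1) last_time_measurable])
  then show ?thesis unfolding survival_def by measurable
qed

lemma survival_inverse: "inverse (survival k x s) = exp (cumulated k x s - cumulated k x (last_time k (snd x)))"
  unfolding survival_def by (subst exp_minus[symmetric]) simp

lemma survival_pos: "0 < survival k x s"
  by (simp add: survival_def)

lemma survival_inverse_bound:
  assumes "0 \<le> s" "s \<le> t"
  shows "inverse (survival k x s) \<le> exp (cumulated k x t)"
  unfolding survival_inverse using cumulated_mono[OF assms(2) order_refl assms(1), of k x] cumulated_nonneg[of k x "last_time k (snd x)"]
  by simp

text \<open>Test \<open>jump_intensity\<close> with the inverse survival probability up to time \<open>s\<close>. On the right the time integral is the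
explicit one in \<open>cumulated_hazard\<close>, evaluated at the jump time or at \<open>s\<close>, whichever comes first. The paths that have jumped
before \<open>s\<close> contribute equally to both sides, and the others give the claim. Restricting to \<open>D\<close> makes the
contribution to be cancelled finite.\<close>

lemma survival_on_bounded:
  assumes D: "D \<in> sets (path_space k)" and s: "s \<in> {0..t}" and N: "\<And>x. x \<in> D \<Longrightarrow> exp (cumulated k x t) \<le> N"
  shows "(\<integral>\<^sup>+\<omega>. of_bool (last_hop k \<omega> \<le> s \<and> s < hop_time (Suc k) \<omega>) * (indicator D (hops k \<omega>) * ennreal (inverse (survival k (hops k \<omega>) s))) \<partial>M)
    = (\<integral>\<^sup>+\<omega>. of_bool (last_hop k \<omega> \<le> s) * indicator D (hops k \<omega>) \<partial>M)"
    (is "?I2 = ?I3")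
proof -
  note D[measurable]
  let ?\<tau> = "hop_time (Suc k)"
  let ?e = "\<lambda>\<omega> u. inverse (survival k (hops k \<omega>) u)"
  define \<phi> where "\<phi> p = indicator D (fst p) * (ennreal (inverse (survival k (fst p) (snd p))) * of_bool (snd p \<le> s))"
    for p :: "(((real^'m) \<times> (real^'m)) \<times> (nat \<Rightarrow> real)) \<times> real"
  have \<phi>: "\<phi> \<in> borel_measurable (path_space k \<Otimes>\<^sub>M borel)" unfolding \<phi>_def by measurable
  define I1 where "I1 = (\<integral>\<^sup>+\<omega>. of_bool (?\<tau> \<omega> \<le> t) * \<phi> (hops k \<omega>, ?\<tau> \<omega>) \<partial>M)"
  have e1: "1 \<le> ?e \<omega> u" if "good \<omega>" "last_hop k \<omega> \<le> u" "u \<le> t" for \<omega> u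
    unfolding survival_inverse last_time_hops using cumulated_mono[OF that(2,3) last_hop_nonneg[OF that(1)], of k "hops k \<omega>"] by simp
  have inner: "(\<integral>\<^sup>+u. of_bool (0 < u \<and> u \<le> t \<and> last_hop k \<omega> < u \<and> u \<le> ?\<tau> \<omega>)
        * (\<phi> (hops k \<omega>, u) * ennreal (intensity k (hops k \<omega>) u)) \<partial>lborel)
      = of_bool (last_hop k \<omega> \<le> s) * (indicator D (hops k \<omega>) * ennreal (?e \<omega> (min s (?\<tau> \<omega>)) - 1))" if good: "good \<omega>" for \<omega>
  proof (cases "last_hop k \<omega> \<le> s")
    case True
    let ?a = "last_hop k \<omega>" and ?b = "min s (?\<tau> \<omega>)"
    have a: "0 \<le> ?a" "?a \<le> ?b" "?b \<le> t"
      using last_hop_nonneg[OF good, of k] last_hop_less[OF good, of k] True s by auto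
    have "(\<integral>\<^sup>+u. of_bool (0 < u \<and> u \<le> t \<and> last_hop k \<omega> < u \<and> u \<le> ?\<tau> \<omega>) * (\<phi> (hops k \<omega>, u) * ennreal (intensity k (hops k \<omega>) u)) \<partial>lborel)
      = (\<integral>\<^sup>+u. indicator D (hops k \<omega>) * (indicator {?a<..?b} u *
          ennreal (intensity k (hops k \<omega>) u * exp (cumulated k (hops k \<omega>) u - cumulated k (hops k \<omega>) ?a))) \<partial>lborel)"
    proof (rule nn_integral_cong)
      fix u
      have iff: "(0 < u \<and> u \<le> t \<and> last_hop k \<omega> < u \<and> u \<le> ?\<tau> \<omega>) \<and> u \<le> s \<longleftrightarrow> u \<in> {?a<..?b}"
        using a s by auto
      show "of_bool (0 < u \<and> u \<le> t \<and> last_hop k \<omega> < u \<and> u \<le> ?\<tau> \<omega>) * (\<phi> (hops k \<omega>, u) * ennreal (intensity k (hops k \<omega>) u))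
        = indicator D (hops k \<omega>) * (indicator {?a<..?b} u *
          ennreal (intensity k (hops k \<omega>) u * exp (cumulated k (hops k \<omega>) u - cumulated k (hops k \<omega>) ?a)))"
      proof (cases "u \<in> {?a<..?b}")
        case True
        then have "0 < u \<and> u \<le> t \<and> last_hop k \<omega> < u \<and> u \<le> ?\<tau> \<omega>" "u \<le> s" using iff by auto
        then show ?thesis
          using True by (simp add: \<phi>_def survival_inverse last_time_hops ennreal_mult intensity_nonneg mult_ac)
      next
        case False
        then have "\<not> ((0 < u \<and> u \<le> t \<and> last_hop k \<omega> < u \<and> u \<le> ?\<tau> \<omega>) \<and> u \<le> s)" using iff by blast
        then show ?thesis using False by (auto simp: \<phi>_def of_bool_def)
      qed
    qed
    also have "\<dots> = indicator D (hops k \<omega>) * (\<integral>\<^sup>+u. indicator {?a<..?b} u *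
          ennreal (intensity k (hops k \<omega>) u * exp (cumulated k (hops k \<omega>) u - cumulated k (hops k \<omega>) ?a)) \<partial>lborel)"
    proof (rule nn_integral_cmult)
      have sp: "hops k \<omega> \<in> space (path_space k)"
        by (auto simp: hops_eq path_space_def space_pair_measure space_PiM)
      have [measurable]: "(\<lambda>u. hops k \<omega>) \<in> lborel \<rightarrow>\<^sub>M path_space k" using sp by simp
      show "(\<lambda>u. indicator {?a<..?b} u *
          ennreal (intensity k (hops k \<omega>) u * exp (cumulated k (hops k \<omega>) u - cumulated k (hops k \<omega>) ?a))) \<in> borel_measurable lborel"
        by measurable
    qed
    also have "\<dots> = indicator D (hops k \<omega>) * ennreal (?e \<omega> ?b - 1)"
      unfolding cumulated_hazard[OF a] survival_inverse last_time_hops ..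
    finally show ?thesis using True by simp
  next
    case False
    then have zero: "of_bool (0 < u \<and> u \<le> t \<and> last_hop k \<omega> < u \<and> u \<le> ?\<tau> \<omega>) * (\<phi> (hops k \<omega>, u) * ennreal (intensity k (hops k \<omega>) u)) = 0" for u
      by (auto simp: \<phi>_def of_bool_def)
    show ?thesis unfolding zero using False by simp
  qed
  have I1_eq: "I1 = (\<integral>\<^sup>+\<omega>. of_bool (last_hop k \<omega> \<le> s) * (indicator D (hops k \<omega>) * ennreal (?e \<omega> (min s (?\<tau> \<omega>)) - 1)) \<partial>M)"
  proof -
    have \<phi>2: "(\<lambda>p. \<phi> (hops k (fst p), snd p)) \<in> borel_measurable (M \<Otimes>\<^sub>M lborel)"
      by (rule measurable_compose[OF _ \<phi>]) measurable
    then have m: "(\<lambda>p. of_bool (0 < snd p \<and> snd p \<le> t \<and> last_hop k (fst p) < snd p \<and> snd p \<le> ?\<tau> (fst p))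
        * (\<phi> (hops k (fst p), snd p) * ennreal (intensity k (hops k (fst p)) (snd p)))) \<in> borel_measurable (M \<Otimes>\<^sub>M lborel)"
      unfolding of_bool_def by measurable
    have "I1 = (\<integral>\<^sup>+\<omega>. \<integral>\<^sup>+u. of_bool (0 < u \<and> u \<le> t \<and> last_hop k \<omega> < u \<and> u \<le> ?\<tau> \<omega>)
        * (\<phi> (hops k \<omega>, u) * ennreal (intensity k (hops k \<omega>) u)) \<partial>lborel \<partial>M)"
      unfolding I1_def jump_intensity[OF \<phi>] using lborel.nn_integral_fst[OF m] by (simp only: fst_conv snd_conv)
    also have "\<dots> = (\<integral>\<^sup>+\<omega>. of_bool (last_hop k \<omega> \<le> s) * (indicator D (hops k \<omega>) * ennreal (?e \<omega> (min s (?\<tau> \<omega>)) - 1)) \<partial>M)"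
      using AE_good by (intro nn_integral_cong_AE) (auto elim!: eventually_mono simp: inner)
    finally show ?thesis .
  qed
  have I1_fin: "I1 < \<infinity>"
  proof -
    have "I1 \<le> (\<integral>\<^sup>+\<omega>. ennreal N \<partial>M)"
      unfolding I1_def
    proof (rule nn_integral_mono_AE)
      show "AE \<omega> in M. of_bool (?\<tau> \<omega> \<le> t) * \<phi> (hops k \<omega>, ?\<tau> \<omega>) \<le> ennreal N"
        using AE_good
      proof eventually_elim
        case (elim \<omega>)
        show ?case
        proof (cases "?\<tau> \<omega> \<le> t \<and> hops k \<omega> \<in> D")
          case True
          then have "?e \<omega> (?\<tau> \<omega>) \<le> N"
            using survival_inverse_bound[of "?\<tau> \<omega>" k "hops k \<omega>"] N[of "hops k \<omega>"] hop_time_range[OF elim, of k] by auto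
          then show ?thesis using True by (auto simp: \<phi>_def of_bool_def intro: ennreal_leI)
        qed (auto simp: \<phi>_def of_bool_def)
      qed
    qed
    then show ?thesis by (simp add: emeasure_space_1 le_less_trans)
  qed
  have [measurable]: "(\<lambda>\<omega>. \<phi> (hops k \<omega>, ?\<tau> \<omega>)) \<in> borel_measurable M"
    by (rule measurable_compose[OF _ \<phi>]) measurable
  have "I1 + ?I2 = (\<integral>\<^sup>+\<omega>. of_bool (?\<tau> \<omega> \<le> t) * \<phi> (hops k \<omega>, ?\<tau> \<omega>)
      + of_bool (last_hop k \<omega> \<le> s \<and> s < ?\<tau> \<omega>) * (indicator D (hops k \<omega>) * ennreal (?e \<omega> s)) \<partial>M)"
    unfolding I1_def by (rule nn_integral_add[symmetric]) (unfold of_bool_def, measurable)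
  also have "\<dots> = (\<integral>\<^sup>+\<omega>. of_bool (last_hop k \<omega> \<le> s) * (indicator D (hops k \<omega>) * ennreal (?e \<omega> (min s (?\<tau> \<omega>)) - 1))
      + of_bool (last_hop k \<omega> \<le> s) * indicator D (hops k \<omega>) \<partial>M)"
  proof (rule nn_integral_cong_AE)
    show "AE \<omega> in M. of_bool (?\<tau> \<omega> \<le> t) * \<phi> (hops k \<omega>, ?\<tau> \<omega>)
      + of_bool (last_hop k \<omega> \<le> s \<and> s < ?\<tau> \<omega>) * (indicator D (hops k \<omega>) * ennreal (?e \<omega> s))
      = of_bool (last_hop k \<omega> \<le> s) * (indicator D (hops k \<omega>) * ennreal (?e \<omega> (min s (?\<tau> \<omega>)) - 1))
      + of_bool (last_hop k \<omega> \<le> s) * indicator D (hops k \<omega>)"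
      using AE_good
    proof eventually_elim
      case (elim \<omega>)
      have split: "ennreal (?e \<omega> u - 1) + 1 = ennreal (?e \<omega> u)" if "last_hop k \<omega> \<le> u" "u \<le> t" for u
        using e1[OF elim that] by (simp flip: ennreal_1 ennreal_plus)
      show ?case
      proof (cases "last_hop k \<omega> \<le> s")
        case True
        then have lt: "last_hop k \<omega> < ?\<tau> \<omega>" using last_hop_less[OF elim, of k] s by auto
        have "ennreal (?e \<omega> (min s (?\<tau> \<omega>)) - 1) + 1 = ennreal (?e \<omega> (min s (?\<tau> \<omega>)))"
          using True lt s by (intro split) auto
        moreover have "?\<tau> \<omega> \<le> t" if "?\<tau> \<omega> \<le> s" using that s by auto
        ultimately show ?thesis
          using True by (cases "?\<tau> \<omega> \<le> s") (auto simp: \<phi>_def of_bool_def indicator_def min_def)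
      next
        case False
        then have "\<not> ?\<tau> \<omega> \<le> s" using last_hop_less[OF elim, of k] last_hop_less_hop_time[OF elim, of k] s by auto
        then show ?thesis using False by (auto simp: \<phi>_def of_bool_def)
      qed
    qed
  qed
  also have "\<dots> = I1 + ?I3"
    unfolding I1_eq by (rule nn_integral_add) (unfold of_bool_def, measurable)
  finally show ?thesis using I1_fin by (auto simp: ennreal_add_left_cancel)
qed

lemma survival_indicator:
  assumes C: "C \<in> sets (path_space k)" and s: "s \<in> {0..t}"
  shows "(\<integral>\<^sup>+\<omega>. of_bool (last_hop k \<omega> \<le> s \<and> s < hop_time (Suc k) \<omega>) * (indicator C (hops k \<omega>) * ennreal (inverse (survival k (hops k \<omega>) s))) \<partial>M)
    = (\<integral>\<^sup>+\<omega>. of_bool (last_hop k \<omega> \<le> s) * indicator C (hops k \<omega>) \<partial>M)"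
proof -
  define D where "D n = C \<inter> {x \<in> space (path_space k). exp (cumulated k x t) \<le> real n}" for n
  have Dm [measurable]: "D n \<in> sets (path_space k)" for n
    unfolding D_def by (rule sets.Int[OF C]) measurable
  have hsp: "hops k \<omega> \<in> space (path_space k)" for \<omega>
    by (auto simp: hops_eq path_space_def space_pair_measure space_PiM)
  have Dlim: "\<forall>\<^sub>F n in sequentially. indicator (D n) (hops k \<omega>) = (indicator C (hops k \<omega>) :: ennreal)" for \<omega>
    using eventually_ge_at_top[of "nat \<lceil>exp (cumulated k (hops k \<omega>) t)\<rceil>"]
  proof eventually_elim
    case (elim n)
    then have "exp (cumulated k (hops k \<omega>) t) \<le> real n" by linarith
    then show ?case using hsp by (auto simp: D_def indicator_def)
  qed
  have Dmono: "D n \<subseteq> D m" if "n \<le> m" for n m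
    using that by (auto simp: D_def intro: order_trans)
  have imono: "indicator (D n) x \<le> (indicator (D m) x :: ennreal)" if "n \<le> m" for n m x
    using Dmono[OF that] by (auto simp: indicator_def)
  have 1: "(\<lambda>n. \<integral>\<^sup>+\<omega>. of_bool (last_hop k \<omega> \<le> s \<and> s < hop_time (Suc k) \<omega>) * (indicator (D n) (hops k \<omega>) * ennreal (inverse (survival k (hops k \<omega>) s))) \<partial>M)
    \<longlonglongrightarrow> (\<integral>\<^sup>+\<omega>. of_bool (last_hop k \<omega> \<le> s \<and> s < hop_time (Suc k) \<omega>) * (indicator C (hops k \<omega>) * ennreal (inverse (survival k (hops k \<omega>) s))) \<partial>M)"
  proof (rule nn_integral_LIMSEQ)
    show "incseq (\<lambda>n \<omega>. of_bool (last_hop k \<omega> \<le> s \<and> s < hop_time (Suc k) \<omega>) * (indicator (D n) (hops k \<omega>) * ennreal (inverse (survival k (hops k \<omega>) s))))"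
      unfolding incseq_def le_fun_def by (intro allI impI mult_left_mono mult_right_mono imono) auto
    show "(\<lambda>\<omega>. of_bool (last_hop k \<omega> \<le> s \<and> s < hop_time (Suc k) \<omega>) * (indicator (D n) (hops k \<omega>) * ennreal (inverse (survival k (hops k \<omega>) s)))) \<in> borel_measurable M" for n
      unfolding of_bool_def by measurable
    show "(\<lambda>n. of_bool (last_hop k \<omega> \<le> s \<and> s < hop_time (Suc k) \<omega>) * (indicator (D n) (hops k \<omega>) * ennreal (inverse (survival k (hops k \<omega>) s))))
        \<longlonglongrightarrow> of_bool (last_hop k \<omega> \<le> s \<and> s < hop_time (Suc k) \<omega>) * (indicator C (hops k \<omega>) * ennreal (inverse (survival k (hops k \<omega>) s)))" for \<omega>
      using Dlim[of \<omega>] by (intro tendsto_eventually) (auto elim!: eventually_mono)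
  qed
  have 2: "(\<lambda>n. \<integral>\<^sup>+\<omega>. of_bool (last_hop k \<omega> \<le> s) * indicator (D n) (hops k \<omega>) \<partial>M)
    \<longlonglongrightarrow> (\<integral>\<^sup>+\<omega>. of_bool (last_hop k \<omega> \<le> s) * indicator C (hops k \<omega>) \<partial>M)"
  proof (rule nn_integral_LIMSEQ)
    show "incseq (\<lambda>n \<omega>. of_bool (last_hop k \<omega> \<le> s) * indicator (D n) (hops k \<omega>) :: ennreal)"
      unfolding incseq_def le_fun_def by (intro allI impI mult_left_mono imono) auto
    show "(\<lambda>\<omega>. of_bool (last_hop k \<omega> \<le> s) * indicator (D n) (hops k \<omega>) :: ennreal) \<in> borel_measurable M" for n
      unfolding of_bool_def by measurable
    show "(\<lambda>n. of_bool (last_hop k \<omega> \<le> s) * indicator (D n) (hops k \<omega>) :: ennreal)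
        \<longlonglongrightarrow> of_bool (last_hop k \<omega> \<le> s) * indicator C (hops k \<omega>)" for \<omega>
      using Dlim[of \<omega>] by (intro tendsto_eventually) (auto elim!: eventually_mono)
  qed
  have eq: "(\<integral>\<^sup>+\<omega>. of_bool (last_hop k \<omega> \<le> s \<and> s < hop_time (Suc k) \<omega>) * (indicator (D n) (hops k \<omega>) * ennreal (inverse (survival k (hops k \<omega>) s))) \<partial>M)
    = (\<integral>\<^sup>+\<omega>. of_bool (last_hop k \<omega> \<le> s) * indicator (D n) (hops k \<omega>) \<partial>M)" for n
    by (rule survival_on_bounded[OF Dm s, where N = "real n"]) (simp add: D_def)
  show ?thesis using 1 2 unfolding eq by (rule LIMSEQ_unique)
qed

text \<open>The waiting time for the next jump, given the jumps so far, has the survival function of its hazard rate. It is obtained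
by dividing \<open>survival_indicator\<close> by the inverse survival probability.\<close>

lemma survival_law:
  assumes \<psi>: "\<psi> \<in> borel_measurable (path_space k)" and s: "s \<in> {0..t}"
  shows "(\<integral>\<^sup>+\<omega>. of_bool (last_hop k \<omega> \<le> s \<and> s < hop_time (Suc k) \<omega>) * \<psi> (hops k \<omega>) \<partial>M)
    = (\<integral>\<^sup>+\<omega>. of_bool (last_hop k \<omega> \<le> s) * (\<psi> (hops k \<omega>) * ennreal (survival k (hops k \<omega>) s)) \<partial>M)"
proof -
  define f where "f \<omega> = of_bool (last_hop k \<omega> \<le> s \<and> s < hop_time (Suc k) \<omega>) * ennreal (inverse (survival k (hops k \<omega>) s))" for \<omega>
  define g where "g \<omega> = (of_bool (last_hop k \<omega> \<le> s) :: ennreal)" for \<omega>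
  have [measurable]: "f \<in> borel_measurable M" "g \<in> borel_measurable M"
    unfolding f_def[abs_def] g_def[abs_def] of_bool_def by measurable
  have eq: "distr (density M f) (path_space k) (hops k) = distr (density M g) (path_space k) (hops k)"
  proof (rule measure_eqI)
    fix C assume "C \<in> sets (distr (density M f) (path_space k) (hops k))"
    then have C: "C \<in> sets (path_space k)" by simp
    have em: "emeasure (distr (density M h) (path_space k) (hops k)) C = (\<integral>\<^sup>+\<omega>. h \<omega> * indicator C (hops k \<omega>) \<partial>M)"
      if [measurable]: "h \<in> borel_measurable M" for h
    proof -
      have "emeasure (distr (density M h) (path_space k) (hops k)) C
          = (\<integral>\<^sup>+x. indicator C x \<partial>distr (density M h) (path_space k) (hops k))" using C by simp
      also have "\<dots> = (\<integral>\<^sup>+\<omega>. indicator C (hops k \<omega>) \<partial>density M h)"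
        using C by (intro nn_integral_distr) auto
      also have "\<dots> = (\<integral>\<^sup>+\<omega>. h \<omega> * indicator C (hops k \<omega>) \<partial>M)"
        using C by (intro nn_integral_density) auto
      finally show ?thesis .
    qed
    have "(\<integral>\<^sup>+\<omega>. f \<omega> * indicator C (hops k \<omega>) \<partial>M) = (\<integral>\<^sup>+\<omega>. g \<omega> * indicator C (hops k \<omega>) \<partial>M)"
      unfolding f_def g_def survival_indicator[OF C s, symmetric] by (simp only: mult_ac)
    then show "emeasure (distr (density M f) (path_space k) (hops k)) C = emeasure (distr (density M g) (path_space k) (hops k)) C"
      by (simp add: em)
  qed simp
  have test: "(\<integral>\<^sup>+\<omega>. h \<omega> * \<theta> (hops k \<omega>) \<partial>M) = (\<integral>\<^sup>+x. \<theta> x \<partial>distr (density M h) (path_space k) (hops k))"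
    if [measurable]: "h \<in> borel_measurable M" "\<theta> \<in> borel_measurable (path_space k)" for h \<theta>
  proof -
    have "(\<integral>\<^sup>+x. \<theta> x \<partial>distr (density M h) (path_space k) (hops k)) = (\<integral>\<^sup>+\<omega>. \<theta> (hops k \<omega>) \<partial>density M h)"
      by (intro nn_integral_distr) auto
    also have "\<dots> = (\<integral>\<^sup>+\<omega>. h \<omega> * \<theta> (hops k \<omega>) \<partial>M)"
      by (intro nn_integral_density) auto
    finally show ?thesis by simp
  qed
  have [measurable]: "(\<lambda>x. \<psi> x * ennreal (survival k x s)) \<in> borel_measurable (path_space k)"
    using \<psi> by measurable
  have "of_bool (last_hop k \<omega> \<le> s \<and> s < hop_time (Suc k) \<omega>) * \<psi> (hops k \<omega>)
      = f \<omega> * (\<psi> (hops k \<omega>) * ennreal (survival k (hops k \<omega>) s))" for \<omega>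
  proof -
    have "ennreal (inverse (survival k (hops k \<omega>) s)) * ennreal (survival k (hops k \<omega>) s) = 1"
      using survival_pos[of k "hops k \<omega>" s] by (simp flip: ennreal_mult)
    moreover have "(a * e) * (p * c) = (a * p) * (e * c)" for a e p c :: ennreal by (simp only: mult_ac)
    ultimately show ?thesis unfolding f_def by (simp only: mult_1_right)
  qed
  then have "(\<integral>\<^sup>+\<omega>. of_bool (last_hop k \<omega> \<le> s \<and> s < hop_time (Suc k) \<omega>) * \<psi> (hops k \<omega>) \<partial>M)
      = (\<integral>\<^sup>+\<omega>. f \<omega> * (\<psi> (hops k \<omega>) * ennreal (survival k (hops k \<omega>) s)) \<partial>M)" by simp
  also have "\<dots> = (\<integral>\<^sup>+\<omega>. g \<omega> * (\<psi> (hops k \<omega>) * ennreal (survival k (hops k \<omega>) s)) \<partial>M)"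
    using test[of f "\<lambda>x. \<psi> x * ennreal (survival k x s)"] test[of g "\<lambda>x. \<psi> x * ennreal (survival k x s)"] eq by simp
  finally show ?thesis unfolding g_def .
qed

lemma hops_space: "hops k \<omega> \<in> space (path_space k)"
  by (auto simp: hops_eq path_space_def space_pair_measure space_PiM)

lemma start_distributed: "distributed M lborel start_point (\<lambda>z. ennreal (initial_density z))"
proof -
  have "distributed M lborel (\<lambda>\<omega>. (Qp 0 \<omega>, Pp 0 \<omega>))
       (\<lambda>(q, p). ennreal (cmod (init_amp \<epsilon> u0 q p) / (LINT z|lborel. cmod (init_amp \<epsilon> u0 (fst z) (snd z)))))"
    using process by (simp add: hopping_process_def)
  then show ?thesis
    by (simp add: start_point_def[abs_def] initial_density_def case_prod_unfold)
qed

lemma hop_law_0: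
  assumes \<phi>: "\<phi> \<in> borel_measurable (path_space 0)"
  shows "(\<integral>\<^sup>+\<omega>. of_bool (last_hop 0 \<omega> \<le> t) * \<phi> (hops 0 \<omega>) \<partial>M)
    = (\<integral>\<^sup>+x. \<phi> x * ennreal (hop_density 0 x) \<partial>path_space 0)"
proof -
  interpret P: product_sigma_finite "\<lambda>_::nat. lborel :: real measure" ..
  let ?u = "\<lambda>_::nat. undefined :: real"
  have hops0: "hops 0 \<omega> = (start_point \<omega>, ?u)" for \<omega>
    by (simp add: hops_eq restrict_def)
  have dens: "hop_density 0 (z, \<tau>) = initial_density z" for z \<tau>
    using t_nonneg by (simp add: hop_density_def time_simplex_iff last_time_def cumulated_eq)
  have "(\<lambda>z. (z, ?u)) \<in> lborel \<rightarrow>\<^sub>M (path_space 0 :: (((real^'m) \<times> (real^'m)) \<times> (nat \<Rightarrow> real)) measure)"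
    unfolding path_space_def by (intro measurable_Pair measurable_const) (auto simp: space_PiM)
  from measurable_compose[OF this \<phi>]
  have "(\<lambda>z. \<phi> (z, ?u)) \<in> borel_measurable lborel" .
  from distributed_nn_integral[OF start_distributed this]
  have "(\<integral>\<^sup>+\<omega>. \<phi> (start_point \<omega>, ?u) \<partial>M) = (\<integral>\<^sup>+z. ennreal (initial_density z) * \<phi> (z, ?u) \<partial>lborel)" by simp
  also have "\<dots> = (\<integral>\<^sup>+x. \<phi> x * ennreal (hop_density 0 x) \<partial>path_space 0)"
    using \<phi> by (subst path_space_nn_integral) (auto simp: dens P.nn_integral_empty mult.commute)
  finally show ?thesis using t_nonneg by (simp add: hops0 last_hop_def)
qed

text \<open>Disintegrate at the next jump time with \<open>jump_intensity\<close>; the condition that the jump is still pending becomes the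
survival probability by \<open>survival_law\<close>, and what remains is a function of the earlier jumps, to which the induction hypothesis applies.\<close>

lemma hop_law:
  "\<phi> \<in> borel_measurable (path_space n) \<Longrightarrow>
    (\<integral>\<^sup>+\<omega>. of_bool (last_hop n \<omega> \<le> t) * \<phi> (hops n \<omega>) \<partial>M)
      = (\<integral>\<^sup>+x. \<phi> x * ennreal (hop_density n x) \<partial>path_space n)"
proof (induction n arbitrary: \<phi>)
  case 0
  then show ?case by (rule hop_law_0)
next
  case (Suc n)
  let ?\<tau> = "hop_time (Suc n)"
  define \<phi>' where "\<phi>' p = \<phi> (fst (fst p), (snd (fst p))(Suc n := snd p))"
    for p :: "(((real^'m) \<times> (real^'m)) \<times> (nat \<Rightarrow> real)) \<times> real"
  have \<phi>': "\<phi>' \<in> borel_measurable (path_space n \<Otimes>\<^sub>M borel)"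
    unfolding \<phi>'_def[abs_def] by (rule measurable_compose[OF measurable_extend_path Suc.prems])
  have \<phi>'m [measurable (raw)]: "(\<lambda>y. \<phi>' (f y, g y)) \<in> borel_measurable N"
    if "f \<in> N \<rightarrow>\<^sub>M path_space n" "g \<in> borel_measurable N" for f g N
    using measurable_compose[OF measurable_Pair[OF that] \<phi>'] .
  have lt [measurable (raw)]: "(\<lambda>y. last_time n (snd (f y))) \<in> borel_measurable N"
    if "f \<in> N \<rightarrow>\<^sub>M path_space n" for f and N :: "'z measure"
    by (rule measurable_compose[OF that last_time_measurable])
  define \<psi> where "\<psi> u x = of_bool (0 < u \<and> u < t \<and> last_time n (snd x) < u) * (\<phi>' (x, u) * ennreal (intensity n x u))" for u x
  have \<psi>m: "(\<lambda>y. \<psi> (g y) (f y)) \<in> borel_measurable N"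
    if [measurable]: "f \<in> N \<rightarrow>\<^sub>M path_space n" "g \<in> borel_measurable N" for f g and N :: "'z measure"
    unfolding \<psi>_def of_bool_def using lt[OF that(1)] by measurable
  have "(\<integral>\<^sup>+\<omega>. of_bool (last_hop (Suc n) \<omega> \<le> t) * \<phi> (hops (Suc n) \<omega>) \<partial>M)
      = (\<integral>\<^sup>+\<omega>. of_bool (?\<tau> \<omega> \<le> t) * \<phi>' (hops n \<omega>, ?\<tau> \<omega>) \<partial>M)"
    by (simp add: \<phi>'_def hops_Suc last_hop_def) (simp add: hops_eq)
  also have "\<dots> = (\<integral>\<^sup>+p. of_bool (0 < snd p \<and> snd p \<le> t \<and> last_hop n (fst p) < snd p \<and> snd p \<le> ?\<tau> (fst p))
        * (\<phi>' (hops n (fst p), snd p) * ennreal (intensity n (hops n (fst p)) (snd p))) \<partial>(M \<Otimes>\<^sub>M lborel))"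
    by (rule jump_intensity[OF \<phi>'])
  also have "\<dots> = (\<integral>\<^sup>+\<omega>. \<integral>\<^sup>+u. of_bool (0 < u \<and> u \<le> t \<and> last_hop n \<omega> < u \<and> u \<le> ?\<tau> \<omega>)
        * (\<phi>' (hops n \<omega>, u) * ennreal (intensity n (hops n \<omega>) u)) \<partial>lborel \<partial>M)"
  proof -
    have m: "(\<lambda>p. of_bool (0 < snd p \<and> snd p \<le> t \<and> last_hop n (fst p) < snd p \<and> snd p \<le> ?\<tau> (fst p))
        * (\<phi>' (hops n (fst p), snd p) * ennreal (intensity n (hops n (fst p)) (snd p)))) \<in> borel_measurable (M \<Otimes>\<^sub>M lborel)"
      unfolding of_bool_def by measurable
    show ?thesis using lborel.nn_integral_fst[OF m] by (simp only: fst_conv snd_conv)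
  qed
  \<comment> \<open>Strict and weak inequalities are interchanged here: the boundary cases concern single times \<open>u\<close>.\<close>
  also have "\<dots> = (\<integral>\<^sup>+\<omega>. \<integral>\<^sup>+u. of_bool (last_hop n \<omega> \<le> u \<and> u < ?\<tau> \<omega>) * \<psi> u (hops n \<omega>) \<partial>lborel \<partial>M)"
  proof (rule nn_integral_cong, rule nn_integral_cong_AE)
    fix \<omega>
    show "AE u in lborel. of_bool (0 < u \<and> u \<le> t \<and> last_hop n \<omega> < u \<and> u \<le> ?\<tau> \<omega>)
        * (\<phi>' (hops n \<omega>, u) * ennreal (intensity n (hops n \<omega>) u))
        = of_bool (last_hop n \<omega> \<le> u \<and> u < ?\<tau> \<omega>) * \<psi> u (hops n \<omega>)"
      using AE_lborel_singleton[of t] AE_lborel_singleton[of "?\<tau> \<omega>"]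
      by eventually_elim (auto simp: \<psi>_def last_time_hops of_bool_def)
  qed
  also have "\<dots> = (\<integral>\<^sup>+u. \<integral>\<^sup>+\<omega>. of_bool (last_hop n \<omega> \<le> u \<and> u < ?\<tau> \<omega>) * \<psi> u (hops n \<omega>) \<partial>M \<partial>lborel)"
  proof -
    have "(\<lambda>p. \<psi> (snd p) (hops n (fst p))) \<in> borel_measurable (M \<Otimes>\<^sub>M lborel)"
      by (rule \<psi>m) measurable
    then have m: "(\<lambda>p. of_bool (last_hop n (fst p) \<le> snd p \<and> snd p < ?\<tau> (fst p)) * \<psi> (snd p) (hops n (fst p))) \<in> borel_measurable (M \<Otimes>\<^sub>M lborel)"
      unfolding of_bool_def by measurable
    show ?thesis using lborel.nn_integral_fst[OF m] time.nn_integral_snd[OF m] by (simp only: fst_conv snd_conv)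
  qed
  also have "\<dots> = (\<integral>\<^sup>+u. \<integral>\<^sup>+\<omega>. of_bool (last_hop n \<omega> \<le> u) * (\<psi> u (hops n \<omega>) * ennreal (survival n (hops n \<omega>) u)) \<partial>M \<partial>lborel)"
  proof (rule nn_integral_cong)
    fix u
    show "(\<integral>\<^sup>+\<omega>. of_bool (last_hop n \<omega> \<le> u \<and> u < ?\<tau> \<omega>) * \<psi> u (hops n \<omega>) \<partial>M)
        = (\<integral>\<^sup>+\<omega>. of_bool (last_hop n \<omega> \<le> u) * (\<psi> u (hops n \<omega>) * ennreal (survival n (hops n \<omega>) u)) \<partial>M)"
    proof (cases "u \<in> {0..t}")
      case True
      have "\<psi> u \<in> borel_measurable (path_space n)" by (rule \<psi>m) measurable
      from survival_law[OF this True] show ?thesis .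
    next
      case False
      then have "\<psi> u x = 0" for x by (auto simp: \<psi>_def of_bool_def)
      then show ?thesis by simp
    qed
  qed
  also have "\<dots> = (\<integral>\<^sup>+\<omega>. \<integral>\<^sup>+u. of_bool (last_hop n \<omega> \<le> u) * (\<psi> u (hops n \<omega>) * ennreal (survival n (hops n \<omega>) u)) \<partial>lborel \<partial>M)"
  proof -
    have [measurable]: "(\<lambda>p. \<psi> (snd p) (hops n (fst p))) \<in> borel_measurable (M \<Otimes>\<^sub>M lborel)"
      by (rule \<psi>m) measurable
    have m: "(\<lambda>p. of_bool (last_hop n (fst p) \<le> snd p) * (\<psi> (snd p) (hops n (fst p)) * ennreal (survival n (hops n (fst p)) (snd p))))
        \<in> borel_measurable (M \<Otimes>\<^sub>M lborel)"
      unfolding of_bool_def by measurable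
    show ?thesis using lborel.nn_integral_fst[OF m] time.nn_integral_snd[OF m] by (simp only: fst_conv snd_conv)
  qed
  also have "\<dots> = (\<integral>\<^sup>+\<omega>. of_bool (last_hop n \<omega> \<le> t) * (\<integral>\<^sup>+u. \<psi> u (hops n \<omega>) * ennreal (survival n (hops n \<omega>) u) \<partial>lborel) \<partial>M)"
  proof (rule nn_integral_cong)
    fix \<omega>
    have [measurable]: "(\<lambda>u. hops n \<omega>) \<in> lborel \<rightarrow>\<^sub>M path_space n" by (simp add: hops_space)
    have [measurable]: "(\<lambda>u. \<psi> u (hops n \<omega>)) \<in> borel_measurable lborel" by (rule \<psi>m) measurable
    have "(\<integral>\<^sup>+u. of_bool (last_hop n \<omega> \<le> u) * (\<psi> u (hops n \<omega>) * ennreal (survival n (hops n \<omega>) u)) \<partial>lborel)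
        = (\<integral>\<^sup>+u. of_bool (last_hop n \<omega> \<le> t) * (\<psi> u (hops n \<omega>) * ennreal (survival n (hops n \<omega>) u)) \<partial>lborel)"
      by (intro nn_integral_cong) (auto simp: \<psi>_def last_time_hops of_bool_def)
    also have "\<dots> = of_bool (last_hop n \<omega> \<le> t) * (\<integral>\<^sup>+u. \<psi> u (hops n \<omega>) * ennreal (survival n (hops n \<omega>) u) \<partial>lborel)"
      by (rule nn_integral_cmult) measurable
    finally show "(\<integral>\<^sup>+u. of_bool (last_hop n \<omega> \<le> u) * (\<psi> u (hops n \<omega>) * ennreal (survival n (hops n \<omega>) u)) \<partial>lborel)
        = of_bool (last_hop n \<omega> \<le> t) * (\<integral>\<^sup>+u. \<psi> u (hops n \<omega>) * ennreal (survival n (hops n \<omega>) u) \<partial>lborel)" .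
  qed
  also have "\<dots> = (\<integral>\<^sup>+x. (\<integral>\<^sup>+u. \<psi> u x * ennreal (survival n x u) \<partial>lborel) * ennreal (hop_density n x) \<partial>path_space n)"
  proof (rule Suc.IH)
    have [measurable]: "(\<lambda>p. \<psi> (snd p) (fst p)) \<in> borel_measurable (path_space n \<Otimes>\<^sub>M lborel)"
      by (rule \<psi>m) measurable
    have "case_prod (\<lambda>x u. \<psi> u x * ennreal (survival n x u)) \<in> borel_measurable (path_space n \<Otimes>\<^sub>M lborel)"
      unfolding case_prod_unfold by measurable
    then show "(\<lambda>x. \<integral>\<^sup>+u. \<psi> u x * ennreal (survival n x u) \<partial>lborel) \<in> borel_measurable (path_space n)"
      by (rule lborel.borel_measurable_nn_integral)
  qed
  also have "\<dots> = (\<integral>\<^sup>+x. \<integral>\<^sup>+u. \<phi> (fst x, (snd x)(Suc n := u)) * ennreal (hop_density (Suc n) (fst x, (snd x)(Suc n := u))) \<partial>lborel \<partial>path_space n)"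
  proof (rule nn_integral_cong)
    fix x :: "((real^'m) \<times> (real^'m)) \<times> (nat \<Rightarrow> real)" assume x: "x \<in> space (path_space n)"
    have [measurable]: "(\<lambda>u. x) \<in> lborel \<rightarrow>\<^sub>M path_space n" by (simp add: x)
    have [measurable]: "(\<lambda>u. \<psi> u x) \<in> borel_measurable lborel" by (rule \<psi>m) measurable
    have "(\<integral>\<^sup>+u. \<psi> u x * ennreal (survival n x u) \<partial>lborel) * ennreal (hop_density n x)
        = (\<integral>\<^sup>+u. \<psi> u x * ennreal (survival n x u) * ennreal (hop_density n x) \<partial>lborel)"
      by (rule nn_integral_multc[symmetric]) measurable
    also have "\<dots> = (\<integral>\<^sup>+u. \<phi> (fst x, (snd x)(Suc n := u)) * ennreal (hop_density (Suc n) (fst x, (snd x)(Suc n := u))) \<partial>lborel)"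
    proof (rule nn_integral_cong)
      fix u
      show "\<psi> u x * ennreal (survival n x u) * ennreal (hop_density n x)
          = \<phi> (fst x, (snd x)(Suc n := u)) * ennreal (hop_density (Suc n) (fst x, (snd x)(Suc n := u)))"
      proof (cases "last_time n (snd x) < u \<and> u < t \<and> snd x \<in> time_simplex n t")
        case True
        then have "0 < u" using last_time_bounds(1)[of "snd x" n] by auto
        have "ennreal (hop_density (Suc n) (fst x, (snd x)(Suc n := u)))
            = ennreal (hop_density n x) * ennreal (intensity n x u) * ennreal (survival n x u)"
          using True by (simp add: hop_density_extend survival_def ennreal_mult hop_density_nonneg intensity_nonneg)
        then show ?thesis using True \<open>0 < u\<close> by (simp add: \<psi>_def \<phi>'_def mult_ac)
      next
        case False
        have "hop_density (Suc n) (fst x, (snd x)(Suc n := u)) = 0"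
          unfolding hop_density_extend using False by (auto simp: hop_density_def[of n x])
        moreover have "\<psi> u x = 0 \<or> hop_density n x = 0"
          using False by (auto simp: \<psi>_def hop_density_def[of n x])
        ultimately show ?thesis by auto
      qed
    qed
    finally show "(\<integral>\<^sup>+u. \<psi> u x * ennreal (survival n x u) \<partial>lborel) * ennreal (hop_density n x)
        = (\<integral>\<^sup>+u. \<phi> (fst x, (snd x)(Suc n := u)) * ennreal (hop_density (Suc n) (fst x, (snd x)(Suc n := u))) \<partial>lborel)" .
  qed
  also have "\<dots> = (\<integral>\<^sup>+x. \<phi> x * ennreal (hop_density (Suc n) x) \<partial>path_space (Suc n))"
  proof (rule path_space_Suc_nn_integral[symmetric])
    note [measurable] = Suc.prems hop_density_measurable[of "Suc n"]
    show "(\<lambda>x. \<phi> x * ennreal (hop_density (Suc n) x)) \<in> borel_measurable (path_space (Suc n))" by measurable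
  qed
  finally show ?case .
qed


section \<open>Paths with a given number of jumps\<close>

definition n_hops :: "nat \<Rightarrow> 'w \<Rightarrow> bool" where
  "n_hops n \<omega> \<longleftrightarrow> last_hop n \<omega> \<le> t \<and> t < hop_time (Suc n) \<omega>"

text \<open>The density on the event of exactly \<open>n\<close> jumps: no jump follows the last one up to time \<open>t\<close>.\<close>

definition path_density :: "nat \<Rightarrow> ((real^'m) \<times> (real^'m)) \<times> (nat \<Rightarrow> real) \<Rightarrow> real" where
  "path_density n x = hop_density n x * survival n x t"

lemma path_density_nonneg: "0 \<le> path_density n x"
  using hop_density_nonneg survival_pos[of n x t] by (simp add: path_density_def less_imp_le)

lemma path_density_measurable [measurable]: "path_density n \<in> borel_measurable (path_space n)"
  unfolding path_density_def[abs_def] by measurable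

lemma n_hops_measurable [measurable]: "Measurable.pred M (n_hops n)"
  unfolding n_hops_def by measurable

lemma path_law:
  "distr (density M (\<lambda>\<omega>. ennreal (of_bool (n_hops n \<omega>)))) (path_space n) (hops n)
    = density (path_space n) (\<lambda>x. ennreal (path_density n x))"
proof (rule measure_eqI)
  fix C assume "C \<in> sets (distr (density M (\<lambda>\<omega>. ennreal (of_bool (n_hops n \<omega>)))) (path_space n) (hops n))"
  then have C [measurable]: "C \<in> sets (path_space n)" by simp
  have "emeasure (distr (density M (\<lambda>\<omega>. ennreal (of_bool (n_hops n \<omega>)))) (path_space n) (hops n)) C
      = (\<integral>\<^sup>+x. indicator C x \<partial>distr (density M (\<lambda>\<omega>. ennreal (of_bool (n_hops n \<omega>)))) (path_space n) (hops n))" by simp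
  also have "\<dots> = (\<integral>\<^sup>+\<omega>. indicator C (hops n \<omega>) \<partial>density M (\<lambda>\<omega>. ennreal (of_bool (n_hops n \<omega>))))"
    by (rule nn_integral_distr) auto
  also have "\<dots> = (\<integral>\<^sup>+\<omega>. ennreal (of_bool (n_hops n \<omega>)) * indicator C (hops n \<omega>) \<partial>M)"
    by (rule nn_integral_density) measurable
  also have "\<dots> = (\<integral>\<^sup>+\<omega>. of_bool (last_hop n \<omega> \<le> t \<and> t < hop_time (Suc n) \<omega>) * indicator C (hops n \<omega>) \<partial>M)"
    by (intro nn_integral_cong) (simp add: n_hops_def of_bool_def)
  also have "\<dots> = (\<integral>\<^sup>+\<omega>. of_bool (last_hop n \<omega> \<le> t) * (indicator C (hops n \<omega>) * ennreal (survival n (hops n \<omega>) t)) \<partial>M)"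
    using t_nonneg by (intro survival_law) auto
  also have "\<dots> = (\<integral>\<^sup>+x. indicator C x * ennreal (survival n x t) * ennreal (hop_density n x) \<partial>path_space n)"
    by (rule hop_law) measurable
  also have "\<dots> = (\<integral>\<^sup>+x. ennreal (path_density n x) * indicator C x \<partial>path_space n)"
    by (intro nn_integral_cong) (simp add: path_density_def ennreal_mult hop_density_nonneg survival_pos less_imp_le mult_ac)
  also have "\<dots> = emeasure (density (path_space n) (\<lambda>x. ennreal (path_density n x))) C"
    by (rule emeasure_density[symmetric]) measurable
  finally show "emeasure (distr (density M (\<lambda>\<omega>. ennreal (of_bool (n_hops n \<omega>)))) (path_space n) (hops n)) C
      = emeasure (density (path_space n) (\<lambda>x. ennreal (path_density n x))) C" .
qed simp

lemma path_expectation: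
  fixes H :: "_ \<Rightarrow> complex"
  assumes H: "H \<in> borel_measurable (path_space n)"
  shows "integrable M (\<lambda>\<omega>. of_bool (n_hops n \<omega>) *\<^sub>R H (hops n \<omega>)) \<longleftrightarrow> integrable (path_space n) (\<lambda>x. path_density n x *\<^sub>R H x)"
    and "(LINT \<omega>|M. of_bool (n_hops n \<omega>) *\<^sub>R H (hops n \<omega>)) = (LINT x|path_space n. path_density n x *\<^sub>R H x)"
proof -
  let ?D = "density M (\<lambda>\<omega>. ennreal (of_bool (n_hops n \<omega>)))"
  have hm: "hops n \<in> ?D \<rightarrow>\<^sub>M path_space n" by simp
  have Hm: "(\<lambda>\<omega>. H (hops n \<omega>)) \<in> borel_measurable M" by (rule measurable_compose[OF hops_measurable H])
  have [measurable]: "(\<lambda>\<omega>. of_bool (n_hops n \<omega>) :: real) \<in> borel_measurable M" unfolding of_bool_def by measurable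
  have "integrable M (\<lambda>\<omega>. of_bool (n_hops n \<omega>) *\<^sub>R H (hops n \<omega>)) \<longleftrightarrow> integrable ?D (\<lambda>\<omega>. H (hops n \<omega>))"
    using Hm by (intro integrable_density[symmetric]) auto
  also have "\<dots> \<longleftrightarrow> integrable (distr ?D (path_space n) (hops n)) H"
    by (rule integrable_distr_eq[OF hm H, symmetric])
  also have "\<dots> \<longleftrightarrow> integrable (path_space n) (\<lambda>x. path_density n x *\<^sub>R H x)"
    unfolding path_law using H path_density_nonneg by (intro integrable_density) auto
  finally show "integrable M (\<lambda>\<omega>. of_bool (n_hops n \<omega>) *\<^sub>R H (hops n \<omega>)) \<longleftrightarrow> integrable (path_space n) (\<lambda>x. path_density n x *\<^sub>R H x)" .
  have "(LINT \<omega>|M. of_bool (n_hops n \<omega>) *\<^sub>R H (hops n \<omega>)) = (LINT \<omega>|?D. H (hops n \<omega>))"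
    using Hm by (intro integral_density[symmetric]) auto
  also have "\<dots> = (LINT x|distr ?D (path_space n) (hops n). H x)"
    by (rule integral_distr[OF hm H, symmetric])
  also have "\<dots> = (LINT x|path_space n. path_density n x *\<^sub>R H x)"
    unfolding path_law using H path_density_nonneg by (intro integral_density) auto
  finally show "(LINT \<omega>|M. of_bool (n_hops n \<omega>) *\<^sub>R H (hops n \<omega>)) = (LINT x|path_space n. path_density n x *\<^sub>R H x)" .
qed

text \<open>The ansatz has hopping times strictly before \<open>t\<close>, whereas the path may in principle jump at \<open>t\<close>. The law of the jump times has a
density supported on the open simplex, so that this has probability zero.\<close>

lemma AE_no_hop_at_end: "AE \<omega> in M. \<forall>n. last_hop n \<omega> = t \<longrightarrow> n = 0"
proof -
  have "AE \<omega> in M. last_hop n \<omega> = t \<longrightarrow> n = 0" for n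
  proof (cases "n = 0")
    case False
    have m: "(\<lambda>x. of_bool (last_time n (snd x) = t) :: ennreal) \<in> borel_measurable (path_space n)"
      unfolding of_bool_def by measurable
    have "(\<integral>\<^sup>+\<omega>. of_bool (last_hop n \<omega> \<le> t) * of_bool (last_time n (snd (hops n \<omega>)) = t) \<partial>M)
        = (\<integral>\<^sup>+x. of_bool (last_time n (snd x) = t) * ennreal (hop_density n x) \<partial>path_space n)"
      by (rule hop_law[OF m])
    also have "\<dots> = (\<integral>\<^sup>+x. 0 \<partial>(path_space n :: (((real^'m) \<times> (real^'m)) \<times> (nat \<Rightarrow> real)) measure))"
    proof (rule nn_integral_cong)
      fix x :: "((real^'m) \<times> (real^'m)) \<times> (nat \<Rightarrow> real)"
      have "last_time n (snd x) < t" if "snd x \<in> time_simplex n t"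
        using time_simplexD(2)[OF that, of n] False by (simp add: last_time_def)
      then show "of_bool (last_time n (snd x) = t) * ennreal (hop_density n x) = 0"
        by (auto simp: hop_density_def of_bool_def)
    qed
    finally have zero: "(\<integral>\<^sup>+\<omega>. of_bool (last_hop n \<omega> \<le> t) * of_bool (last_hop n \<omega> = t) \<partial>M) = 0"
      by (simp add: last_time_hops)
    have "(\<lambda>\<omega>. of_bool (last_hop n \<omega> \<le> t) * of_bool (last_hop n \<omega> = t) :: ennreal) \<in> borel_measurable M"
      unfolding of_bool_def by measurable
    then have "AE \<omega> in M. (of_bool (last_hop n \<omega> \<le> t) * of_bool (last_hop n \<omega> = t) :: ennreal) = 0"
      using zero by (simp only: nn_integral_0_iff_AE)
    then show ?thesis by eventually_elim (auto simp: of_bool_def split: if_splits)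
  qed simp
  then show ?thesis unfolding AE_all_countable by blast
qed

text \<open>If the integral were zero, be it by vanishing amplitude or by divergence, the initial density would be zero, which
contradicts total mass one.\<close>

lemma normalization_neq_0: "(LINT z|lborel. cmod (init_amp \<epsilon> u0 (fst z) (snd z))) \<noteq> 0"
proof
  assume "(LINT z|lborel. cmod (init_amp \<epsilon> u0 (fst z) (snd z))) = 0"
  then have "initial_density z = 0" for z by (simp add: initial_density_def)
  then have dens: "hop_density 0 x = 0" for x by (simp add: hop_density_def)
  have "(\<integral>\<^sup>+\<omega>. of_bool (last_hop 0 \<omega> \<le> t) * 1 \<partial>M) = (\<integral>\<^sup>+x. 1 * ennreal (hop_density 0 x) \<partial>path_space 0)"
    by (rule hop_law_0[of "\<lambda>_. 1"]) simp
  then show False using t_nonneg by (simp add: dens last_hop_def emeasure_space_1)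
qed


section \<open>Trajectory average and ansatz\<close>

definition realized :: "real^'m \<Rightarrow> 'w \<Rightarrow> complex \<times> complex" where
  "realized y = avg_integrand V \<epsilon> \<delta> u0 t Q P S A Qp Pp l y"

definition realized_weight :: "real^'m \<Rightarrow> 'w \<Rightarrow> complex" where
  "realized_weight y \<omega> = fst (realized y \<omega>) + snd (realized y \<omega>)"

lemma n_hops_iff:
  assumes "good \<omega>"
  shows "n_hops n \<omega> \<longleftrightarrow> level_path.count t (\<lambda>s. l s \<omega>) t = n"
  using level_path.count_eq_iff[OF good_level_path[OF assms], of t n] t_nonneg
  by (simp add: n_hops_def last_hop_eq last_time_def hop_time_eq_tau[OF assms])

lemma sorted_jumps_hops:
  assumes good: "good \<omega>" and n: "n_hops n \<omega>"
  shows "sorted_list_of_set (jump_set t (\<lambda>s. l s \<omega>)) = times n (snd (hops n \<omega>))"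
proof -
  have c: "level_path.count t (\<lambda>s. l s \<omega>) t = n" using n_hops_iff[OF good] n by simp
  show ?thesis
    using level_path.jumps_eq_tau[OF good_level_path[OF good]]
    unfolding times_hops c by (simp only: hop_time_eq_tau[OF good])
qed

text \<open>The realized path follows the deterministic trajectory with the same jump times. The modulus of the coupling is the same for both
directions of a hop since the potential is Hermitian.\<close>

lemma realized_eq_path_weight:
  assumes good: "good \<omega>" and n: "n_hops n \<omega>" and end_time: "last_hop n \<omega> = t \<longrightarrow> n = 0"
  shows "realized y \<omega> = (path_weight y n (hops n \<omega>) * of_bool (even n), path_weight y n (hops n \<omega>) * of_bool (odd n))"
proof -
  let ?x = "hops n \<omega>" and ?\<tau> = "\<lambda>i. hop_time i \<omega>" and ?q = "Qp 0 \<omega>" and ?p = "Pp 0 \<omega>"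
  let ?ts = "times n (snd ?x)"
  have last: "last_hop n \<omega> < t \<or> n = 0" using n end_time by (auto simp: n_hops_def)
  have simplex: "snd ?x \<in> time_simplex n t" by (rule hops_simplex[OF good last])
  have hop: "hop_times t ?ts" using simplex by (simp add: time_simplex_def)
  have start: "fst ?x = (?q, ?p)" by (simp add: hop_history_def start_point_def)
  have st: "(Qp s \<omega>, Pp s \<omega>) = state ?ts (?q, ?p) s" if "s \<in> {0..t}" for s
    using state_hops[OF good that last] that n unfolding start by (simp add: n_hops_def)
  have Qst: "Qp s \<omega> = Q ?ts ?q ?p s" if "s \<in> {0..t}" for s
    using st[OF that] by (simp add: state_def del: upt_Suc)
  have \<tau>: "snd ?x j = ?\<tau> j" if "j \<in> {1..n}" for j using that by (simp add: hops_eq)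
  have \<tau>t: "?\<tau> j \<in> {0..t}" if "j \<in> {1..n}" for j
    using time_simplexD[OF simplex that] \<tau>[OF that] by simp
  have int: "intensity n ?x s = \<delta> / \<epsilon> * cmod (V 0 1 (Q ?ts ?q ?p s))" if "s \<in> {0..t}" for s
    using that simplex by (simp add: intensity_def hop_region_def start state_def del: upt_Suc)
  have cum: "integral {0..t} (\<lambda>s. \<delta> / \<epsilon> * cmod (V 0 1 (Qp s \<omega>))) = cumulated n ?x t"
  proof -
    have "integral {0..t} (\<lambda>s. \<delta> / \<epsilon> * cmod (V 0 1 (Qp s \<omega>))) = integral {0..t} (intensity n ?x)"
    proof (rule Henstock_Kurzweil_Integration.integral_cong)
      fix s assume s: "s \<in> {0..t}"
      show "\<delta> / \<epsilon> * cmod (V 0 1 (Qp s \<omega>)) = intensity n ?x s" by (simp only: int[OF s] Qst[OF s])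
    qed
    then show ?thesis using t_nonneg by (simp add: cumulated_eq)
  qed
  have lev: "l (?\<tau> j) \<omega> = j mod 2" if "j \<in> {1..n}" for j
  proof (rule good_level[OF good \<tau>t[OF that]])
    show "last_hop j \<omega> \<le> ?\<tau> j" using that by (simp add: last_hop_def)
    show "?\<tau> j < hop_time (Suc j) \<omega>"
      using last_hop_less[OF good, of j] \<tau>t[OF that] that by (simp add: last_hop_def)
  qed
  have l0: "l 0 \<omega> = 0" using good by (simp add: good_def hopping_path_def)
  have c: "cmod (V (j mod 2) ((j - 1) mod 2) z) = cmod (V 0 1 z)" if "j \<in> {1..n}" for j z
  proof -
    have "odd j \<noteq> odd (j - 1)" using that by (cases j) auto
    then have "j mod 2 \<noteq> (j - 1) mod 2" by (metis even_iff_mod_2_eq_zero)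
    then show ?thesis by (intro V_offdiag_norm) auto
  qed
  have hp: "hop_prod (\<lambda>j k y. V j k y / complex_of_real (cmod (V j k y))) ?ts (\<lambda>s. l s \<omega>) (\<lambda>s. Qp s \<omega>)
      = hop_prod V ?ts (level ?ts) (Q ?ts ?q ?p) / complex_of_real (\<Prod>j=1..n. cmod (V 0 1 (Q ?ts ?q ?p (snd ?x j))))"
  proof -
    have "hop_prod (\<lambda>j k y. V j k y / complex_of_real (cmod (V j k y))) ?ts (\<lambda>s. l s \<omega>) (\<lambda>s. Qp s \<omega>)
        = (\<Prod>j=1..n. V (j mod 2) ((j - 1) mod 2) (Qp (snd ?x j) \<omega>) / complex_of_real (cmod (V (j mod 2) ((j - 1) mod 2) (Qp (snd ?x j) \<omega>))))"
      by (rule hop_prod_times) (simp_all add: l0 \<tau> lev)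
    also have "\<dots> = (\<Prod>j=1..n. V (j mod 2) ((j - 1) mod 2) (Q ?ts ?q ?p (snd ?x j)) / complex_of_real (cmod (V 0 1 (Q ?ts ?q ?p (snd ?x j)))))"
    proof (rule prod.cong)
      fix j assume j: "j \<in> {1..n}"
      have "Qp (snd ?x j) \<omega> = Q ?ts ?q ?p (snd ?x j)" using \<tau>[OF j] \<tau>t[OF j] by (intro Qst) simp
      then show "V (j mod 2) ((j - 1) mod 2) (Qp (snd ?x j) \<omega>) / complex_of_real (cmod (V (j mod 2) ((j - 1) mod 2) (Qp (snd ?x j) \<omega>)))
          = V (j mod 2) ((j - 1) mod 2) (Q ?ts ?q ?p (snd ?x j)) / complex_of_real (cmod (V 0 1 (Q ?ts ?q ?p (snd ?x j))))"
        by (simp only: c[OF j])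
    qed simp
    also have "\<dots> = (\<Prod>j=1..n. V (j mod 2) ((j - 1) mod 2) (Q ?ts ?q ?p (snd ?x j))) / complex_of_real (\<Prod>j=1..n. cmod (V 0 1 (Q ?ts ?q ?p (snd ?x j))))"
      by (simp only: prod_dividef of_real_prod)
    also have "(\<Prod>j=1..n. V (j mod 2) ((j - 1) mod 2) (Q ?ts ?q ?p (snd ?x j))) = hop_prod V ?ts (level ?ts) (Q ?ts ?q ?p)"
      by (rule hop_prod_times[symmetric]) (use level_start[OF hop] level_at_hop[OF simplex] in \<open>simp_all del: upt_Suc\<close>)
    finally show ?thesis .
  qed
  have ip: "(\<Prod>j=1..n. intensity n ?x (snd ?x j)) = (\<delta> / \<epsilon>) ^ n * (\<Prod>j=1..n. cmod (V 0 1 (Q ?ts ?q ?p (snd ?x j))))"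
  proof -
    have "(\<Prod>j=1..n. intensity n ?x (snd ?x j)) = (\<Prod>j=1..n. \<delta> / \<epsilon> * cmod (V 0 1 (Q ?ts ?q ?p (snd ?x j))))"
      using \<tau> \<tau>t by (intro prod.cong int) auto
    then show ?thesis by (simp only: prod.distrib prod_constant card_atLeastAtMost diff_Suc_1)
  qed
  have cancel: "(- \<i>) ^ n * (h / complex_of_real w) * (b / complex_of_real a) * e * g
      = (- \<i> * \<delta> / \<epsilon>) ^ n * (h * b * e) / complex_of_real ((\<delta> / \<epsilon>) ^ n * w * a) * g" for h b e g :: complex and w a :: real
  proof -
    have "- \<i> * complex_of_real \<delta> / complex_of_real \<epsilon> = - \<i> * complex_of_real (\<delta> / \<epsilon>)" by simp
    then have p: "(- \<i> * complex_of_real \<delta> / complex_of_real \<epsilon>) ^ n = (- \<i>) ^ n * complex_of_real ((\<delta> / \<epsilon>) ^ n)"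
      by (simp only: power_mult_distrib of_real_power)
    have "complex_of_real ((\<delta> / \<epsilon>) ^ n) \<noteq> 0" using eps_pos delta_pos by simp
    then show ?thesis using eps_pos delta_pos unfolding p of_real_mult by (cases "w = 0"; cases "a = 0") (simp_all add: field_simps del: of_real_power of_real_divide)
  qed
  have "path_weight y n ?x = (- \<i>) ^ n
             * hop_prod (\<lambda>j k y. V j k y / complex_of_real (cmod (V j k y))) ?ts (\<lambda>s. l s \<omega>) (\<lambda>s. Qp s \<omega>)
             * (A ?ts ?q ?p t / complex_of_real (cmod (init_amp \<epsilon> u0 ?q ?p)))
             * exp (\<i> / \<epsilon> * phase (S ?ts ?q ?p t) (P ?ts ?q ?p t) (Q ?ts ?q ?p t) y)
             * complex_of_real (exp (integral {0..t} (\<lambda>s. \<delta> / \<epsilon> * cmod (V 0 1 (Qp s \<omega>)))))"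
    unfolding path_weight_def if_P[OF simplex] uF_integrand_def hp ip cum start fst_conv snd_conv cancel ..
  moreover have "length ?ts = n" by simp
  ultimately show ?thesis
    unfolding realized_def avg_integrand_def Let_def sorted_jumps_hops[OF good n] by (simp only:)
qed

lemma path_density_times_weight:
  "path_density n x *\<^sub>R path_weight y n x = (- \<i> * \<delta> / \<epsilon>) ^ n / complex_of_real (LINT z|lborel. cmod (init_amp \<epsilon> u0 (fst z) (snd z)))
     * (indicator (time_simplex n t) (snd x) *\<^sub>R uF_integrand V \<epsilon> t Q P S A y (fst (fst x)) (snd (fst x)) (times n (snd x)))"
proof (cases "snd x \<in> time_simplex n t")
  case True
  have "path_density n x = initial_density (fst x) * (\<Prod>j=1..n. intensity n x (snd x j)) * exp (- cumulated n x t)"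
    unfolding path_density_def hop_density_def if_P[OF True] survival_def mult.assoc exp_add[symmetric] by simp
  then show ?thesis
    using density_times_weight[OF True, of y] True by (simp add: scaleR_conv_of_real del: upt_Suc of_real_mult)
next
  case False
  then show ?thesis by (simp add: path_density_def hop_density_def)
qed

lemma term_expectation:
  assumes int: "integrable M (realized y)"
  shows "C_N \<epsilon> u0 *\<^sub>R (LINT \<omega>|M. of_bool (n_hops n \<omega>) *\<^sub>R realized_weight y \<omega>) = uF_term V \<epsilon> \<delta> t Q P S A y n"
proof -
  let ?N = "LINT z|lborel. cmod (init_amp \<epsilon> u0 (fst z) (snd z))"
  let ?g = "\<lambda>x. indicator (time_simplex n t) (snd x) *\<^sub>R uF_integrand V \<epsilon> t Q P S A y (fst (fst x)) (snd (fst x)) (times n (snd x))"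
  let ?c = "(- \<i> * \<delta> / \<epsilon>) ^ n / complex_of_real ?N"
  have c0: "?c \<noteq> 0" using normalization_neq_0 eps_pos delta_pos by simp
  have rw: "integrable M (realized_weight y)"
    unfolding realized_weight_def[abs_def] using int
    by (intro Bochner_Integration.integrable_add integrable_bounded_linear[OF bounded_linear_fst] integrable_bounded_linear[OF bounded_linear_snd])
  have [measurable]: "(\<lambda>\<omega>. of_bool (n_hops n \<omega>) :: real) \<in> borel_measurable M" unfolding of_bool_def by measurable
  have [measurable]: "realized_weight y \<in> borel_measurable M" using rw by simp
  have pm [measurable]: "(\<lambda>\<omega>. path_weight y n (hops n \<omega>)) \<in> borel_measurable M"
    by (rule measurable_compose[OF hops_measurable path_weight_measurable])
  have ae: "AE \<omega> in M. of_bool (n_hops n \<omega>) *\<^sub>R realized_weight y \<omega> = of_bool (n_hops n \<omega>) *\<^sub>R path_weight y n (hops n \<omega>)"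
    using AE_good AE_no_hop_at_end
    by eventually_elim (auto simp: realized_weight_def of_bool_def realized_eq_path_weight)
  have "integrable M (\<lambda>\<omega>. of_bool (n_hops n \<omega>) *\<^sub>R realized_weight y \<omega>)"
    by (rule Bochner_Integration.integrable_bound[OF rw]) (auto simp: of_bool_def)
  then have "integrable M (\<lambda>\<omega>. of_bool (n_hops n \<omega>) *\<^sub>R path_weight y n (hops n \<omega>))"
    by (rule Bochner_Integration.integrable_cong_AE_imp) (use ae in auto)
  then have "integrable (path_space n) (\<lambda>x. path_density n x *\<^sub>R path_weight y n x)"
    unfolding path_expectation(1)[OF path_weight_measurable] .
  then have "integrable (path_space n) (\<lambda>x. ?c * ?g x)" unfolding path_density_times_weight .
  then have "integrable (path_space n) (\<lambda>x. inverse ?c * (?c * ?g x))" by (rule integrable_mult_right)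
  moreover have "inverse ?c * (?c * z) = z" for z using left_inverse[OF c0] by (simp only: mult.assoc[symmetric]) simp
  ultimately have g_int: "integrable (path_space n) ?g" by (simp only:)
  have "(LINT \<omega>|M. of_bool (n_hops n \<omega>) *\<^sub>R realized_weight y \<omega>) = (LINT \<omega>|M. of_bool (n_hops n \<omega>) *\<^sub>R path_weight y n (hops n \<omega>))"
    by (rule integral_cong_AE) (use ae in auto)
  also have "\<dots> = (LINT x|path_space n. path_density n x *\<^sub>R path_weight y n x)"
    by (rule path_expectation(2)[OF path_weight_measurable])
  also have "\<dots> = ?c * (LINT x|path_space n. ?g x)"
    unfolding path_density_times_weight by (rule integral_mult_right_zero)
  also have "(LINT x|path_space n. ?g x) = (LINT z|lborel. LINT \<tau>|Pi\<^sub>M {1..n} (\<lambda>_. lborel). ?g (z, \<tau>))"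
  proof -
    interpret T: product_sigma_finite "\<lambda>_::nat. lborel :: real measure" ..
    interpret F: sigma_finite_measure "Pi\<^sub>M {1..n} (\<lambda>_. lborel :: real measure)" by (rule T.sigma_finite) simp
    interpret pair_sigma_finite "lborel :: ((real^'m) \<times> (real^'m)) measure" "Pi\<^sub>M {1..n} (\<lambda>_. lborel :: real measure)" ..
    show ?thesis
      using integral_fst'[of ?g] g_int unfolding path_space_def by simp
  qed
  finally have E: "(LINT \<omega>|M. of_bool (n_hops n \<omega>) *\<^sub>R realized_weight y \<omega>)
      = ?c * (LINT z|lborel. LINT \<tau>|Pi\<^sub>M {1..n} (\<lambda>_. lborel). ?g (z, \<tau>))" .
  have "complex_of_real (C_N \<epsilon> u0) * ?c = (- \<i> * \<delta> / \<epsilon>) ^ n * complex_of_real (1 / (2 * pi * \<epsilon>) powr (3 * real CARD('m) / 2))"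
    using normalization_neq_0 by (simp add: C_N_def)
  then have "C_N \<epsilon> u0 *\<^sub>R (?c * I) = (- \<i> * \<delta> / \<epsilon>) ^ n * complex_of_real (1 / (2 * pi * \<epsilon>) powr (3 * real CARD('m) / 2)) * I" for I
    by (simp only: scaleR_conv_of_real mult.assoc[symmetric])
  then show ?thesis
    unfolding E uF_term_def set_lebesgue_integral_def by (simp only: fst_conv snd_conv)
qed

text \<open>Almost surely at most one summand is nonzero, so the partial sums are either zero or equal to the limit; dominated
convergence applies with the random variable itself.\<close>

lemma parity_sums:
  assumes int: "integrable M (realized y)" and proj: "(proj = fst \<and> r = 0) \<or> (proj = snd \<and> r = 1)"
  shows "(\<lambda>k. LINT \<omega>|M. of_bool (n_hops (2 * k + r) \<omega>) *\<^sub>R realized_weight y \<omega>) sums (LINT \<omega>|M. proj (realized y \<omega>))"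
proof -
  let ?f = "\<lambda>k \<omega>. of_bool (n_hops (2 * k + r) \<omega>) *\<^sub>R realized_weight y \<omega>"
  have bl: "bounded_linear (proj :: complex \<times> complex \<Rightarrow> complex)"
    using proj bounded_linear_fst bounded_linear_snd by auto
  have pint: "integrable M (\<lambda>\<omega>. proj (realized y \<omega>))" by (rule integrable_bounded_linear[OF bl int])
  have rw: "integrable M (realized_weight y)"
    unfolding realized_weight_def[abs_def] using int
    by (intro Bochner_Integration.integrable_add integrable_bounded_linear[OF bounded_linear_fst] integrable_bounded_linear[OF bounded_linear_snd])
  have [measurable]: "realized_weight y \<in> borel_measurable M" using rw by simp
  have fm: "?f k \<in> borel_measurable M" for k unfolding of_bool_def by measurable
  have fint: "integrable M (?f k)" for k
    by (rule Bochner_Integration.integrable_bound[OF rw fm]) (auto simp: of_bool_def)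
  have partial: "AE \<omega> in M. \<exists>K. \<forall>m. (\<Sum>k<m. ?f k \<omega>) = (if K < m then proj (realized y \<omega>) else 0) \<or> (\<Sum>k<m. ?f k \<omega>) = proj (realized y \<omega>)"
    using AE_good AE_no_hop_at_end
  proof eventually_elim
    case (elim \<omega>)
    define n where "n = level_path.count t (\<lambda>s. l s \<omega>) t"
    have nh: "n_hops k \<omega> \<longleftrightarrow> k = n" for k using n_hops_iff[OF elim(1)] by (auto simp: n_def)
    have re: "realized y \<omega> = (path_weight y n (hops n \<omega>) * of_bool (even n), path_weight y n (hops n \<omega>) * of_bool (odd n))"
      using elim nh by (intro realized_eq_path_weight) auto
    have r: "r = 0 \<or> r = 1" using proj by auto
    show ?case
    proof (cases "n mod 2 = r")
      case True
      then have n: "n = 2 * (n div 2) + r" by presburger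
      have "?f k \<omega> = (if k = n div 2 then proj (realized y \<omega>) else 0)" for k
      proof (cases "k = n div 2")
        case True
        then have "n_hops (2 * k + r) \<omega>" using n nh by simp
        moreover have "proj (realized y \<omega>) = realized_weight y \<omega>"
          using proj \<open>n mod 2 = r\<close> by (auto simp: re realized_weight_def even_iff_mod_2_eq_zero odd_iff_mod_2_eq_one)
        ultimately show ?thesis using True by simp
      next
        case False
        then have "\<not> n_hops (2 * k + r) \<omega>" using r nh by auto
        then show ?thesis using False by simp
      qed
      then show ?thesis by (intro exI[of _ "n div 2"]) simp
    next
      case False
      have f0: "?f k \<omega> = 0" for k using False nh r by auto
      have "proj (realized y \<omega>) = 0"
        using proj False by (auto simp: re even_iff_mod_2_eq_zero odd_iff_mod_2_eq_one)
      then show ?thesis by (simp only: f0 sum.neutral_const simp_thms)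
    qed
  qed
  have "(\<lambda>m. LINT \<omega>|M. (\<Sum>k<m. ?f k \<omega>)) \<longlonglongrightarrow> (LINT \<omega>|M. proj (realized y \<omega>))"
  proof (rule integral_dominated_convergence[where w = "\<lambda>\<omega>. norm (proj (realized y \<omega>))"])
    show "(\<lambda>\<omega>. proj (realized y \<omega>)) \<in> borel_measurable M" using pint by simp
    show "(\<lambda>\<omega>. \<Sum>k<m. ?f k \<omega>) \<in> borel_measurable M" for m by (intro borel_measurable_sum fm)
    show "integrable M (\<lambda>\<omega>. norm (proj (realized y \<omega>)))" using pint by (rule integrable_norm)
    show "AE \<omega> in M. (\<lambda>m. \<Sum>k<m. ?f k \<omega>) \<longlonglongrightarrow> proj (realized y \<omega>)"
      using partial
    proof eventually_elim
      case (elim \<omega>)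
      then obtain K where K: "\<And>m. (\<Sum>k<m. ?f k \<omega>) = (if K < m then proj (realized y \<omega>) else 0) \<or> (\<Sum>k<m. ?f k \<omega>) = proj (realized y \<omega>)"
        by blast
      have "\<forall>\<^sub>F m in sequentially. (\<Sum>k<m. ?f k \<omega>) = proj (realized y \<omega>)"
        using eventually_gt_at_top[of K]
      proof eventually_elim
        case (elim m)
        with K[of m] show ?case by (simp only: if_True simp_thms)
      qed
      then show ?case by (rule tendsto_eventually)
    qed
    show "AE \<omega> in M. norm (\<Sum>k<m. ?f k \<omega>) \<le> norm (proj (realized y \<omega>))" for m
      using partial
    proof eventually_elim
      case (elim \<omega>)
      then obtain K where "(\<Sum>k<m. ?f k \<omega>) = (if K < m then proj (realized y \<omega>) else 0) \<or> (\<Sum>k<m. ?f k \<omega>) = proj (realized y \<omega>)"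
        by blast
      then consider "(\<Sum>k<m. ?f k \<omega>) = 0" | "(\<Sum>k<m. ?f k \<omega>) = proj (realized y \<omega>)" by (cases "K < m") (simp_all only: if_True if_False, blast+)
      then show ?case by cases (simp_all only: norm_zero norm_ge_zero order_refl)
    qed
  qed
  moreover have "(LINT \<omega>|M. (\<Sum>k<m. ?f k \<omega>)) = (\<Sum>k<m. LINT \<omega>|M. ?f k \<omega>)" for m
    by (intro Bochner_Integration.integral_sum fint)
  ultimately show ?thesis unfolding sums_def by simp
qed

lemma average_eq_ansatz:
  assumes int: "integrable M (realized y)"
  shows "summable (\<lambda>k. uF_term V \<epsilon> \<delta> t Q P S A y (2 * k))
       \<and> summable (\<lambda>k. uF_term V \<epsilon> \<delta> t Q P S A y (2 * k + 1))
       \<and> u_avg M V \<epsilon> \<delta> u0 t Q P S A Qp Pp l y = uF V \<epsilon> \<delta> t Q P S A y"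
proof -
  have s: "(\<lambda>k. uF_term V \<epsilon> \<delta> t Q P S A y (2 * k + r)) sums (C_N \<epsilon> u0 *\<^sub>R (LINT \<omega>|M. proj (realized y \<omega>)))"
    if "(proj = fst \<and> r = 0) \<or> (proj = snd \<and> r = 1)" for proj r
    using sums_scaleR_right[OF parity_sums[OF int that], of "C_N \<epsilon> u0"] by (simp only: term_expectation[OF int])
  have s0: "(\<lambda>k. uF_term V \<epsilon> \<delta> t Q P S A y (2 * k)) sums (C_N \<epsilon> u0 *\<^sub>R (LINT \<omega>|M. fst (realized y \<omega>)))"
    using s[of fst 0] by simp
  have s1: "(\<lambda>k. uF_term V \<epsilon> \<delta> t Q P S A y (2 * k + 1)) sums (C_N \<epsilon> u0 *\<^sub>R (LINT \<omega>|M. snd (realized y \<omega>)))"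
    using s[of snd 1] by simp
  have "u_avg M V \<epsilon> \<delta> u0 t Q P S A Qp Pp l y = C_N \<epsilon> u0 *\<^sub>R (LINT \<omega>|M. realized y \<omega>)"
    by (simp only: u_avg_def realized_def)
  also have "\<dots> = (C_N \<epsilon> u0 *\<^sub>R (LINT \<omega>|M. fst (realized y \<omega>)), C_N \<epsilon> u0 *\<^sub>R (LINT \<omega>|M. snd (realized y \<omega>)))"
    using integral_bounded_linear[OF bounded_linear_fst int] integral_bounded_linear[OF bounded_linear_snd int]
    by (simp add: prod_eq_iff)
  also have "\<dots> = uF V \<epsilon> \<delta> t Q P S A y"
    unfolding uF_def using sums_unique[OF s0] sums_unique[OF s1] by simp
  finally show ?thesis using sums_summable[OF s0] sums_summable[OF s1] by blast
qed

end

theorem mainTheorem1: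
  fixes V :: "'m::finite potential"
    and u0 :: "real^'m \<Rightarrow> complex"
    and \<epsilon> \<delta> t :: real
    and Q P :: "real list \<Rightarrow> real^'m \<Rightarrow> real^'m \<Rightarrow> real \<Rightarrow> real^'m"
    and S :: "real list \<Rightarrow> real^'m \<Rightarrow> real^'m \<Rightarrow> real \<Rightarrow> real"
    and A :: "real list \<Rightarrow> real^'m \<Rightarrow> real^'m \<Rightarrow> real \<Rightarrow> complex"
    and M :: "'w measure"
    and Qp Pp :: "real \<Rightarrow> 'w \<Rightarrow> real^'m"
    and l :: "real \<Rightarrow> 'w \<Rightarrow> nat"
    and x :: "real^'m"
  assumes "\<epsilon> > 0" and "\<delta> > 0" and "t \<ge> 0"
    and "hermitian_potential V"
    and "C2 (surface V 0)" and "C2 (surface V 1)" and "continuous_on UNIV (V 0 1)"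
    and "u0 \<in> borel_measurable borel"
    and "\<And>ts. hop_times t ts \<Longrightarrow> trajectory V \<epsilon> u0 t ts (Q ts) (P ts) (S ts) (A ts)"
    and "hopping_process M V \<epsilon> \<delta> u0 t Qp Pp l"
    and "integrable M (avg_integrand V \<epsilon> \<delta> u0 t Q P S A Qp Pp l x)"
  shows "summable (\<lambda>k. uF_term V \<epsilon> \<delta> t Q P S A x (2 * k))
       \<and> summable (\<lambda>k. uF_term V \<epsilon> \<delta> t Q P S A x (2 * k + 1))
       \<and> u_avg M V \<epsilon> \<delta> u0 t Q P S A Qp Pp l x = uF V \<epsilon> \<delta> t Q P S A x"
  proof -
  have "smooth_surfaces V" using assms(5,6) by (rule smooth_surfaces.intro)
  then have "hopping_flow V u0 \<epsilon> t Q P S A"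
    by (rule hopping_flow.intro) (rule hopping_flow_axioms.intro; fact)
  then have "hopping_model V u0 \<epsilon> t Q P S A \<delta>"
    by (rule hopping_model.intro) (rule hopping_model_axioms.intro; fact)
  then interpret hopping_process_model V u0 \<epsilon> t Q P S A \<delta> M Qp Pp l
    by (rule hopping_process_model.intro) (rule hopping_process_model_axioms.intro; fact)
  show ?thesis by (rule average_eq_ansatz) (unfold realized_def, fact)
qed

end
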